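(* Suppose the Markov chain $\Xi$ on $\mathbb X\subseteq\mathbb R$ satisfies (N$'$), $(\mathrm T^{\mathrm{bal}}_{\alpha,c})$ and $(\mathrm D'_{\gamma,b})$. Then: (i) if $\gamma>\alpha-1$, $\Xi$ is null recurrent; (ii) if $\gamma<\alpha-1$ and $b<0$, $\Xi$ is positive recurrent; (iii) if $\gamma<\alpha-1$ and $b>0$, $\Xi$ is directional transient; (iv) if $\gamma=\alpha-1$ and $b+c\pi\cot(\frac{\pi\alpha}2)<0$, $\Xi$ is null recurrent. If in addition the four limits in $(\mathrm T^{\mathrm{bal}}_{\alpha,c})$ are strengthened to: each of the four suprema is $O(y^{-\delta})$ as $y\to\infty$ for some $\delta>0$, then (v) if $\gamma=\alpha-1$ and $b+c\pi\cot(\frac{\pi\alpha}2)>0$, $\Xi$ is oscillatory transient.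
   Context: $\Xi=(\xi_n)_{n\ge0}$ is a time-homogeneous Markov chain on an infinite, unbounded, measurable $\mathbb X\subseteq\mathbb R$. $\mathbb P_x,\mathbb E_x$ refer to the chain started at $x$; $\theta:=\xi_1-\xi_0$; $y_+:=y\mathbf 1\{y\ge0\}$, $y_-:=-y\mathbf 1\{y<0\}$; $\mu(x):=\mathbb E_x[\theta]$; $\tau_a:=\min\{n\ge0:|\xi_n|\le a\}$. $\Xi$ is recurrent if $\liminf_n|\xi_n|\le r_0$ a.s. for some deterministic $r_0$; positive recurrent if $\mathbb E_x[\tau_a]<\infty$ for all large $a$ and all $x$; null recurrent if recurrent and $\mathbb E_x[\tau_a]=\infty$ for all large $a$ and $|x|>a$; directional transient if $\lim_n\xi_n\in\{-\infty,+\infty\}$ a.s.; oscillatory transient if a.s. $|\xi_n|\to\infty$, $\liminf_n\xi_n=-\infty$ and $\limsup_n\xi_n=+\infty$. (N$'$): $\limsup_n|\xi_n|=+\infty$ a.s. $(\mathrm T^{\mathrm{bal}}_{\alpha,c})$: there exist $\alpha\in(1,2)$, $c>0$, $x_0\in\mathbb R_+$ such that, as $y\to\infty$, each of $\sup_{x\ge x_0}|y^\alpha\mathbb P_x[\theta_+>y]-c|$, $\sup_{x\ge x_0}|y^\alpha\mathbb P_x[\theta_->y]-c|$, $\sup_{x\le-x_0}|y^\alpha\mathbb P_x[\theta_+>y]-c|$, $\sup_{x\le-x_0}|y^\alpha\mathbb P_x[\theta_->y]-c|$ tends to $0$. $(\mathrm D'_{\gamma,b})$: there exist $\gamma\ge0$,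 $b\in\mathbb R$ with $\lim_{x\to+\infty}x^\gamma\mu(x)=\lim_{x\to-\infty}(-|x|^\gamma\mu(x))=b$. *)

theory Defs
  imports "HOL-Probability.Probability"
begin

definition pos_part_r :: "real \<Rightarrow> real" where
  "pos_part_r y = (if y \<ge> 0 then y else 0)"

definition neg_part_r :: "real \<Rightarrow> real" where
  "neg_part_r y = (if y < 0 then - y else 0)"

text \<open>The chain is given by a state space X, a transition kernel K (K x is the law of
  xi_1 under P_x), and for each starting point x a probability space M x (this is P_x)
  carrying the process xi.  theta = xi_1 - xi_0, so under P_x its law is that of z - x, z ~ K x.\<close>

definition markov_chain ::
  "real set \<Rightarrow> (real \<Rightarrow> real measure) \<Rightarrow> (real \<Rightarrow> 'a measure) \<Rightarrow> (nat \<Rightarrow> 'a \<Rightarrow> real) \<Rightarrow> bool" where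
  "markov_chain X K M \<xi> \<longleftrightarrow>
     X \<in> sets borel \<and> infinite X \<and> \<not> bounded X \<and>
     (\<forall>x\<in>X. prob_space (K x) \<and> sets (K x) = sets borel \<and> measure (K x) X = 1) \<and>
     (\<forall>A\<in>sets borel. (\<lambda>x. measure (K x) A) \<in> borel_measurable (restrict_space borel X)) \<and>
     (\<forall>x\<in>X. prob_space (M x) \<and>
        (\<forall>n. \<xi> n \<in> borel_measurable (M x)) \<and>
        (AE \<omega> in M x. \<xi> 0 \<omega> = x) \<and>
        (\<forall>n. \<forall>B\<in>sets (PiM {..n} (\<lambda>_. borel)). \<forall>A\<in>sets borel.
           measure (M x) {\<omega>\<in>space (M x). restrict (\<lambda>i. \<xi> i \<omega>) {..n} \<in> B \<and> \<xi> (Suc n) \<omega> \<in> A}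
           = (\<integral>\<omega>. indicator B (restrict (\<lambda>i. \<xi> i \<omega>) {..n}) * measure (K (\<xi> n \<omega>)) A \<partial>M x)))"

definition tail_plus :: "(real \<Rightarrow> real measure) \<Rightarrow> real \<Rightarrow> real \<Rightarrow> real" where
  "tail_plus K x y = measure (K x) {z. pos_part_r (z - x) > y}"

definition tail_minus :: "(real \<Rightarrow> real measure) \<Rightarrow> real \<Rightarrow> real \<Rightarrow> real" where
  "tail_minus K x y = measure (K x) {z. neg_part_r (z - x) > y}"

definition drift :: "(real \<Rightarrow> real measure) \<Rightarrow> real \<Rightarrow> real" where
  "drift K x = (\<integral>z. z - x \<partial>K x)"

definition hit_time :: "(nat \<Rightarrow> 'a \<Rightarrow> real) \<Rightarrow> real \<Rightarrow> 'a \<Rightarrow> ennreal" where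
  "hit_time \<xi> a \<omega> = (if \<exists>n. \<bar>\<xi> n \<omega>\<bar> \<le> a then of_nat (LEAST n. \<bar>\<xi> n \<omega>\<bar> \<le> a) else \<infinity>)"

definition cond_N' :: "real set \<Rightarrow> (real \<Rightarrow> 'a measure) \<Rightarrow> (nat \<Rightarrow> 'a \<Rightarrow> real) \<Rightarrow> bool" where
  "cond_N' X M \<xi> \<longleftrightarrow> (\<forall>x\<in>X. AE \<omega> in M x. limsup (\<lambda>n. ereal \<bar>\<xi> n \<omega>\<bar>) = \<infinity>)"

definition recurrent :: "real set \<Rightarrow> (real \<Rightarrow> 'a measure) \<Rightarrow> (nat \<Rightarrow> 'a \<Rightarrow> real) \<Rightarrow> bool" where
  "recurrent X M \<xi> \<longleftrightarrow>
     (\<exists>r0::real. \<forall>x\<in>X. AE \<omega> in M x. liminf (\<lambda>n. ereal \<bar>\<xi> n \<omega>\<bar>) \<le> ereal r0)"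

definition positive_recurrent :: "real set \<Rightarrow> (real \<Rightarrow> 'a measure) \<Rightarrow> (nat \<Rightarrow> 'a \<Rightarrow> real) \<Rightarrow> bool" where
  "positive_recurrent X M \<xi> \<longleftrightarrow>
     (\<exists>a0. \<forall>a\<ge>a0. \<forall>x\<in>X. (\<integral>\<^sup>+\<omega>. hit_time \<xi> a \<omega> \<partial>M x) < \<infinity>)"

definition null_recurrent :: "real set \<Rightarrow> (real \<Rightarrow> 'a measure) \<Rightarrow> (nat \<Rightarrow> 'a \<Rightarrow> real) \<Rightarrow> bool" where
  "null_recurrent X M \<xi> \<longleftrightarrow> recurrent X M \<xi> \<and>
     (\<exists>a0. \<forall>a\<ge>a0. \<forall>x\<in>X. \<bar>x\<bar> > a \<longrightarrow> (\<integral>\<^sup>+\<omega>. hit_time \<xi> a \<omega> \<partial>M x) = \<infinity>)"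

definition directional_transient :: "real set \<Rightarrow> (real \<Rightarrow> 'a measure) \<Rightarrow> (nat \<Rightarrow> 'a \<Rightarrow> real) \<Rightarrow> bool" where
  "directional_transient X M \<xi> \<longleftrightarrow>
     (\<forall>x\<in>X. AE \<omega> in M x. filterlim (\<lambda>n. \<xi> n \<omega>) at_top sequentially \<or>
                             filterlim (\<lambda>n. \<xi> n \<omega>) at_bot sequentially)"

definition oscillatory_transient :: "real set \<Rightarrow> (real \<Rightarrow> 'a measure) \<Rightarrow> (nat \<Rightarrow> 'a \<Rightarrow> real) \<Rightarrow> bool" where
  "oscillatory_transient X M \<xi> \<longleftrightarrow>
     (\<forall>x\<in>X. AE \<omega> in M x. filterlim (\<lambda>n. \<bar>\<xi> n \<omega>\<bar>) at_top sequentially \<and>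
                             liminf (\<lambda>n. ereal (\<xi> n \<omega>)) = - \<infinity> \<and>
                             limsup (\<lambda>n. ereal (\<xi> n \<omega>)) = \<infinity>)"

text \<open>The four quantities whose suprema appear in (T^bal):
  sup over x >= x0 (resp. x <= -x0) in X of |y^alpha P_x[theta_pm > y] - c|.
  "sup_{x in S} f x \<le> e" is written as "\<forall>x\<in>S. f x \<le> e".\<close>
definition tail_dev_bound ::
  "real set \<Rightarrow> (real \<Rightarrow> real measure) \<Rightarrow> real \<Rightarrow> real \<Rightarrow> real \<Rightarrow> real \<Rightarrow> real \<Rightarrow> bool" where
  "tail_dev_bound X K \<alpha> c x0 y e \<longleftrightarrow>
     (\<forall>x\<in>X. x \<ge> x0 \<longrightarrow> \<bar>y powr \<alpha> * tail_plus K x y - c\<bar> \<le> e) \<and>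
     (\<forall>x\<in>X. x \<ge> x0 \<longrightarrow> \<bar>y powr \<alpha> * tail_minus K x y - c\<bar> \<le> e) \<and>
     (\<forall>x\<in>X. x \<le> - x0 \<longrightarrow> \<bar>y powr \<alpha> * tail_plus K x y - c\<bar> \<le> e) \<and>
     (\<forall>x\<in>X. x \<le> - x0 \<longrightarrow> \<bar>y powr \<alpha> * tail_minus K x y - c\<bar> \<le> e)"

definition cond_Tbal :: "real set \<Rightarrow> (real \<Rightarrow> real measure) \<Rightarrow> real \<Rightarrow> real \<Rightarrow> bool" where
  "cond_Tbal X K \<alpha> c \<longleftrightarrow> 1 < \<alpha> \<and> \<alpha> < 2 \<and> c > 0 \<and>
     (\<exists>x0\<ge>0. \<forall>e>0. \<exists>Y. \<forall>y\<ge>Y. tail_dev_bound X K \<alpha> c x0 y e)"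

definition cond_Tbal_rate :: "real set \<Rightarrow> (real \<Rightarrow> real measure) \<Rightarrow> real \<Rightarrow> real \<Rightarrow> bool" where
  "cond_Tbal_rate X K \<alpha> c \<longleftrightarrow> 1 < \<alpha> \<and> \<alpha> < 2 \<and> c > 0 \<and>
     (\<exists>x0\<ge>0. \<exists>\<delta>>0. \<exists>C Y. \<forall>y\<ge>Y. tail_dev_bound X K \<alpha> c x0 y (C * y powr (- \<delta>)))"

definition cond_D' :: "real set \<Rightarrow> (real \<Rightarrow> real measure) \<Rightarrow> real \<Rightarrow> real \<Rightarrow> bool" where
  "cond_D' X K \<gamma> b \<longleftrightarrow> \<gamma> \<ge> 0 \<and>
     ((\<lambda>x. x powr \<gamma> * drift K x) \<longlongrightarrow> b) (inf at_top (principal X)) \<and>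
     ((\<lambda>x. - (\<bar>x\<bar> powr \<gamma> * drift K x)) \<longlongrightarrow> b) (inf at_bot (principal X))"

end

theory Submission
  imports Defs "HOL-Real_Asymp.Real_Asymp"
begin

text \<open>
  Every case rests on a Lyapunov function \<open>f\<close> of the position, evaluated along one step of the chain:
  \<open>|x|\<close> to the power \<open>1 + \<gamma>\<close> (positive recurrence), a truncated negative power of \<open>x\<close> or of \<open>|x|\<close>
  (transience), \<open>log |x|\<close> (recurrence at criticality), and the one-sided \<open>log x\<close> (the walk cannot
  stay on one half-line). All of them are Box--Cox functions \<open>(u powr p - 1) / p\<close>, cut off at a small
  multiple \<open>e |x|\<close> of the starting distance. By a layer-cake formula the expected increment is an
  integral of the tails of the step against the derivative of \<open>f\<close>. By dominated convergence, the
  expected increment at criticality, multiplied by \<open>|x| powr (\<alpha> - p)\<close>, tends to \<open>b + c J(p, e)\<close>,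
  and \<open>J(p, e)\<close> is continuous at \<open>p = 0\<close>. The integral \<open>J(0, e)\<close> tends to \<open>\<pi> cot (\<pi> \<alpha> / 2)\<close> as
  \<open>e\<close> tends to 0, by a geometric expansion and the reflection formula for the Gamma function.

  The rate of convergence in the last case is needed to control a step into a bounded
  neighbourhood of the origin, where a negative power of \<open>|x|\<close> is large. Null recurrence follows since a
  return from distance \<open>z\<close> takes time of order \<open>z powr \<alpha>\<close>, and the step has no moment of order \<open>\<alpha>\<close>.
\<close>

subsection \<open>The Markov property\<close>

text \<open>The obstacle is the origin. Logarithms and negative powers are singular there, while the
  balanced tail condition fixes the tails only up to a relative error and so says nothing about the
  chance of landing in a small ball around 0. Cutting off at \<open>e |x|\<close> removes the
  singularity. For the logarithm the cut-off enlarges the function, which is harmless in an upper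
  bound, so recurrence needs no rate. For a negative power it lowers the function, and the missing
  part must be paid for. As e tends to 0, the two-sided jump integral becomes a principal value at
  the singularity, and this is the cot term of the threshold. The one-sided integral has nothing to
  cancel against and tends to minus infinity; hence no value of b can hold the walk on one
  half-line. No martingale theory is involved. Hitting and escape statements are inductions on the
  number of steps for the kernel functions \<open>surv A m\<close>, and \<open>markov_surv\<close>
  carries them to the measures \<open>M x\<close>. The range \<gamma> > \<alpha> - 1 is the critical
  case with b = 0: the drift vanishes on the critical scale, and cot is negative on (pi/2,
  pi).\<close>

lemma limsup_inf_large:
  assumes "limsup (\<lambda>n. ereal \<bar>s n\<bar>) = \<infinity>"
  shows "\<exists>j. r \<le> \<bar>s (n + j)\<bar>"
proof (rule ccontr)
  assume "\<not> ?thesis"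
  then have *: "\<bar>s (n + j)\<bar> < r" for j by (auto simp: not_le)
  have "limsup (\<lambda>n. ereal \<bar>s n\<bar>) \<le> ereal r"
    by (rule Limsup_bounded) (use * in \<open>auto simp: eventually_sequentially intro!: exI[of _ n] dest!: le_Suc_ex less_imp_le\<close>)
  then show False using assms by simp
qed

locale chain =
  fixes X :: "real set" and K :: "real \<Rightarrow> real measure"
    and M :: "real \<Rightarrow> 'a measure" and \<xi> :: "nat \<Rightarrow> 'a \<Rightarrow> real"
  assumes chain: "markov_chain X K M \<xi>"
begin

text \<open>The kernel \<open>K\<close> is arbitrary outside \<open>X\<close>; there it is replaced by a point mass to make it measurable.\<close>

definition Q :: "real \<Rightarrow> real measure" where
  "Q z = (if z \<in> X then K z else return borel z)"

lemma X_borel [measurable]: "X \<in> sets borel"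
  using chain unfolding markov_chain_def by blast

lemma K_props:
  assumes "x \<in> X"
  shows "prob_space (K x)" "sets (K x) = sets borel" "measure (K x) X = 1"
  using chain assms unfolding markov_chain_def by blast+

lemma Q_eq: "x \<in> X \<Longrightarrow> Q x = K x"
  by (simp add: Q_def)

lemma sets_Q [simp, measurable_cong]: "sets (Q z) = sets borel"
  by (simp add: Q_def K_props)

lemma space_Q [simp]: "space (Q z) = UNIV"
  using sets_eq_imp_space_eq[OF sets_Q[of z]] by simp

lemma prob_Q: "prob_space (Q z)"
  by (auto simp: Q_def K_props intro!: prob_space_return)

lemma Q_measurable [measurable]: "Q \<in> borel \<rightarrow>\<^sub>M subprob_algebra borel"
proof (rule measurable_subprob_algebra)
  show "subprob_space (Q a)" for a
    by (rule prob_space_imp_subprob_space[OF prob_Q])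
  show "sets (Q a) = sets borel" for a by simp
  fix A :: "real set" assume A[measurable]: "A \<in> sets borel"
  have 1: "(\<lambda>x. measure (K x) A) \<in> borel_measurable (restrict_space borel X)"
    using chain A unfolding markov_chain_def by blast
  have eq: "(\<lambda>a. emeasure (Q a) A) = (\<lambda>a. if a \<in> X then ennreal (measure (K a) A) else indicator A a)"
  proof
    fix a
    show "emeasure (Q a) A = (if a \<in> X then ennreal (measure (K a) A) else indicator A a)"
    proof (cases "a \<in> X")
      case True
      then interpret prob_space "K a" using K_props by blast
      show ?thesis using True by (simp add: Q_def emeasure_eq_measure)
    next
      case False then show ?thesis by (simp add: Q_def emeasure_return)
    qed
  qed
  show "(\<lambda>a. emeasure (Q a) A) \<in> borel_measurable borel"
    unfolding eq
    by (rule measurable_If_restrict_space_iff[THEN iffD2])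
       (use 1 in \<open>auto intro!: measurable_restrict_space1\<close>)
qed

lemma AE_Q: assumes "z \<in> X" shows "AE y in Q z. y \<in> X"
proof -
  interpret prob_space "Q z" by (rule prob_Q)
  show ?thesis using K_props(3)[OF assms] by (subst AE_in_set_eq_1) (auto simp: Q_eq[OF assms] K_props[OF assms])
qed

lemma Q_emeasure_UNIV [simp]: "emeasure (Q z) UNIV = 1"
  using prob_space.emeasure_space_1[OF prob_Q, of z] by simp

text \<open>The restriction makes a path a point of \<open>Paths n\<close>, so events of the past up
  to time n are preimages of measurable sets of paths, as in the definition of the chain.\<close>

definition path :: "nat \<Rightarrow> 'a \<Rightarrow> nat \<Rightarrow> real" where
  "path n \<omega> = restrict (\<lambda>i. \<xi> i \<omega>) {..n}"

abbreviation Paths :: "nat \<Rightarrow> (nat \<Rightarrow> real) measure" where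
  "Paths n \<equiv> PiM {..n} (\<lambda>_. borel)"

lemma path_apply [simp]: "i \<le> n \<Longrightarrow> path n \<omega> i = \<xi> i \<omega>"
  by (simp add: path_def)

lemma restrict_path [simp]: "m \<le> n \<Longrightarrow> restrict (path n \<omega>) {..m} = path m \<omega>"
  by (auto simp: path_def restrict_def)

context
  fixes x assumes x: "x \<in> X"
begin

lemma prob_M: "prob_space (M x)"
  using chain x unfolding markov_chain_def by blast

lemma xi_meas [measurable]: "\<xi> n \<in> borel_measurable (M x)"
  using chain x unfolding markov_chain_def by blast

lemma xi_0: "AE \<omega> in M x. \<xi> 0 \<omega> = x"
  using chain x unfolding markov_chain_def by blast

lemma path_meas [measurable]: "path n \<in> M x \<rightarrow>\<^sub>M Paths n"
  unfolding path_def by measurable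

lemma step_raw:
  assumes "B \<in> sets (Paths n)" "A \<in> sets borel"
  shows "measure (M x) {\<omega>\<in>space (M x). path n \<omega> \<in> B \<and> \<xi> (Suc n) \<omega> \<in> A}
           = (\<integral>\<omega>. indicator B (path n \<omega>) * measure (K (\<xi> n \<omega>)) A \<partial>M x)"
  using chain x assms unfolding markov_chain_def path_def by blast

text \<open>The integrand in the definition of the chain may be non-measurable, because \<open>K\<close> is
  arbitrary off \<open>X\<close>; its integral is then the junk value 0. Comparing \<open>A\<close> with its complement
  shows that the identity with \<open>Q\<close> in place of \<open>K\<close> holds in any case.\<close>

lemma step_Q:
  assumes B[measurable]: "B \<in> sets (Paths n)" and A[measurable]: "A \<in> sets borel"
    and inX: "AE \<omega> in M x. \<xi> n \<omega> \<in> X"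
  shows "measure (M x) {\<omega>\<in>space (M x). path n \<omega> \<in> B \<and> \<xi> (Suc n) \<omega> \<in> A}
           = (\<integral>\<omega>. indicator B (path n \<omega>) * measure (Q (\<xi> n \<omega>)) A \<partial>M x)"
proof -
  interpret prob_space "M x" by (rule prob_M)
  define L where "L A = measure (M x) {\<omega>\<in>space (M x). path n \<omega> \<in> B \<and> \<xi> (Suc n) \<omega> \<in> A}" for A
  define I where "I A = (\<integral>\<omega>. indicator B (path n \<omega>) * measure (K (\<xi> n \<omega>)) A \<partial>M x)" for A
  define J where "J A = (\<integral>\<omega>. indicator B (path n \<omega>) * measure (Q (\<xi> n \<omega>)) A \<partial>M x)" for A
  define p where "p = measure (M x) {\<omega>\<in>space (M x). path n \<omega> \<in> B}"
  have Qm[measurable]: "(\<lambda>z. measure (Q z) A) \<in> borel_measurable borel" if [measurable]: "A \<in> sets borel" for A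
    by measurable
  have Q1: "measure (Q z) A \<le> 1" for z A by (rule prob_space.prob_le_1[OF prob_Q])
  have LI: "L A = I A" if "A \<in> sets borel" for A
    unfolding L_def I_def by (rule step_raw[OF B that])
  have IJ: "I A = J A \<or> I A = 0" if [measurable]: "A \<in> sets borel" for A
  proof (cases "(\<lambda>\<omega>. indicator B (path n \<omega>) * measure (K (\<xi> n \<omega>)) A) \<in> borel_measurable (M x)")
    case True
    have "I A = J A" unfolding I_def J_def
      by (rule integral_cong_AE[OF True]) (use inX in \<open>auto simp: Q_eq\<close>)
    then show ?thesis ..
  next
    case False
    then have "I A = 0" unfolding I_def
      by (intro not_integrable_integral_eq) (use borel_measurable_integrable in blast)
    then show ?thesis ..
  qed
  have Jint: "integrable (M x) (\<lambda>\<omega>. indicator B (path n \<omega>) * measure (Q (\<xi> n \<omega>)) A)"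
    if [measurable]: "A \<in> sets borel" for A
    by (rule integrable_const_bound[where B=1]) (auto simp: indicator_def Q1)
  have Lsum: "L A + L (- A) = p"
    unfolding L_def p_def by (subst finite_measure_Union[symmetric]) (auto intro!: arg_cong[where f="measure (M x)"])
  have Jsum: "J A + J (- A) = p"
  proof -
    have 1: "measure (Q z) A + measure (Q z) (- A) = 1" for z
    proof -
      interpret q: prob_space "Q z" by (rule prob_Q)
      show ?thesis using q.prob_compl[of A] by (simp add: Compl_eq_Diff_UNIV)
    qed
    have "J A + J (- A) = (\<integral>\<omega>. indicator B (path n \<omega>) * (measure (Q (\<xi> n \<omega>)) A + measure (Q (\<xi> n \<omega>)) (-A)) \<partial>M x)"
      unfolding J_def by (subst Bochner_Integration.integral_add[symmetric]) (auto simp: Jint algebra_simps)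
    also have "\<dots> = (\<integral>\<omega>. indicator {\<omega>\<in>space (M x). path n \<omega> \<in> B} \<omega> \<partial>M x)"
      by (intro Bochner_Integration.integral_cong) (auto simp: 1 indicator_def)
    also have "\<dots> = p" by (simp add: p_def)
    finally show ?thesis .
  qed
  \<comment> \<open>Nonnegativity settles the mixed cases: if one or both of the integrals with
    \<open>K\<close> are 0, comparing the two sums forces the matching \<open>J\<close> to be 0 as
    well.\<close>
  have J0: "J A \<ge> 0" "J (- A) \<ge> 0"
    unfolding J_def by (intro Bochner_Integration.integral_nonneg; simp)+
  have "L A = J A"
    using IJ[of A] IJ[of "- A"] LI[of A] LI[of "- A"] Lsum Jsum J0 by auto
  then show ?thesis by (simp add: L_def J_def)
qed

text \<open>\<open>step_Q\<close> at time n presupposes the claim at time n, hence the induction: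
  the hypothesis licenses \<open>step_Q\<close> with target X, and \<open>Q z\<close> gives X full
  mass for z in X.\<close>

lemma xi_in_X: "AE \<omega> in M x. \<xi> n \<omega> \<in> X"
proof (induction n)
  case 0 show ?case using xi_0 x by auto
next
  case (Suc n)
  interpret prob_space "M x" by (rule prob_M)
  have *: "{\<omega> \<in> space (M x). path n \<omega> \<in> space (Paths n) \<and> \<xi> (Suc n) \<omega> \<in> X} = {\<omega> \<in> space (M x). \<xi> (Suc n) \<omega> \<in> X}"
    using measurable_space[OF path_meas, of _ n] by auto
  have "prob {\<omega>\<in>space (M x). \<xi> (Suc n) \<omega> \<in> X}
      = (\<integral>\<omega>. indicator (space (Paths n)) (path n \<omega>) * measure (Q (\<xi> n \<omega>)) X \<partial>M x)"
    using step_Q[OF sets.top[of "Paths n"] X_borel Suc] * by simp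
  also have "\<dots> = (\<integral>\<omega>. 1 \<partial>M x)"
  proof (rule integral_cong_AE)
    show "AE \<omega> in M x. indicator (space (Paths n)) (path n \<omega>) * measure (Q (\<xi> n \<omega>)) X = 1"
      using Suc AE_space
    proof eventually_elim
      case (elim \<omega>)
      then show ?case using measurable_space[OF path_meas, of \<omega> n]
        by (simp add: Q_eq K_props)
    qed
  qed auto
  also have "\<dots> = 1" by (simp add: prob_space)
  finally show ?case
    by (subst (asm) prob_Collect_eq_1) auto
qed

text \<open>Extension of \<open>step_Q\<close> from sets to functions by the usual induction. Values
  in \<open>ennreal\<close> avoid all integrability conditions, and the event B of the past is kept
  because the later arguments decompose along it.\<close>

lemma step_nn:
  assumes B[measurable]: "B \<in> sets (Paths n)" and g[measurable]: "g \<in> borel_measurable borel"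
  shows "(\<integral>\<^sup>+\<omega>. indicator B (path n \<omega>) * g (\<xi> (Suc n) \<omega>) \<partial>M x)
       = (\<integral>\<^sup>+\<omega>. indicator B (path n \<omega>) * (\<integral>\<^sup>+y. g y \<partial>Q (\<xi> n \<omega>)) \<partial>M x)"
  using g
proof (induction g rule: borel_measurable_induct)
  case (cong f g)
  then show ?case
    by (metis (no_types, lifting) UNIV_I nn_integral_cong space_borel)
next
  case (set A)
  then have A[measurable]: "A \<in> sets borel" by simp
  interpret prob_space "M x" by (rule prob_M)
  have "(\<integral>\<^sup>+\<omega>. indicator B (path n \<omega>) * indicator A (\<xi> (Suc n) \<omega>) \<partial>M x)
      = (\<integral>\<^sup>+\<omega>. indicator {\<omega>\<in>space (M x). path n \<omega> \<in> B \<and> \<xi> (Suc n) \<omega> \<in> A} \<omega> \<partial>M x)"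
    by (intro nn_integral_cong) (auto simp: indicator_def)
  also have "\<dots> = ennreal (measure (M x) {\<omega>\<in>space (M x). path n \<omega> \<in> B \<and> \<xi> (Suc n) \<omega> \<in> A})"
    by (subst nn_integral_indicator) (auto simp: emeasure_eq_measure)
  also have "\<dots> = ennreal (\<integral>\<omega>. indicator B (path n \<omega>) * measure (Q (\<xi> n \<omega>)) A \<partial>M x)"
    by (subst step_Q[OF B A xi_in_X]) simp
  also have "\<dots> = (\<integral>\<^sup>+\<omega>. ennreal (indicator B (path n \<omega>) * measure (Q (\<xi> n \<omega>)) A) \<partial>M x)"
    by (rule nn_integral_eq_integral[symmetric])
       (auto intro!: integrable_const_bound[where B=1] simp: indicator_def prob_space.prob_le_1[OF prob_Q])
  also have "\<dots> = (\<integral>\<^sup>+\<omega>. indicator B (path n \<omega>) * (\<integral>\<^sup>+y. indicator A y \<partial>Q (\<xi> n \<omega>)) \<partial>M x)"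
  proof (intro nn_integral_cong)
    fix \<omega>
    interpret q: prob_space "Q (\<xi> n \<omega>)" by (rule prob_Q)
    have "(\<integral>\<^sup>+y. indicator A y \<partial>Q (\<xi> n \<omega>)) = ennreal (measure (Q (\<xi> n \<omega>)) A)"
      by (subst nn_integral_indicator) (auto simp: q.emeasure_eq_measure)
    then show "ennreal (indicator B (path n \<omega>) * measure (Q (\<xi> n \<omega>)) A)
        = indicator B (path n \<omega>) * (\<integral>\<^sup>+y. indicator A y \<partial>Q (\<xi> n \<omega>))"
      by (cases "path n \<omega> \<in> B") auto
  qed
  finally show ?case .
next
  case (mult u c)
  then have [measurable]: "u \<in> borel_measurable borel" by simp
  have "(\<integral>\<^sup>+\<omega>. indicator B (path n \<omega>) * (c * u (\<xi> (Suc n) \<omega>)) \<partial>M x)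
     = c * (\<integral>\<^sup>+\<omega>. indicator B (path n \<omega>) * u (\<xi> (Suc n) \<omega>) \<partial>M x)"
    by (subst nn_integral_cmult[symmetric]) (auto simp: mult_ac)
  also have "\<dots> = (\<integral>\<^sup>+\<omega>. indicator B (path n \<omega>) * (\<integral>\<^sup>+y. c * u y \<partial>Q (\<xi> n \<omega>)) \<partial>M x)"
    unfolding mult.IH by (subst nn_integral_cmult[symmetric]) (auto simp: nn_integral_cmult mult_ac)
  finally show ?case .
next
  case (add u v)
  then have [measurable]: "u \<in> borel_measurable borel" "v \<in> borel_measurable borel" by simp_all
  show ?case
    using add.IH by (simp add: distrib_left nn_integral_add)
next
  case (seq U)
  then have [measurable]: "U i \<in> borel_measurable borel" for i by simp
  have inc: "incseq (\<lambda>i \<omega>. indicator B (path n \<omega>) * U i (\<xi> (Suc n) \<omega>))"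
    using seq(3) by (auto simp: incseq_def le_fun_def intro!: mult_left_mono)
  have inc2: "incseq (\<lambda>i \<omega>. indicator B (path n \<omega>) * (\<integral>\<^sup>+y. U i y \<partial>Q (\<xi> n \<omega>)))"
    using seq(3) by (auto simp: incseq_def le_fun_def intro!: mult_left_mono nn_integral_mono)
  have "(\<integral>\<^sup>+\<omega>. indicator B (path n \<omega>) * (SUP i. U i) (\<xi> (Suc n) \<omega>) \<partial>M x)
     = (\<integral>\<^sup>+\<omega>. (SUP i. indicator B (path n \<omega>) * U i (\<xi> (Suc n) \<omega>)) \<partial>M x)"
    by (simp add: SUP_mult_left_ennreal image_comp)
  also have "\<dots> = (SUP i. \<integral>\<^sup>+\<omega>. indicator B (path n \<omega>) * U i (\<xi> (Suc n) \<omega>) \<partial>M x)"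
    by (rule nn_integral_monotone_convergence_SUP[OF inc]) auto
  also have "\<dots> = (SUP i. \<integral>\<^sup>+\<omega>. indicator B (path n \<omega>) * (\<integral>\<^sup>+y. U i y \<partial>Q (\<xi> n \<omega>)) \<partial>M x)"
    by (simp add: seq)
  also have "\<dots> = (\<integral>\<^sup>+\<omega>. (SUP i. indicator B (path n \<omega>) * (\<integral>\<^sup>+y. U i y \<partial>Q (\<xi> n \<omega>))) \<partial>M x)"
    by (rule nn_integral_monotone_convergence_SUP[OF inc2, symmetric]) auto
  also have "\<dots> = (\<integral>\<^sup>+\<omega>. indicator B (path n \<omega>) * (\<integral>\<^sup>+y. (SUP i. U i) y \<partial>Q (\<xi> n \<omega>)) \<partial>M x)"
  proof (intro nn_integral_cong)
    fix \<omega>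
    have "(SUP i. U i) = (\<lambda>y. SUP i. U i y)" by (simp add: fun_eq_iff image_comp)
    then have "(\<integral>\<^sup>+y. (SUP i. U i) y \<partial>Q (\<xi> n \<omega>)) = (SUP i. \<integral>\<^sup>+y. U i y \<partial>Q (\<xi> n \<omega>))"
      using seq(3) by (simp add: nn_integral_monotone_convergence_SUP)
    then show "(SUP i. indicator B (path n \<omega>) * (\<integral>\<^sup>+y. U i y \<partial>Q (\<xi> n \<omega>)))
        = indicator B (path n \<omega>) * (\<integral>\<^sup>+y. (SUP i. U i) y \<partial>Q (\<xi> n \<omega>))"
      by (simp add: SUP_mult_left_ennreal)
  qed
  finally show ?case .
qed

end

section \<open>Avoidance probabilities and Lyapunov inequalities for the kernel\<close>

text \<open>The probability that the chain from z is outside A at all times 0, ..., m, time 0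
  included. It is defined by recursion on the kernel alone, so that estimates become inductions on m
  without reference to the path space.\<close>

fun surv :: "real set \<Rightarrow> nat \<Rightarrow> real \<Rightarrow> ennreal" where
  "surv A 0 z = indicator (- A) z"
| "surv A (Suc m) z = indicator (- A) z * (\<integral>\<^sup>+y. surv A m y \<partial>Q z)"

lemma surv_meas [measurable]:
  assumes [measurable]: "A \<in> sets borel"
  shows "surv A m \<in> borel_measurable borel"
proof (induction m)
  case 0 show ?case by (simp add: fun_eq_iff[symmetric])
next
  case (Suc m)
  have [measurable]: "surv A m \<in> borel_measurable borel" by (rule Suc)
  have "(\<lambda>z. indicator (- A) z * (\<integral>\<^sup>+y. surv A m y \<partial>Q z)) \<in> borel_measurable borel" by measurable
  then show ?case by (simp cong: measurable_cong)
qed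

lemma surv_le_1: "surv A m z \<le> 1"
proof (induction m arbitrary: z)
  case 0 show ?case by (simp add: indicator_def)
next
  case (Suc m)
  have "(\<integral>\<^sup>+y. surv A m y \<partial>Q z) \<le> (\<integral>\<^sup>+y. 1 \<partial>Q z)"
    by (intro nn_integral_mono Suc)
  then show ?case by (simp add: indicator_def)
qed

lemma surv_in [simp]: "z \<in> A \<Longrightarrow> surv A m z = 0"
  by (cases m) auto

abbreviation avoid :: "real \<Rightarrow> nat \<Rightarrow> (nat \<Rightarrow> real) set \<Rightarrow> real set \<Rightarrow> nat \<Rightarrow> 'a set" where
  "avoid x n B A m \<equiv> {\<omega>\<in>space (M x). path n \<omega> \<in> B \<and> (\<forall>j\<le>m. \<xi> (n + j) \<omega> \<notin> A)}"

abbreviation avoid_forever :: "real \<Rightarrow> nat \<Rightarrow> (nat \<Rightarrow> real) set \<Rightarrow> real set \<Rightarrow> 'a set" where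
  "avoid_forever x n B A \<equiv> {\<omega>\<in>space (M x). path n \<omega> \<in> B \<and> (\<forall>j. \<xi> (n + j) \<omega> \<notin> A)}"

text \<open>Induction on m with n and B arbitrary: the condition at time n moves into the event of
  the past, after which the induction hypothesis applies from time n + 1 and \<open>step_nn\<close>
  folds one kernel step into \<open>surv\<close>.\<close>

theorem markov_surv:
  assumes x: "x \<in> X" and A[measurable]: "A \<in> sets borel" and B: "B \<in> sets (Paths n)"
  shows "emeasure (M x) (avoid x n B A m)
       = (\<integral>\<^sup>+\<omega>. indicator B (path n \<omega>) * surv A m (\<xi> n \<omega>) \<partial>M x)"
  using B
proof (induction m arbitrary: n B)
  case 0
  note [measurable] = 0 xi_meas[OF x] path_meas[OF x]
  have "emeasure (M x) {\<omega>\<in>space (M x). path n \<omega> \<in> B \<and> (\<forall>j\<le>0. \<xi> (n + j) \<omega> \<notin> A)}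
      = (\<integral>\<^sup>+\<omega>. indicator {\<omega>\<in>space (M x). path n \<omega> \<in> B \<and> \<xi> n \<omega> \<notin> A} \<omega> \<partial>M x)"
    by (subst nn_integral_indicator) auto
  also have "\<dots> = (\<integral>\<^sup>+\<omega>. indicator B (path n \<omega>) * surv A 0 (\<xi> n \<omega>) \<partial>M x)"
    by (intro nn_integral_cong) (auto simp: indicator_def)
  finally show ?case .
next
  case (Suc m)
  note [measurable] = Suc.prems xi_meas[OF x] path_meas[OF x]
  \<comment> \<open>\<open>B1\<close> adds the condition at time n to B; \<open>B2\<close> is the
    same event read on paths that are one step longer.\<close>
  define B1 where "B1 = {p\<in>space (Paths n). p \<in> B \<and> p n \<notin> A}"
  define B2 where "B2 = {p\<in>space (Paths (Suc n)). restrict p {..n} \<in> B1}"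
  have B1[measurable]: "B1 \<in> sets (Paths n)" unfolding B1_def by measurable
  have [measurable]: "(\<lambda>p. restrict p {..n}) \<in> Paths (Suc n) \<rightarrow>\<^sub>M Paths n"
    by (rule measurable_restrict_subset) auto
  have B2[measurable]: "B2 \<in> sets (Paths (Suc n))" unfolding B2_def by measurable
  have p1: "path n \<omega> \<in> B1 \<longleftrightarrow> path n \<omega> \<in> B \<and> \<xi> n \<omega> \<notin> A" if "\<omega> \<in> space (M x)" for \<omega>
    using measurable_space[OF path_meas[OF x] that] by (auto simp: B1_def)
  have p2: "path (Suc n) \<omega> \<in> B2 \<longleftrightarrow> path n \<omega> \<in> B1" if "\<omega> \<in> space (M x)" for \<omega>
    using measurable_space[OF path_meas[OF x] that] by (auto simp: B2_def)
  have all: "(\<forall>j\<le>Suc m. P j) \<longleftrightarrow> P 0 \<and> (\<forall>j\<le>m. P (Suc j))" for P :: "nat \<Rightarrow> bool"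
    by (metis Suc_le_mono le0 not0_implies_Suc)
  have "{\<omega>\<in>space (M x). path n \<omega> \<in> B \<and> (\<forall>j\<le>Suc m. \<xi> (n + j) \<omega> \<notin> A)}
      = {\<omega>\<in>space (M x). path (Suc n) \<omega> \<in> B2 \<and> (\<forall>j\<le>m. \<xi> (Suc n + j) \<omega> \<notin> A)}"
    by (auto simp: p1 p2 all)
  also have "emeasure (M x) \<dots> = (\<integral>\<^sup>+\<omega>. indicator B2 (path (Suc n) \<omega>) * surv A m (\<xi> (Suc n) \<omega>) \<partial>M x)"
    by (rule Suc.IH[OF B2])
  also have "\<dots> = (\<integral>\<^sup>+\<omega>. indicator B1 (path n \<omega>) * surv A m (\<xi> (Suc n) \<omega>) \<partial>M x)"
    by (intro nn_integral_cong) (auto simp: p2 indicator_def)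
  also have "\<dots> = (\<integral>\<^sup>+\<omega>. indicator B1 (path n \<omega>) * (\<integral>\<^sup>+y. surv A m y \<partial>Q (\<xi> n \<omega>)) \<partial>M x)"
    by (rule step_nn[OF x B1]) simp
  also have "\<dots> = (\<integral>\<^sup>+\<omega>. indicator B (path n \<omega>) * surv A (Suc m) (\<xi> n \<omega>) \<partial>M x)"
    by (intro nn_integral_cong) (auto simp: p1 indicator_def)
  finally show ?case .
qed


lemma Q_mono:
  assumes "z \<in> X" "\<And>y. y \<in> X \<Longrightarrow> f y \<le> g y"
  shows "(\<integral>\<^sup>+y. f y \<partial>Q z) \<le> (\<integral>\<^sup>+y. g y \<partial>Q z)"
  using AE_Q[OF assms(1)] by (intro nn_integral_mono_AE) (auto elim!: eventually_mono simp: assms(2))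

lemma Q_add_const:
  assumes [measurable]: "f \<in> borel_measurable borel"
  shows "(\<integral>\<^sup>+y. f y + c \<partial>Q z) = (\<integral>\<^sup>+y. f y \<partial>Q z) + c"
  by (subst nn_integral_add) auto

text \<open>Foster's criterion on a finite horizon: the left side is the expectation of the minimum
  of N and the hitting time of A. Every step outside A adds 1 to it, and the drift of f pays for
  that.\<close>

lemma surv_foster:
  assumes [measurable]: "A \<in> sets borel"
    and f: "\<And>z. z \<in> X \<Longrightarrow> z \<notin> A \<Longrightarrow> 1 + (\<integral>\<^sup>+y. f y \<partial>Q z) \<le> f z"
    and z: "z \<in> X"
  shows "(\<Sum>m<N. surv A m z) \<le> f z"
  using z
proof (induction N arbitrary: z)
  case 0 then show ?case by simp
next
  case (Suc N)
  show ?case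
  proof (cases "z \<in> A")
    case True then show ?thesis by simp
  next
    case False
    have "(\<Sum>m<Suc N. surv A m z) = 1 + (\<integral>\<^sup>+y. (\<Sum>m<N. surv A m y) \<partial>Q z)"
      unfolding sum.lessThan_Suc_shift using False by (simp add: nn_integral_sum)
    also have "\<dots> \<le> 1 + (\<integral>\<^sup>+y. f y \<partial>Q z)"
      by (intro add_left_mono Q_mono Suc)
    also have "\<dots> \<le> f z" using f Suc.prems False by simp
    finally show ?thesis .
  qed
qed

text \<open>A maximal inequality: a path that avoids A either avoids C too, or enters C, where f is
  at least 1. As f is a supermartingale off A and C, the latter has probability at most f z.\<close>

lemma surv_le_surv_Un:
  assumes [measurable]: "A \<in> sets borel" "C \<in> sets borel" "f \<in> borel_measurable borel"
    and fC: "\<And>z. z \<in> C \<Longrightarrow> z \<notin> A \<Longrightarrow> 1 \<le> f z"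
    and f: "\<And>z. z \<in> X \<Longrightarrow> z \<notin> A \<Longrightarrow> z \<notin> C \<Longrightarrow> (\<integral>\<^sup>+y. f y \<partial>Q z) \<le> f z"
    and z: "z \<in> X"
  shows "surv A m z \<le> f z + surv (A \<union> C) m z"
  using z
proof (induction m arbitrary: z)
  case 0 show ?case
    using fC[of z] by (cases "z \<in> A"; cases "z \<in> C") auto
next
  case (Suc m)
  consider "z \<in> A" | "z \<notin> A" "z \<in> C" | "z \<notin> A" "z \<notin> C" by blast
  then show ?case
  proof cases
    case 1 then show ?thesis by simp
  next
    case 2
    have "surv A (Suc m) z \<le> f z" using surv_le_1[of A "Suc m" z] fC[OF 2(2,1)] by (rule order_trans)
    then show ?thesis by (rule order_trans) simp
  next
    case 3
    have "surv A (Suc m) z \<le> (\<integral>\<^sup>+y. f y + surv (A \<union> C) m y \<partial>Q z)"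
      using 3 Suc by (auto intro!: Q_mono)
    also have "\<dots> = (\<integral>\<^sup>+y. f y \<partial>Q z) + (\<integral>\<^sup>+y. surv (A \<union> C) m y \<partial>Q z)"
      by (rule nn_integral_add) auto
    also have "\<dots> \<le> f z + surv (A \<union> C) (Suc m) z"
      using 3 f Suc.prems by (auto intro!: add_mono)
    finally show ?thesis .
  qed
qed

text \<open>A supermartingale estimate with defect \<kappa> per step: A is hit within m steps with
  probability at most f z + m \<kappa>. It is stated without subtraction because of
  \<open>ennreal\<close>. Escape uses \<kappa> = 0; slow return uses a small positive
  \<kappa>.\<close>

lemma surv_exit:
  assumes [measurable]: "A \<in> sets borel" "f \<in> borel_measurable borel"
    and fA: "\<And>z. z \<in> A \<Longrightarrow> 1 \<le> f z"
    and f: "\<And>z. z \<in> X \<Longrightarrow> z \<notin> A \<Longrightarrow> (\<integral>\<^sup>+y. f y \<partial>Q z) \<le> f z + \<kappa>"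
    and z: "z \<in> X"
  shows "1 \<le> f z + of_nat m * \<kappa> + surv A m z"
  using z
proof (induction m arbitrary: z)
  case 0 show ?case
    using fA[of z] by (cases "z \<in> A") auto
next
  case (Suc m)
  show ?case
  proof (cases "z \<in> A")
    case True
    have "1 \<le> f z" by (rule fA[OF True])
    also have "\<dots> \<le> f z + of_nat (Suc m) * \<kappa>" by (simp add: add_increasing2)
    finally show ?thesis using True by simp
  next
    case False
    have "1 = (\<integral>\<^sup>+y. 1 \<partial>Q z)" by simp
    also have "\<dots> \<le> (\<integral>\<^sup>+y. f y + surv A m y + of_nat m * \<kappa> \<partial>Q z)"
      using Suc.IH by (intro Q_mono Suc.prems) (simp add: add_ac)
    also have "\<dots> = (\<integral>\<^sup>+y. f y \<partial>Q z) + (\<integral>\<^sup>+y. surv A m y \<partial>Q z) + of_nat m * \<kappa>"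
      by (subst Q_add_const) (auto simp: nn_integral_add)
    also have "\<dots> \<le> (f z + \<kappa>) + surv A (Suc m) z + of_nat m * \<kappa>"
      using False f Suc.prems by (auto intro!: add_mono)
    also have "\<dots> = f z + of_nat (Suc m) * \<kappa> + surv A (Suc m) z"
      by (simp add: distrib_right add_ac)
    finally show ?thesis .
  qed
qed

section \<open>From finite horizons to almost sure statements\<close>

lemma decseq_avoid:
  assumes x: "x \<in> X" and [measurable]: "A \<in> sets borel" "B \<in> sets (Paths n)"
  shows "(\<lambda>m. measure (M x) (avoid x n B A m))
     \<longlonglongrightarrow> measure (M x) (avoid_forever x n B A)"
proof -
  interpret prob_space "M x" by (rule prob_M[OF x])
  note [measurable] = xi_meas[OF x] path_meas[OF x]
  have "(\<lambda>m. prob (avoid x n B A m))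
     \<longlonglongrightarrow> prob (\<Inter>m. (avoid x n B A m))"
    by (rule finite_Lim_measure_decseq) (auto simp: decseq_def)
  also have "(\<Inter>m. (avoid x n B A m))
     = (avoid_forever x n B A)" by auto
  finally show ?thesis .
qed

text \<open>Integrates a pointwise bound by \<open>surv\<close> over the paths in B. The larger
  event B0 may forget B: recurrence takes the whole path space for it, escape takes B
  itself.\<close>

lemma markov_surv_le:
  assumes x: "x \<in> X" and [measurable]: "A \<in> sets borel" "B \<in> sets (Paths n)"
    and b: "0 \<le> b" "\<And>p. p \<in> B \<Longrightarrow> p n \<in> X \<Longrightarrow> h (p n) \<le> ennreal b + surv A m (p n)"
    and B0: "B0 \<in> sets (Paths n)" "B \<subseteq> B0"
  shows "(\<integral>\<^sup>+\<omega>. indicator B (path n \<omega>) * h (\<xi> n \<omega>) \<partial>M x)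
    \<le> ennreal b * emeasure (M x) {\<omega>\<in>space (M x). path n \<omega> \<in> B}
       + emeasure (M x) (avoid x n B0 A m)"
proof -
  note [measurable] = xi_meas[OF x] path_meas[OF x] B0(1)
  have "(\<integral>\<^sup>+\<omega>. indicator B (path n \<omega>) * h (\<xi> n \<omega>) \<partial>M x)
     \<le> (\<integral>\<^sup>+\<omega>. ennreal b * indicator {\<omega>\<in>space (M x). path n \<omega> \<in> B} \<omega> + indicator B0 (path n \<omega>) * surv A m (\<xi> n \<omega>) \<partial>M x)"
  proof (rule nn_integral_mono_AE)
    show "AE \<omega> in M x. indicator B (path n \<omega>) * h (\<xi> n \<omega>)
      \<le> ennreal b * indicator {\<omega>\<in>space (M x). path n \<omega> \<in> B} \<omega> + indicator B0 (path n \<omega>) * surv A m (\<xi> n \<omega>)"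
      using xi_in_X[OF x, of n] AE_space
    proof eventually_elim
      case (elim \<omega>)
      show ?case
      proof (cases "path n \<omega> \<in> B")
        case True
        then have "path n \<omega> \<in> B0" using B0(2) by blast
        then show ?thesis using b(2)[of "path n \<omega>"] elim True by simp
      qed simp
    qed
  qed
  also have "\<dots> = ennreal b * emeasure (M x) {\<omega>\<in>space (M x). path n \<omega> \<in> B}
       + emeasure (M x) (avoid x n B0 A m)"
    unfolding markov_surv[OF x \<open>A \<in> sets borel\<close> B0(1)]
    by (subst nn_integral_add) (auto simp: nn_integral_cmult)
  finally show ?thesis .
qed

text \<open>From a point with |z| \<le> k, where f \<le> b, avoiding A forever forces a visit to the
  region f \<ge> R, because (N') makes the chain exceed every level. By the maximal inequality this
  has probability at most b / R, and R is arbitrary. Growth of f is required only off A, so that A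
  may be a half-line.\<close>

theorem recurrence_criterion:
  fixes f :: "real \<Rightarrow> real"
  assumes N': "cond_N' X M \<xi>" and x: "x \<in> X"
    and [measurable]: "A \<in> sets borel" "f \<in> borel_measurable borel"
    and f0: "\<And>z. 0 \<le> f z"
    and f: "\<And>z. z \<in> X \<Longrightarrow> z \<notin> A \<Longrightarrow> (\<integral>\<^sup>+y. ennreal (f y) \<partial>Q z) \<le> ennreal (f z)"
    and bdd: "\<And>k. \<exists>b. \<forall>z. \<bar>z\<bar> \<le> k \<longrightarrow> f z \<le> b"
    and unb: "\<And>R. \<exists>r. \<forall>z. z \<notin> A \<longrightarrow> r \<le> \<bar>z\<bar> \<longrightarrow> R \<le> f z"
  shows "AE \<omega> in M x. \<exists>\<^sub>\<infinity>n. \<xi> n \<omega> \<in> A"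
proof -
  interpret prob_space "M x" by (rule prob_M[OF x])
  note [measurable] = xi_meas[OF x] path_meas[OF x]
  have lim: "AE \<omega> in M x. limsup (\<lambda>n. ereal \<bar>\<xi> n \<omega>\<bar>) = \<infinity>"
    using N' x unfolding cond_N'_def by blast
  have "AE \<omega> in M x. \<not> (\<bar>\<xi> n \<omega>\<bar> \<le> real k \<and> (\<forall>j. \<xi> (n + j) \<omega> \<notin> A))" for n k
  proof -
    define B where "B = {p\<in>space (Paths n). \<bar>p n\<bar> \<le> real k}"
    have [measurable]: "B \<in> sets (Paths n)" unfolding B_def by measurable
    have inB: "path n \<omega> \<in> B \<longleftrightarrow> \<bar>\<xi> n \<omega>\<bar> \<le> real k" if "\<omega> \<in> space (M x)" for \<omega>
      using measurable_space[OF path_meas[OF x] that] by (auto simp: B_def)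
    obtain b where b: "\<And>z. \<bar>z\<bar> \<le> real k \<Longrightarrow> f z \<le> b" using bdd[of "real k"] by blast
    have b0: "0 \<le> b" using b[of 0] f0[of 0] by simp
    define E where "E = (avoid_forever x n B A)"
    have [measurable]: "E \<in> events" unfolding E_def by measurable
    have key: "prob E \<le> b / R" if R: "R > 0" for R
    proof -
      obtain r where r: "\<And>z. z \<notin> A \<Longrightarrow> r \<le> \<bar>z\<bar> \<Longrightarrow> R \<le> f z" using unb[of R] by blast
      define C where "C = {z::real. r \<le> \<bar>z\<bar>}"
      have [measurable]: "C \<in> sets borel" unfolding C_def by measurable
      \<comment> \<open>\<open>W m\<close> avoids A and the far region C together; its probability
        tends to 0, as (N') forces a visit to C.\<close>
      define W where "W m = (avoid x n (space (Paths n)) (A \<union> C) m)" for m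
      have scale: "surv A m z \<le> ennreal (f z / R) + surv (A \<union> C) m z" if "z \<in> X" for m z
      proof (rule surv_le_surv_Un[OF _ _ _ _ _ that])
        show "1 \<le> ennreal (f z / R)" if "z \<in> C" "z \<notin> A" for z
          using r[OF that(2)] that R by (simp add: C_def le_divide_eq)
        show "(\<integral>\<^sup>+y. ennreal (f y / R) \<partial>Q z) \<le> ennreal (f z / R)" if "z \<in> X" "z \<notin> A" "z \<notin> C" for z
        proof -
          have "(\<integral>\<^sup>+y. ennreal (f y / R) \<partial>Q z) = ennreal (1 / R) * (\<integral>\<^sup>+y. ennreal (f y) \<partial>Q z)"
            using R f0 by (subst nn_integral_cmult[symmetric]) (auto simp: ennreal_mult'[symmetric])
          also have "\<dots> \<le> ennreal (1 / R) * ennreal (f z)"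
            by (intro mult_left_mono f that) simp
          also have "\<dots> = ennreal (f z / R)" using R f0 by (simp add: ennreal_mult'[symmetric])
          finally show ?thesis .
        qed
      qed auto
      have "prob E \<le> b / R + prob (W m)" for m
      proof -
        have "emeasure (M x) E \<le> emeasure (M x) (avoid x n B A m)"
          unfolding E_def by (rule emeasure_mono) auto
        also have "\<dots> = (\<integral>\<^sup>+\<omega>. indicator B (path n \<omega>) * surv A m (\<xi> n \<omega>) \<partial>M x)"
          by (rule markov_surv[OF x]) auto
        also have "\<dots> \<le> ennreal (b / R) * emeasure (M x) {\<omega>\<in>space (M x). path n \<omega> \<in> B} + emeasure (M x) (W m)"
          unfolding W_def
        proof (rule markov_surv_le[OF x])
          show "surv A m (p n) \<le> ennreal (b / R) + surv (A \<union> C) m (p n)" if "p \<in> B" "p n \<in> X" for p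
          proof -
            have "f (p n) / R \<le> b / R" using that R b by (simp add: B_def divide_right_mono)
            then have "ennreal (f (p n) / R) + surv (A \<union> C) m (p n) \<le> ennreal (b / R) + surv (A \<union> C) m (p n)"
              by (intro add_right_mono ennreal_leI)
            then show ?thesis using scale[OF that(2), of m] by (rule order_trans[rotated])
          qed
        qed (use b0 R in \<open>auto simp: B_def\<close>)
        also have "\<dots> \<le> ennreal (b / R) * 1 + emeasure (M x) (W m)"
          by (intro add_right_mono mult_left_mono) (auto simp: emeasure_le_1)
        also have "\<dots> = ennreal (b / R + prob (W m))"
          using b0 R by (simp add: emeasure_eq_measure ennreal_plus[symmetric] del: ennreal_plus)
        finally show ?thesis using b0 R by (simp add: emeasure_eq_measure ennreal_le_iff del: ennreal_plus)
      qed
      moreover have "(\<lambda>m. prob (W m)) \<longlonglongrightarrow> 0"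
      proof -
        have "AE \<omega> in M x. \<not> (path n \<omega> \<in> space (Paths n) \<and> (\<forall>j. \<xi> (n + j) \<omega> \<notin> A \<union> C))"
          using lim
        proof eventually_elim
          case (elim \<omega>)
          then obtain j where "r \<le> \<bar>\<xi> (n + j) \<omega>\<bar>" using limsup_inf_large[of "\<lambda>n. \<xi> n \<omega>"] by blast
          then show ?case by (auto simp: C_def)
        qed
        then have "prob (avoid_forever x n (space (Paths n)) (A \<union> C)) = 0"
          by (subst prob_eq_0) auto
        then show ?thesis unfolding W_def
          using decseq_avoid[OF x, of "A \<union> C" "space (Paths n)" n] by simp
      qed
      then have "(\<lambda>m. b / R + prob (W m)) \<longlonglongrightarrow> b / R + 0" by (intro tendsto_intros)
      ultimately show ?thesis by (intro LIMSEQ_le_const[of _ "b / R"]) auto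
    qed
    have "prob E \<le> e" if "e > 0" for e
    proof -
      \<comment> \<open>The level R = (b + 1) / e; the added 1 keeps it positive when b = 0.\<close>
      have "b / ((b + 1) / e) \<le> e" using that b0 by (simp add: field_simps)
      then show ?thesis using key[of "(b + 1) / e"] that b0 by simp
    qed
    then have "prob E \<le> 0" by (rule field_le_epsilon, simp)
    then have "prob E = 0" using measure_nonneg[of "M x" E] by linarith
    then have "AE \<omega> in M x. \<omega> \<notin> E" by (subst (asm) prob_eq_0) auto
    then show ?thesis using AE_space by eventually_elim (auto simp: E_def inB)
  qed
  note ae = this
  have "AE \<omega> in M x. \<forall>n k. \<not> (\<bar>\<xi> n \<omega>\<bar> \<le> real k \<and> (\<forall>j. \<xi> (n + j) \<omega> \<notin> A))"
    unfolding AE_all_countable by (intro allI ae)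
  then show ?thesis
  proof eventually_elim
    case (elim \<omega>)
    show ?case
      unfolding INFM_nat_le
    proof
      fix n
      obtain k :: nat where "\<bar>\<xi> n \<omega>\<bar> \<le> real k" using real_arch_simple by blast
      then obtain j where "\<xi> (n + j) \<omega> \<in> A" using elim by blast
      then show "\<exists>m\<ge>n. \<xi> m \<omega> \<in> A" by (intro exI[of _ "n + j"]) auto
    qed
  qed
qed

text \<open>Decomposition by the first entrance into G1 or G2. From there the chain avoids A1 or A2,
  according to the side of entrance, with conditional probability at least 1 - e. Two pairs are
  needed because in the directional case the set to be avoided depends on the side.\<close>

theorem escape_probability:
  assumes x: "x \<in> X"
    and [measurable]: "A1 \<in> sets borel" "A2 \<in> sets borel" "G1 \<in> sets borel" "G2 \<in> sets borel"
    and e: "0 \<le> e"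
    and 1: "\<And>z m. z \<in> X \<Longrightarrow> z \<in> G1 \<Longrightarrow> 1 \<le> ennreal e + surv A1 m z"
    and 2: "\<And>z m. z \<in> X \<Longrightarrow> z \<in> G2 \<Longrightarrow> 1 \<le> ennreal e + surv A2 m z"
    and G: "AE \<omega> in M x. \<exists>n. \<xi> n \<omega> \<in> G1 \<union> G2"
  shows "1 - e \<le> measure (M x) {\<omega>\<in>space (M x). \<exists>n. (\<forall>j. \<xi> (n + j) \<omega> \<notin> A1) \<or> (\<forall>j. \<xi> (n + j) \<omega> \<notin> A2)}"
proof -
  interpret prob_space "M x" by (rule prob_M[OF x])
  note [measurable] = xi_meas[OF x] path_meas[OF x]
  \<comment> \<open>First entrance exactly at time n, which makes the events for different n
    disjoint. \<open>B1\<close> and \<open>B2\<close> split it, points in both G1 and G2 counting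
    for \<open>B1\<close>.\<close>
  define B where "B n = {p\<in>space (Paths n). (\<forall>i<n. p i \<notin> G1 \<union> G2) \<and> p n \<in> G1 \<union> G2}" for n
  have Bm[measurable]: "B n \<in> sets (Paths n)" for n unfolding B_def by measurable
  define B1 where "B1 n = {p\<in>space (Paths n). p \<in> B n \<and> p n \<in> G1}" for n
  define B2 where "B2 n = {p\<in>space (Paths n). p \<in> B n \<and> p n \<notin> G1}" for n
  have B1m[measurable]: "B1 n \<in> sets (Paths n)" and B2m[measurable]: "B2 n \<in> sets (Paths n)" for n
    unfolding B1_def B2_def by measurable
  have psp: "path n \<omega> \<in> space (Paths n)" if "\<omega> \<in> space (M x)" for n \<omega>
    using measurable_space[OF path_meas[OF x] that] by simp
  define S where "S n = (avoid_forever x n (B1 n) A1)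
      \<union> (avoid_forever x n (B2 n) A2)" for n
  define D where "D n = {\<omega>\<in>space (M x). path n \<omega> \<in> B n}" for n
  have Sm[measurable]: "S n \<in> events" and Dm[measurable]: "D n \<in> events" for n
    unfolding S_def D_def by measurable
  \<comment> \<open>The bound on the conditional probability given B', multiplied out so that B' may
    have probability 0. The horizon m is sent to infinity.\<close>
  have one: "prob {\<omega>\<in>space (M x). path n \<omega> \<in> B'} \<le> e * prob {\<omega>\<in>space (M x). path n \<omega> \<in> B'}
      + prob (avoid_forever x n B' A)"
    if [measurable]: "B' \<in> sets (Paths n)" "A \<in> sets borel"
      and s: "\<And>p m. p \<in> B' \<Longrightarrow> p n \<in> X \<Longrightarrow> 1 \<le> ennreal e + surv A m (p n)" for n B' A
  proof -
    let ?P = "{\<omega>\<in>space (M x). path n \<omega> \<in> B'}"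
    have "prob ?P \<le> e * prob ?P + prob (avoid x n B' A m)" for m
    proof -
      have "emeasure (M x) ?P = (\<integral>\<^sup>+\<omega>. indicator ?P \<omega> \<partial>M x)" by simp
      also have "\<dots> = (\<integral>\<^sup>+\<omega>. indicator B' (path n \<omega>) * (\<lambda>_. 1) (\<xi> n \<omega>) \<partial>M x)"
        by (intro nn_integral_cong) (auto simp: indicator_def)
      also have "\<dots> \<le> ennreal e * emeasure (M x) ?P + emeasure (M x) (avoid x n B' A m)"
        by (rule markov_surv_le[OF x]) (use s e in auto)
      finally show ?thesis using e
        by (simp add: emeasure_eq_measure ennreal_mult'[symmetric] ennreal_plus[symmetric] del: ennreal_plus)
    qed
    moreover have "(\<lambda>m. e * prob ?P + prob (avoid x n B' A m))
      \<longlonglongrightarrow> e * prob ?P + prob (avoid_forever x n B' A)"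
      by (intro tendsto_intros decseq_avoid[OF x]) auto
    ultimately show ?thesis by (intro LIMSEQ_le_const) auto
  qed
  have DS: "(1 - e) * prob (D n) \<le> prob (S n)" for n
  proof -
    have D: "prob (D n) = prob {\<omega>\<in>space (M x). path n \<omega> \<in> B1 n} + prob {\<omega>\<in>space (M x). path n \<omega> \<in> B2 n}"
      by (subst finite_measure_Union[symmetric])
         (auto simp: D_def B1_def B2_def dest: psp intro!: arg_cong[where f=prob])
    have S: "prob (S n) = prob (avoid_forever x n (B1 n) A1)
       + prob (avoid_forever x n (B2 n) A2)"
      unfolding S_def by (subst finite_measure_Union) (auto simp: B1_def B2_def)
    have "1 \<le> ennreal e + surv A1 m (p n)" if "p \<in> B1 n" "p n \<in> X" for p m
      using that 1 by (auto simp: B1_def)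
    from one[OF B1m \<open>A1 \<in> sets borel\<close> this]
    have a: "prob {\<omega>\<in>space (M x). path n \<omega> \<in> B1 n} \<le> e * prob {\<omega>\<in>space (M x). path n \<omega> \<in> B1 n}
      + prob (avoid_forever x n (B1 n) A1)" by simp
    have "1 \<le> ennreal e + surv A2 m (p n)" if "p \<in> B2 n" "p n \<in> X" for p m
      using that 2 by (auto simp: B2_def B_def)
    from one[OF B2m \<open>A2 \<in> sets borel\<close> this]
    have b: "prob {\<omega>\<in>space (M x). path n \<omega> \<in> B2 n} \<le> e * prob {\<omega>\<in>space (M x). path n \<omega> \<in> B2 n}
      + prob (avoid_forever x n (B2 n) A2)" by simp
    show ?thesis using a b unfolding D S by (simp add: algebra_simps)
  qed
  have Ddisj: "D m \<inter> D n = {}" if "m < n" for m n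
  proof -
    have False if "\<omega> \<in> D m" "\<omega> \<in> D n" for \<omega>
    proof -
      have "path m \<omega> m \<in> G1 \<union> G2" using that(1) unfolding D_def B_def by blast
      moreover have "path n \<omega> m \<notin> G1 \<union> G2" using that(2) \<open>m < n\<close> unfolding D_def B_def by blast
      ultimately show False using \<open>m < n\<close> by simp
    qed
    then show ?thesis by blast
  qed
  have SD: "S n \<subseteq> D n" for n by (auto simp: S_def D_def B1_def B2_def)
  have disjD: "disjoint_family D"
    unfolding disjoint_family_on_def
  proof (intro ballI impI)
    fix m n :: nat assume "m \<noteq> n"
    then show "D m \<inter> D n = {}" using Ddisj[of m n] Ddisj[of n m] by (metis Int_commute linorder_neqE_nat)
  qed
  have disjS: "disjoint_family S"
    using disjD SD unfolding disjoint_family_on_def by blast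
  have "(\<lambda>n. prob (D n)) sums prob (\<Union>n. D n)" "(\<lambda>n. prob (S n)) sums prob (\<Union>n. S n)"
    by (rule finite_measure_UNION; use disjD disjS in auto)+
  then have "(1 - e) * prob (\<Union>n. D n) \<le> prob (\<Union>n. S n)"
    by (intro sums_le[OF DS sums_mult])
  also have "\<dots> \<le> prob {\<omega>\<in>space (M x). \<exists>n. (\<forall>j. \<xi> (n + j) \<omega> \<notin> A1) \<or> (\<forall>j. \<xi> (n + j) \<omega> \<notin> A2)}"
    by (rule finite_measure_mono) (auto simp: S_def)
  also have "prob (\<Union>n. D n) = 1"
  proof -
    have "AE \<omega> in M x. \<omega> \<in> (\<Union>n. D n)"
      using G AE_space
    proof eventually_elim
      case (elim \<omega>)
      then obtain n0 where n0: "\<xi> n0 \<omega> \<in> G1 \<union> G2" by blast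
      define n where "n = (LEAST n. \<xi> n \<omega> \<in> G1 \<union> G2)"
      have "\<xi> n \<omega> \<in> G1 \<union> G2" unfolding n_def using n0 by (rule LeastI)
      moreover have "\<xi> i \<omega> \<notin> G1 \<union> G2" if "i < n" for i
        using that not_less_Least unfolding n_def by blast
      ultimately have "\<omega> \<in> D n" using elim psp by (auto simp: D_def B_def)
      then show ?case by blast
    qed
    then show ?thesis by (subst prob_eq_1) auto
  qed
  finally show ?thesis by simp
qed

text \<open>The tail-sum formula: the event \<open>E m\<close> says that the hitting time exceeds m.
  There is no offset, since \<open>surv\<close> with index m covers the times 0 to m. A path that
  never hits contributes a divergent sum, in agreement with the value infinity of
  \<open>hit_time\<close>.\<close>

lemma expected_hit_time:
  assumes x: "x \<in> X"
  shows "(\<integral>\<^sup>+\<omega>. hit_time \<xi> a \<omega> \<partial>M x) = (\<Sum>m. surv {-a..a} m x)"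
proof -
  interpret prob_space "M x" by (rule prob_M[OF x])
  note [measurable] = xi_meas[OF x] path_meas[OF x]
  define E where "E m = {\<omega>\<in>space (M x). \<forall>j\<le>m. \<xi> j \<omega> \<notin> {-a..a}}" for m
  have [measurable]: "E m \<in> events" for m unfolding E_def by measurable
  have in_iff: "y \<in> {-a..a} \<longleftrightarrow> \<bar>y\<bar> \<le> a" for y :: real by auto
  have pw: "hit_time \<xi> a \<omega> = (\<Sum>m. indicator (E m) \<omega>)" if w: "\<omega> \<in> space (M x)" for \<omega>
  proof (cases "\<exists>n. \<bar>\<xi> n \<omega>\<bar> \<le> a")
    case True
    define T where "T = (LEAST n. \<bar>\<xi> n \<omega>\<bar> \<le> a)"
    have T: "\<bar>\<xi> T \<omega>\<bar> \<le> a" unfolding T_def using True by (rule LeastI_ex)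
    have T2: "\<not> \<bar>\<xi> i \<omega>\<bar> \<le> a" if "i < T" for i using not_less_Least that unfolding T_def by blast
    have ind: "indicator (E m) \<omega> = (if m < T then 1 else 0 :: ennreal)" for m
      
    proof (cases "m < T")
      case True
      then have "\<omega> \<in> E m" using T2 w unfolding E_def in_iff by auto
      then show ?thesis using True by simp
    next
      case False
      then have "T \<le> m" by simp
      then have "\<omega> \<notin> E m" using T unfolding E_def in_iff by blast
      then show ?thesis using False by simp
    qed
    have "(\<Sum>m. indicator (E m) \<omega> :: ennreal) = (\<Sum>m<T. indicator (E m) \<omega>)"
      by (rule suminf_finite) (auto simp: ind)
    also have "\<dots> = of_nat T" by (simp add: ind)
    finally show ?thesis using True by (simp add: hit_time_def T_def)
  next
    case False
    then have ind: "indicator (E m) \<omega> = (1 :: ennreal)" for m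
      using w unfolding E_def in_iff by auto
    have "(\<Sum>m. indicator (E m) \<omega> :: ennreal) = (SUP n. of_nat n)"
      by (simp add: ind suminf_eq_SUP)
    then show ?thesis using False by (simp add: hit_time_def ennreal_SUP_of_nat_eq_top)
  qed
  have "(\<integral>\<^sup>+\<omega>. hit_time \<xi> a \<omega> \<partial>M x) = (\<integral>\<^sup>+\<omega>. (\<Sum>m. indicator (E m) \<omega>) \<partial>M x)"
    by (intro nn_integral_cong pw)
  also have "\<dots> = (\<Sum>m. emeasure (M x) (E m))"
    by (subst nn_integral_suminf) auto
  also have "\<dots> = (\<Sum>m. surv {-a..a} m x)"
  proof (rule arg_cong[where f=suminf], rule ext)
    fix m
    have "E m = {\<omega>\<in>space (M x). path 0 \<omega> \<in> space (Paths 0) \<and> (\<forall>j\<le>m. \<xi> (0 + j) \<omega> \<notin> {-a..a})}"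
      using measurable_space[OF path_meas[OF x, of 0]] by (auto simp: E_def)
    then have "emeasure (M x) (E m) = (\<integral>\<^sup>+\<omega>. indicator (space (Paths 0)) (path 0 \<omega>) * surv {-a..a} m (\<xi> 0 \<omega>) \<partial>M x)"
      using markov_surv[OF x, of "{-a..a}" "space (Paths 0)" 0 m] by simp
    also have "\<dots> = (\<integral>\<^sup>+\<omega>. surv {-a..a} m x \<partial>M x)"
      using xi_0[OF x] AE_space
      by (intro nn_integral_cong_AE, eventually_elim)
         (use measurable_space[OF path_meas[OF x, of 0]] in auto)
    also have "\<dots> = surv {-a..a} m x" by (simp add: emeasure_space_1)
    finally show "emeasure (M x) (E m) = surv {-a..a} m x" .
  qed
  finally show ?thesis .
qed

end

subsection \<open>Expected increments of cut-off powers\<close>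

text \<open>Fubini on the product of Lebesgue measure and P. G is the primitive of g with value 0 at
  0, but this is asked for only through its integrals, since the g in use has jumps where the
  cut-off sits. D is the integrable majorant that justifies the exchange.\<close>

lemma layer_cake:
  fixes g G :: "real \<Rightarrow> real"
  assumes P: "prob_space P" and sP[measurable_cong]: "sets P = sets borel"
    and [measurable]: "g \<in> borel_measurable borel" and r: "r > 0"
    and D: "integrable lborel D"
    and D1: "\<And>w. w > 0 \<Longrightarrow> \<bar>g w\<bar> * measure P {r*w<..} \<le> D w"
    and D2: "\<And>w. w > 0 \<Longrightarrow> \<bar>g (-w)\<bar> * measure P {..<-(r*w)} \<le> D w"
    and G1: "\<And>s. s \<ge> 0 \<Longrightarrow> (\<integral>w. indicator {0<..<s} w * g w \<partial>lborel) = G s"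
    and G2: "\<And>s. s \<ge> 0 \<Longrightarrow> (\<integral>w. indicator {0<..<s} w * - g (-w) \<partial>lborel) = G (-s)"
  shows "integrable P (\<lambda>t. G (t / r))"
    "(\<integral>t. G (t / r) \<partial>P) = (\<integral>w. indicator {0<..} w * (g w * measure P {r*w<..} - g (-w) * measure P {..<-(r*w)}) \<partial>lborel)"
proof -
  interpret prob_space P by (rule P)
  interpret pp: pair_sigma_finite lborel P ..
  \<comment> \<open>Integrating \<open>k w t\<close> over t produces the two tails at level r w;
    integrating over w produces G (t / r).\<close>
  define k where "k w t = indicator {0<..} w * (g w * indicator {r*w<..} t - g (-w) * indicator {..<-(r*w)} t)" for w t :: real
  have km[measurable]: "case_prod k \<in> borel_measurable (lborel \<Otimes>\<^sub>M P)"
  proof -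
    have "case_prod k = (\<lambda>p. indicator {0<..} (fst p) * (g (fst p) * (if r * fst p < snd p then 1 else 0) - g (- fst p) * (if snd p < -(r * fst p) then 1 else 0)))"
      by (auto simp: k_def fun_eq_iff indicator_def)
    then show ?thesis by (simp only:) measurable
  qed
  have spP: "space P = UNIV" using sets_eq_imp_space_eq[OF sP] by simp
  have [measurable]: "D \<in> borel_measurable borel" using borel_measurable_integrable[OF D] by simp
  have "(\<integral>\<^sup>+p. norm (case_prod k p) \<partial>(lborel \<Otimes>\<^sub>M P)) = (\<integral>\<^sup>+w. (\<integral>\<^sup>+t. norm (k w t) \<partial>P) \<partial>lborel)"
    by (subst nn_integral_fst[symmetric]) auto
  \<comment> \<open>The factor 2 counts the two tails; the modulus is taken because the assumptions
    bound D from below only for w > 0.\<close>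
  also have "\<dots> \<le> (\<integral>\<^sup>+w. ennreal (2 * \<bar>D w\<bar>) \<partial>lborel)"
  proof (rule nn_integral_mono)
    fix w :: real
    show "(\<integral>\<^sup>+t. norm (k w t) \<partial>P) \<le> ennreal (2 * \<bar>D w\<bar>)"
    proof (cases "w > 0")
      case False then show ?thesis by (simp add: k_def)
    next
      case True
      have "(\<integral>\<^sup>+t. norm (k w t) \<partial>P) \<le> (\<integral>\<^sup>+t. ennreal \<bar>g w\<bar> * indicator {r*w<..} t + ennreal \<bar>g (-w)\<bar> * indicator {..<-(r*w)} t \<partial>P)"
        using True mult_pos_pos[OF r True] by (intro nn_integral_mono) (auto simp: k_def indicator_def)
      also have "\<dots> = ennreal \<bar>g w\<bar> * emeasure P {r*w<..} + ennreal \<bar>g (-w)\<bar> * emeasure P {..<-(r*w)}"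
        by (subst nn_integral_add) (auto simp: nn_integral_cmult)
      also have "\<dots> = ennreal (\<bar>g w\<bar> * prob {r*w<..} + \<bar>g (-w)\<bar> * prob {..<-(r*w)})"
        by (simp add: emeasure_eq_measure ennreal_mult'')
      also have "\<dots> \<le> ennreal (2 * \<bar>D w\<bar>)"
        using D1[OF True] D2[OF True] by (intro ennreal_leI) auto
      finally show ?thesis .
    qed
  qed
  also have "\<dots> < \<infinity>"
  proof -
    have "integrable lborel (\<lambda>w. 2 * \<bar>D w\<bar>)" using D by auto
    then show ?thesis by (subst nn_integral_eq_integral) auto
  qed
  finally have int: "integrable (lborel \<Otimes>\<^sub>M P) (case_prod k)"
    by (intro integrableI_bounded) auto
  have inner: "(\<integral>w. k w t \<partial>lborel) = G (t / r)" for t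
  proof -
    have less: "r * w < s \<longleftrightarrow> w < s / r" for s w
      using r by (simp add: pos_less_divide_eq mult.commute)
    show ?thesis
    proof (cases "t \<ge> 0")
      case True
      have "k w t = indicator {0<..<t/r} w * g w" for w
        using True mult_pos_pos[OF r, of w] by (cases "w > 0") (auto simp: k_def indicator_def less)
      then show ?thesis using G1[of "t/r"] True r by simp
    next
      case False
      have "r * w < - t \<longleftrightarrow> w < - (t / r)" for w using less[of w "- t"] by simp
      then have "t < - (r * w) \<longleftrightarrow> w < - (t / r)" for w using less_minus_iff[of t "r * w"] by blast
      then have "k w t = indicator {0<..<-(t/r)} w * - g (-w)" for w
        using False mult_pos_pos[OF r, of w] by (cases "w > 0") (auto simp: k_def indicator_def)
      then show ?thesis using G2[of "-(t/r)"] False r by (simp add: divide_nonpos_pos)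
    qed
  qed
  show "integrable P (\<lambda>t. G (t / r))"
    using pp.integrable_snd[OF int] by (simp add: inner)
  have "(\<integral>t. G (t / r) \<partial>P) = (\<integral>t. (\<integral>w. k w t \<partial>lborel) \<partial>P)" by (simp add: inner)
  also have "\<dots> = (\<integral>w. (\<integral>t. k w t \<partial>P) \<partial>lborel)"
    by (rule pp.Fubini_integral[OF int])
  also have "\<dots> = (\<integral>w. indicator {0<..} w * (g w * measure P {r*w<..} - g (-w) * measure P {..<-(r*w)}) \<partial>lborel)"
  proof (intro Bochner_Integration.integral_cong refl)
    fix w
    have "(\<integral>t. g w * indicator {r*w<..} t - g (-w) * indicator {..<-(r*w)} t \<partial>P)
        = g w * measure P {r*w<..} - g (-w) * measure P {..<-(r*w)}"
      by (subst Bochner_Integration.integral_diff)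
         (auto intro!: integrable_mult_right integrable_real_indicator simp: emeasure_eq_measure spP)
    then show "(\<integral>t. k w t \<partial>P) = indicator {0<..} w * (g w * measure P {r*w<..} - g (-w) * measure P {..<-(r*w)})"
      by (simp add: k_def)
  qed
  finally show "(\<integral>t. G (t / r) \<partial>P) = (\<integral>w. indicator {0<..} w * (g w * measure P {r*w<..} - g (-w) * measure P {..<-(r*w)}) \<partial>lborel)" .
qed

section \<open>Box-Cox functions and their cut-offs\<close>

text \<open>Value 0 and slope 1 at u = 1 for every p: the linear part of an expected increment is
  then exactly the drift divided by the distance, and the family passes continuously through the
  logarithm.\<close>

definition box_cox :: "real \<Rightarrow> real \<Rightarrow> real" where
  "box_cox p u = (if p = 0 then ln u else (u powr p - 1) / p)"

text \<open>The flag t chooses between the two-sided function of |u| and the one-sided function of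
  u; the cut-off makes it constant on a ball around 0 or on a half-line, respectively.\<close>

definition bcut :: "real \<Rightarrow> real \<Rightarrow> bool \<Rightarrow> real \<Rightarrow> real" where
  "bcut p e t u = (if t then box_cox p (max \<bar>u\<bar> e) else box_cox p (max u e))"

text \<open>The derivative of \<open>bcut p e t (1 + w) - w\<close> in the relative step w.
  Subtracting 1 removes the linear part, so that the slope vanishes at w = 0. The values at the
  kinks are immaterial.\<close>

definition bcut_slope :: "real \<Rightarrow> real \<Rightarrow> bool \<Rightarrow> real \<Rightarrow> real" where
  "bcut_slope p e t w = (if 1 + w > e then (1 + w) powr (p - 1)
     else if t \<and> 1 + w < - e then - ((- (1 + w)) powr (p - 1)) else 0) - 1"

lemma box_cox_1 [simp]: "box_cox p 1 = 0" by (simp add: box_cox_def)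

lemma box_cox_deriv:
  assumes "u > 0"
  shows "(box_cox p has_real_derivative u powr (p - 1)) (at u)"
proof (cases "p = 0")
  case True
  then have *: "box_cox p = ln" by (auto simp: box_cox_def)
  show ?thesis unfolding * using assms True
    by (auto intro!: derivative_eq_intros simp: powr_minus field_simps)
next
  case False
  then have *: "box_cox p = (\<lambda>u. (u powr p - 1) / p)" by (auto simp: box_cox_def)
  show ?thesis unfolding * using assms False
    by (auto intro!: derivative_eq_intros simp: powr_diff field_simps)
qed

lemma box_cox_cont: "continuous_on {0<..} (box_cox p)"
  by (intro continuous_at_imp_continuous_on ballI DERIV_isCont[OF box_cox_deriv]) simp

lemma bcut_cont: assumes "e > 0" shows "continuous_on UNIV (bcut p e t)"
proof (cases t)
  case True
  then have *: "bcut p e t = (\<lambda>u. box_cox p (max \<bar>u\<bar> e))" by (auto simp: bcut_def)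
  show ?thesis unfolding *
    by (rule continuous_on_compose2[OF box_cox_cont]) (use assms in \<open>auto intro!: continuous_intros\<close>)
next
  case False
  then have *: "bcut p e t = (\<lambda>u. box_cox p (max u e))" by (auto simp: bcut_def)
  show ?thesis unfolding *
    by (rule continuous_on_compose2[OF box_cox_cont]) (use assms in \<open>auto intro!: continuous_intros\<close>)
qed

lemma bcut_meas [measurable]: "e > 0 \<Longrightarrow> bcut p e t \<in> borel_measurable borel"
  using bcut_cont borel_measurable_continuous_onI by blast

lemma bcut_slope_meas [measurable]: "bcut_slope p e t \<in> borel_measurable borel"
  unfolding bcut_slope_def by measurable

lemma bcut_deriv:
  assumes e: "0 < e" "e < 1" and w: "w \<noteq> e - 1" "w \<noteq> - e - 1"
  shows "((\<lambda>w. bcut p e t (1 + w) - w) has_real_derivative bcut_slope p e t w) (at w)"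
proof -
  consider "1 + w > e" | "\<bar>1 + w\<bar> < e" | "1 + w < - e" using w e by linarith
  then show ?thesis
  proof cases
    case 1
    have "((\<lambda>w. box_cox p (1 + w) - w) has_real_derivative (1 + w) powr (p - 1) - 1) (at w)"
      using 1 e by (auto intro!: derivative_eq_intros DERIV_chain2[OF box_cox_deriv])
    moreover have "eventually (\<lambda>v. v > e - 1) (nhds w)"
      using 1 by (intro order_tendstoD(1)[OF filterlim_ident]) auto
    then have "eventually (\<lambda>v. bcut p e t (1 + v) - v = box_cox p (1 + v) - v) (nhds w)"
      by eventually_elim (use e in \<open>auto simp: bcut_def max_def\<close>)
    ultimately show ?thesis using 1
      by (subst DERIV_cong_ev[OF refl _ refl]) (auto simp: bcut_slope_def)
  next
    case 2
    have "((\<lambda>w. box_cox p e - w) has_real_derivative - 1) (at w)"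
      by (auto intro!: derivative_eq_intros)
    moreover have "eventually (\<lambda>v. v > - e - 1) (nhds w)" "eventually (\<lambda>v. v < e - 1) (nhds w)"
      using 2 by (auto intro!: order_tendstoD[OF filterlim_ident])
    then have "eventually (\<lambda>v. bcut p e t (1 + v) - v = box_cox p e - v) (nhds w)"
      by eventually_elim (use e in \<open>auto simp: bcut_def max_def\<close>)
    ultimately show ?thesis using 2
      by (subst DERIV_cong_ev[OF refl _ refl]) (auto simp: bcut_slope_def)
  next
    case 3
    have ev: "eventually (\<lambda>v. v < - e - 1) (nhds w)"
      using 3 by (intro order_tendstoD(2)[OF filterlim_ident]) auto
    show ?thesis
    proof (cases t)
      case True
      have "((\<lambda>w. box_cox p (- (1 + w)) - w) has_real_derivative - ((- (1 + w)) powr (p - 1)) - 1) (at w)"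
        using 3 e by (auto intro!: derivative_eq_intros DERIV_chain2[OF box_cox_deriv])
      moreover have "eventually (\<lambda>v. bcut p e t (1 + v) - v = box_cox p (- (1 + v)) - v) (nhds w)"
        using ev by eventually_elim (use e True in \<open>auto simp: bcut_def max_def\<close>)
      ultimately show ?thesis using 3 True e
        by (subst DERIV_cong_ev[OF refl _ refl]) (auto simp: bcut_slope_def)
    next
      case False
      have "((\<lambda>w. box_cox p e - w) has_real_derivative - 1) (at w)"
        by (auto intro!: derivative_eq_intros)
      moreover have "eventually (\<lambda>v. bcut p e t (1 + v) - v = box_cox p e - v) (nhds w)"
        using ev by eventually_elim (use e False in \<open>auto simp: bcut_def max_def\<close>)
      ultimately show ?thesis using 3 False e
        by (subst DERIV_cong_ev[OF refl _ refl]) (auto simp: bcut_slope_def)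
    qed
  qed
qed

text \<open>Linear near 0, where the slope vanishes to first order, and a power further out, where
  the growth of the Lyapunov function decides.\<close>

definition slope_env :: "real \<Rightarrow> real \<Rightarrow> real" where
  "slope_env b w = (if w \<le> 1/2 then w else w powr b)"

lemma slope_env_meas [measurable]: "slope_env b \<in> borel_measurable borel"
  unfolding slope_env_def by measurable

text \<open>For |v| \<le> 1/2 the kinks are out of reach because e < 1/2, and the mean value theorem
  applies to the power. Further out, negative exponents are controlled by the cut-off, and for p > 1
  the growth is that of |v| to the power p - 1.\<close>

lemma bcut_slope_bound:
  assumes e: "0 < e" "e < 1/2" and p: "- 1 \<le> p" "p \<le> 2" and v: "v \<noteq> 0"
  shows "\<bar>bcut_slope p e t v\<bar> \<le> (16 + 1 / e\<^sup>2) * slope_env (max (p - 1) 0) \<bar>v\<bar>"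
proof (cases "\<bar>v\<bar> \<le> 1/2")
  case True
  then have v2: "1 + v > e" using e by linarith
  have "\<exists>\<zeta>. \<zeta> \<ge> 1/2 \<and> \<zeta> \<le> 3/2 \<and> (1 + v) powr (p - 1) - 1 powr (p - 1) = v * ((p - 1) * \<zeta> powr (p - 1 - 1))"
  proof -
    have d: "((\<lambda>x. x powr (p - 1)) has_real_derivative (p - 1) * x powr (p - 1 - 1)) (at x)" if "x > 0" for x
      using that by (auto intro!: derivative_eq_intros)
    consider "v > 0" | "v < 0" using v by linarith
    then show ?thesis
    proof cases
      case 1
      from MVT2[of 1 "1 + v" "\<lambda>x. x powr (p - 1)" "\<lambda>x. (p - 1) * x powr (p - 1 - 1)"] 1 d
      obtain z where "z > 1" "z < 1 + v" "(1 + v) powr (p - 1) - 1 powr (p - 1) = (1 + v - 1) * ((p - 1) * z powr (p - 1 - 1))"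
        by force
      then show ?thesis using True by (intro exI[of _ z]) auto
    next
      case 2
      have "\<exists>z. 1 + v < z \<and> z < 1 \<and> 1 powr (p - 1) - (1 + v) powr (p - 1) = (1 - (1 + v)) * ((p - 1) * z powr (p - 1 - 1))"
        by (rule MVT2) (use 2 True d in auto)
      then obtain z where z: "1 + v < z" "z < 1" "1 powr (p - 1) - (1 + v) powr (p - 1) = (1 - (1 + v)) * ((p - 1) * z powr (p - 1 - 1))"
        by blast
      show ?thesis using z True by (intro exI[of _ z]) (auto simp: algebra_simps)
    qed
  qed
  then obtain z where z: "z \<ge> 1/2" "z \<le> 3/2" "(1 + v) powr (p - 1) - 1 = v * ((p - 1) * z powr (p - 1 - 1))" by auto
  \<comment> \<open>The exponent lies in [-3, 0] and z \<ge> 1/2, hence 8 = 2^3. With |p - 1| \<le>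
    2 this gives the constant 16.\<close>
  have "z powr (p - 2) \<le> 8"
  proof -
    have "z powr (p - 2) \<le> (1/2) powr (p - 2)"
      using z p by (intro powr_mono2') auto
    also have "\<dots> \<le> (1/2) powr (-3)" using p by (intro powr_mono') auto
    also have "(1/2::real) powr (-3) = 8" by (simp add: powr_minus powr_numeral power3_eq_cube)
    finally show ?thesis .
  qed
  moreover have "\<bar>p - 1\<bar> \<le> 2" using p by auto
  ultimately have "\<bar>p - 1\<bar> * z powr (p - 2) \<le> 2 * 8" by (intro mult_mono) auto
  then have "\<bar>v\<bar> * (\<bar>p - 1\<bar> * z powr (p - 2)) \<le> \<bar>v\<bar> * 16" by (intro mult_left_mono) auto
  then have "\<bar>bcut_slope p e t v\<bar> \<le> 16 * \<bar>v\<bar>"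
    using v2 z(3) by (simp add: bcut_slope_def abs_mult)
  also have "\<dots> \<le> (16 + 1 / e\<^sup>2) * \<bar>v\<bar>" by (intro mult_right_mono) auto
  finally show ?thesis using True by (simp add: slope_env_def)
next
  case False
  define w where "w = \<bar>v\<bar>"
  have w: "w > 1/2" using False by (simp add: w_def)
  have e2: "1 / e\<^sup>2 \<ge> 4"
  proof -
    have "e\<^sup>2 \<le> (1/2)\<^sup>2" using e by (intro power_mono) auto
    then show ?thesis using e by (simp add: field_simps power2_eq_square)
  qed
  have main: "\<bar>bcut_slope p e t v\<bar> \<le> 1 + max 0 (if \<bar>1 + v\<bar> > e then \<bar>1 + v\<bar> powr (p - 1) else 0)"
    using e by (auto simp: bcut_slope_def abs_if max_def)
  have "\<bar>bcut_slope p e t v\<bar> \<le> (16 + 1 / e\<^sup>2) * w powr (max (p - 1) 0)"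
  proof (cases "p \<le> 1")
    case True
    \<comment> \<open>The exponent lies in [-2, 0] and the base exceeds e, hence the term 1 / e^2 of
      the constant.\<close>
    have "\<bar>1 + v\<bar> powr (p - 1) \<le> 1 / e\<^sup>2" if "\<bar>1 + v\<bar> > e"
    proof -
      have "\<bar>1 + v\<bar> powr (p - 1) \<le> e powr (p - 1)" using that e True by (intro powr_mono2') auto
      also have "\<dots> \<le> e powr (-2)" using p e by (intro powr_mono') auto
      also have "\<dots> = 1 / e\<^sup>2" using e by (simp add: powr_minus powr_numeral field_simps)
      finally show ?thesis .
    qed
    then have "\<bar>bcut_slope p e t v\<bar> \<le> 1 + 1 / e\<^sup>2" using main e2 by (auto split: if_splits)
    then show ?thesis using True w by (simp add: max_def)
  next
    case False
    then have p1: "p > 1" by simp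
    have le1: "1 \<le> 2 * w powr (p - 1)"
    proof -
      have "(1/2) powr 1 \<le> (1/2) powr (p - 1)" using p by (intro powr_mono') auto
      also have "\<dots> \<le> w powr (p - 1)" using w p1 by (intro powr_mono2) auto
      finally show ?thesis by simp
    qed
    have le2: "\<bar>1 + v\<bar> powr (p - 1) \<le> 3 * w powr (p - 1)"
    proof -
      have "\<bar>1 + v\<bar> \<le> 3 * w" using w by (simp add: w_def)
      then have "\<bar>1 + v\<bar> powr (p - 1) \<le> (3 * w) powr (p - 1)" using p1 by (intro powr_mono2) auto
      also have "\<dots> = 3 powr (p - 1) * w powr (p - 1)" using w by (simp add: powr_mult)
      also have "\<dots> \<le> 3 powr 1 * w powr (p - 1)" using p by (intro mult_right_mono powr_mono) auto
      finally show ?thesis by simp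
    qed
    have "\<bar>bcut_slope p e t v\<bar> \<le> 5 * w powr (p - 1)"
      using main le1 le2 by (auto split: if_splits)
    also have "\<dots> \<le> (16 + 1 / e\<^sup>2) * w powr (p - 1)" using e2 by (intro mult_right_mono) auto
    finally show ?thesis using p1 by (simp add: max_def)
  qed
  then show ?thesis using w by (simp add: slope_env_def w_def)
qed

text \<open>Supplies the primitive that \<open>layer_cake\<close> asks for; the second identity is
  the first reflected to negative steps.\<close>

lemma bcut_slope_integrals:
  assumes e: "0 < e" "e < 1/2" and p: "- 1 \<le> p" "p \<le> 2" and s: "s \<ge> 0"
  shows "(\<integral>w. indicator {0<..<s} w * bcut_slope p e t w \<partial>lborel) = bcut p e t (1 + s) - s"
    "(\<integral>w. indicator {0<..<s} w * - bcut_slope p e t (-w) \<partial>lborel) = bcut p e t (1 - s) + s"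
proof -
  \<comment> \<open>The fundamental theorem of calculus with a finite exceptional set S, which will
    hold the two kinks.\<close>
  have gen: "(\<integral>w. indicator {0<..<s} w * f w \<partial>lborel) = F s - F 0"
    if [measurable]: "f \<in> borel_measurable borel" and b: "\<And>w. \<bar>w\<bar> \<le> s \<Longrightarrow> \<bar>f w\<bar> \<le> B"
      and S: "finite S" "\<And>w. w \<notin> S \<Longrightarrow> (F has_real_derivative f w) (at w)" "continuous_on UNIV F"
    for f F :: "real \<Rightarrow> real" and B S
  proof -
    have si: "set_integrable lborel {0<..<s} f"
      unfolding set_integrable_def
    proof (rule Bochner_Integration.integrable_bound)
      show "integrable lborel (\<lambda>w. indicator {0<..<s} w *\<^sub>R B)"
        by (intro integrable_scaleR_left integrable_real_indicator) (auto simp: emeasure_lborel_Ioo s)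
      show "AE w in lborel. norm (indicator {0<..<s} w *\<^sub>R f w) \<le> norm (indicator {0<..<s} w *\<^sub>R B)"
      proof (rule AE_I2)
        fix w show "norm (indicator {0<..<s} w *\<^sub>R f w) \<le> norm (indicator {0<..<s} w *\<^sub>R B)"
          using b[of w] by (auto simp: indicator_def)
      qed
    qed measurable
    have "(f has_integral F s - F 0) {0..s}"
      by (rule fundamental_theorem_of_calculus_interior_strong[OF S(1) s])
         (use S in \<open>auto simp: has_real_derivative_iff_has_vector_derivative[symmetric] intro: continuous_on_subset\<close>)
    then have "integral {0<..<s} f = F s - F 0"
      by (simp add: integral_open_interval_real[symmetric] integral_unique)
    then show ?thesis
      using set_borel_integral_eq_integral(2)[OF si] by (simp add: set_lebesgue_integral_def)
  qed
  have HHb: "slope_env (max (p - 1) 0) \<bar>w\<bar> \<le> s + s powr (max (p - 1) 0) + 1" if "\<bar>w\<bar> \<le> s" for w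
  proof -
    have "\<bar>w\<bar> powr max (p - 1) 0 \<le> s powr max (p - 1) 0" using that by (intro powr_mono2) auto
    then show ?thesis using that s unfolding slope_env_def by (smt (verit) powr_ge_zero)
  qed
  have g0: "bcut_slope p e t 0 = 0" using e by (simp add: bcut_slope_def)
  have b: "\<bar>bcut_slope p e t w\<bar> \<le> (16 + 1 / e\<^sup>2) * (s + s powr (max (p - 1) 0) + 1)" if "\<bar>w\<bar> \<le> s" for w
  proof (cases "w = 0")
    case False
    have "(16 + 1 / e\<^sup>2) * slope_env (max (p - 1) 0) \<bar>w\<bar> \<le> (16 + 1 / e\<^sup>2) * (s + s powr (max (p - 1) 0) + 1)"
      using HHb[OF that] by (intro mult_left_mono) auto
    then show ?thesis using bcut_slope_bound[OF e p False, of t] by linarith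
  qed (use s in \<open>auto simp: g0\<close>)
  have F1: "bcut p e t 1 = 0" using e by (auto simp: bcut_def max_def)
  have c1: "continuous_on UNIV (\<lambda>w. bcut p e t (1 + w) - w)"
    by (intro continuous_intros continuous_on_compose2[OF bcut_cont]) (use e in auto)
  have c2: "continuous_on UNIV (\<lambda>w. bcut p e t (1 + - w) - - w)"
    by (intro continuous_intros continuous_on_compose2[OF bcut_cont]) (use e in auto)
  show "(\<integral>w. indicator {0<..<s} w * bcut_slope p e t w \<partial>lborel) = bcut p e t (1 + s) - s"
    using gen[of "bcut_slope p e t" "(16 + 1 / e\<^sup>2) * (s + s powr (max (p - 1) 0) + 1)" "{e - 1, - e - 1}" "\<lambda>w. bcut p e t (1 + w) - w"]
      b bcut_deriv[of e] c1 e by (simp add: F1)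
  have "((\<lambda>w. bcut p e t (1 + - w) - - w) has_real_derivative bcut_slope p e t (-w) * (-1)) (at w)"
    if "w \<notin> {1 - e, 1 + e}" for w
    by (rule DERIV_chain2[OF bcut_deriv]) (use that e in \<open>auto intro!: derivative_eq_intros\<close>)
  then show "(\<integral>w. indicator {0<..<s} w * - bcut_slope p e t (-w) \<partial>lborel) = bcut p e t (1 - s) + s"
    using gen[of "\<lambda>w. - bcut_slope p e t (-w)" "(16 + 1 / e\<^sup>2) * (s + s powr (max (p - 1) 0) + 1)" "{1 - e, 1 + e}" "\<lambda>w. bcut p e t (1 + - w) - - w"]
      b c2 by (simp add: F1)
qed

lemma powr_lborel_0:
  assumes "a > -1" "c \<ge> 0"
  shows "integrable lborel (\<lambda>x::real. indicator {0..c} x * x powr a)"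
    "(\<integral>x. indicator {0..c} x * x powr a \<partial>lborel) = c powr (a + 1) / (a + 1)"
proof -
  have "((\<lambda>x. indicator {0..c} x * x powr a) has_integral c powr (a+1) / (a+1)) UNIV"
  proof -
    have "(\<lambda>x. indicator {0..c} x * x powr a) = (\<lambda>x. if x \<in> {0..c} then x powr a else 0)"
      by (auto simp: fun_eq_iff indicator_def)
    then show ?thesis using has_integral_powr_from_0[OF assms] by (simp only: has_integral_restrict_UNIV)
  qed
  then have "(\<integral>\<^sup>+x. ennreal (indicator {0..c} x * x powr a) \<partial>lborel) = ennreal (c powr (a+1) / (a+1))"
    by (intro nn_integral_has_integral_lborel) auto
  moreover have "c powr (a+1) / (a+1) \<ge> 0" using assms by simp
  ultimately show "integrable lborel (\<lambda>x::real. indicator {0..c} x * x powr a)"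
    "(\<integral>x. indicator {0..c} x * x powr a \<partial>lborel) = c powr (a + 1) / (a + 1)"
    using nn_integral_eq_integrable[of "\<lambda>x::real. indicator {0..c} x * x powr a" lborel] by auto
qed

lemma powr_lborel_inf:
  assumes "a < -1" "c > 0"
  shows "integrable lborel (\<lambda>x::real. indicator {c..} x * x powr a)"
    "(\<integral>x. indicator {c..} x * x powr a \<partial>lborel) = - (c powr (a + 1)) / (a + 1)"
proof -
  have "((\<lambda>x. indicator {c..} x * x powr a) has_integral - (c powr (a+1)) / (a+1)) UNIV"
  proof -
    have "(\<lambda>x. indicator {c..} x * x powr a) = (\<lambda>x. if x \<in> {c..} then x powr a else 0)"
      by (auto simp: fun_eq_iff indicator_def)
    then show ?thesis using has_integral_powr_to_inf[OF assms] by (simp only: has_integral_restrict_UNIV)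
  qed
  then have "(\<integral>\<^sup>+x. ennreal (indicator {c..} x * x powr a) \<partial>lborel) = ennreal (- (c powr (a+1)) / (a+1))"
    by (intro nn_integral_has_integral_lborel) auto
  moreover have "- (c powr (a+1)) / (a+1) \<ge> 0" using assms by (intro divide_nonpos_neg) auto
  ultimately show "integrable lborel (\<lambda>x::real. indicator {c..} x * x powr a)"
    "(\<integral>x. indicator {c..} x * x powr a \<partial>lborel) = - (c powr (a + 1)) / (a + 1)"
    using nn_integral_eq_integrable[of "\<lambda>x::real. indicator {c..} x * x powr a" lborel] by auto
qed

text \<open>At 0 the exponent is 1 - a > -1 because a < 2; at infinity it is b - a < -1. With b = p
  - 1 the latter says p < a: the Lyapunov function must grow more slowly than the moments of the
  step allow.\<close>

lemma slope_env_integrable: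
  assumes "1 < a" "a < 2" "0 \<le> b" "b < a - 1"
  shows "integrable lborel (\<lambda>w. indicator {0<..} w * (slope_env b w * w powr (-a)))"
proof (rule Bochner_Integration.integrable_bound)
  show "integrable lborel (\<lambda>w::real. indicator {0..1/2} w * w powr (1 - a) + indicator {1/2..} w * w powr (b - a))"
    using assms by (intro Bochner_Integration.integrable_add powr_lborel_0 powr_lborel_inf) auto
  show "AE w in lborel. norm (indicator {0<..} w * (slope_env b w * w powr (-a)))
      \<le> norm (indicator {0..1/2} w * w powr (1 - a) + indicator {1/2..} w * w powr (b - a))"
  proof (rule AE_I2)
    fix w :: real
    have *: "w * w powr (-a) = w powr (1 - a)" "w powr b * w powr (-a) = w powr (b - a)" if "w > 0"
      using that by (simp_all add: powr_diff powr_minus field_simps)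
    show "norm (indicator {0<..} w * (slope_env b w * w powr (-a)))
      \<le> norm (indicator {0..1/2} w * w powr (1 - a) + indicator {1/2..} w * w powr (b - a))"
      using * by (cases "w \<le> 0"; cases "w = 1/2"; cases "w < 1/2") (auto simp: slope_env_def)
  qed
qed measurable

text \<open>Up to integration by parts, the jump integral of \<open>bcut\<close> at the point 1 for
  the symmetric measure with tails w^(-a). The two compensating terms -1 inside the slopes
  cancel.\<close>

definition jump_int :: "real \<Rightarrow> real \<Rightarrow> real \<Rightarrow> bool \<Rightarrow> real" where
  "jump_int a p e t = (\<integral>w. indicator {0<..} w * ((bcut_slope p e t w - bcut_slope p e t (-w)) * w powr (-a)) \<partial>lborel)"

text \<open>A sequence of step laws \<open>P n\<close>, to be thought of as the steps of the chain from points at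
  distance \<open>r n\<close> from the origin, oriented away from the origin.\<close>

locale balanced_tails =
  fixes \<alpha> c C0 :: real and P :: "nat \<Rightarrow> real measure" and r :: "nat \<Rightarrow> real"
  assumes \<alpha>: "1 < \<alpha>" "\<alpha> < 2" and c: "c > 0"
    and prob: "\<And>n. prob_space (P n)" and sP [measurable_cong, simp]: "\<And>n. sets (P n) = sets borel"
    and r: "\<And>n. r n > 0" "filterlim r at_top sequentially"
    and tailC: "\<And>n y. y > 0 \<Longrightarrow> measure (P n) {y<..} \<le> C0 * y powr (-\<alpha>)"
      "\<And>n y. y > 0 \<Longrightarrow> measure (P n) {..<-y} \<le> C0 * y powr (-\<alpha>)"
    and tail: "\<And>w. w > 0 \<Longrightarrow> (\<lambda>n. r n powr \<alpha> * measure (P n) {r n * w<..}) \<longlonglongrightarrow> c * w powr (-\<alpha>)"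
      "\<And>w. w > 0 \<Longrightarrow> (\<lambda>n. r n powr \<alpha> * measure (P n) {..<-(r n * w)}) \<longlonglongrightarrow> c * w powr (-\<alpha>)"
begin

lemma C0: "C0 \<ge> 0"
proof -
  have "0 \<le> measure (P 0) {1<..}" by simp
  also have "\<dots> \<le> C0" using tailC(1)[of 1 0] by simp
  finally show ?thesis .
qed

lemma integrable_step: "integrable (P n) (\<lambda>t. t)"
proof -
  \<comment> \<open>Below 1 a probability is bounded by 1 instead, since w^(-\<alpha>) is not
    integrable at 0.\<close>
  define D where "D w = indicator {0..1} w * w powr 0 + C0 * (indicator {1..} w * w powr (-\<alpha>))" for w :: real
  have "integrable lborel D"
    unfolding D_def using \<alpha>
    by (intro Bochner_Integration.integrable_add integrable_mult_right powr_lborel_0 powr_lborel_inf) auto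
  moreover have "\<bar>1\<bar> * measure (P n) {1*w<..} \<le> D w" "\<bar>1\<bar> * measure (P n) {..<-(1*w)} \<le> D w" if w: "w > 0" for w
  proof -
    have m1: "measure (P n) S \<le> 1" for S by (rule prob_space.prob_le_1[OF prob])
    show "\<bar>1\<bar> * measure (P n) {1*w<..} \<le> D w" "\<bar>1\<bar> * measure (P n) {..<-(1*w)} \<le> D w"
      using tailC[OF w, of n] m1[of "{w<..}"] m1[of "{..<-w}"] w C0
      by (cases "w < 1"; cases "w = 1"; simp add: D_def)+
  qed
  moreover have "(\<integral>w. indicator {0<..<s} w * 1 \<partial>lborel) = s" "(\<integral>w. indicator {0<..<s} w * - 1 \<partial>lborel) = - s"
    if "s \<ge> 0" for s :: real using that by simp_all
  ultimately show ?thesis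
    using layer_cake(1)[OF prob[of n] sP[of n], of "\<lambda>_. 1" 1 D "\<lambda>s. s"] by simp
qed

text \<open>Dominated convergence in the layer-cake formula. The mean has to be split off first:
  only the slope without its linear part is of order w near 0, and this is what makes the majorant w
  * w^(-\<alpha>) integrable there.\<close>

lemma bcut_limit:
  assumes e: "0 < e" "e < 1/2" and p: "- 1 \<le> p" "p < \<alpha>"
  shows "integrable (P n) (\<lambda>t'. bcut p e t (1 + t' / r n))"
    "(\<lambda>n. r n powr \<alpha> * ((\<integral>t'. bcut p e t (1 + t' / r n) \<partial>P n) - (\<integral>t'. t' \<partial>P n) / r n)) \<longlonglongrightarrow> c * jump_int \<alpha> p e t"
proof -
  define b where "b = max (p - 1) 0"
  define H where "H w = indicator {0<..} w * (slope_env b w * w powr (-\<alpha>))" for w :: real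
  define B where "B = 16 + 1 / e\<^sup>2"
  have B: "B \<ge> 0" by (simp add: B_def)
  have H: "integrable lborel H"
    unfolding H_def by (rule slope_env_integrable) (use \<alpha> p in \<open>auto simp: b_def\<close>)
  have p2: "p \<le> 2" using p \<alpha> by simp
  have gb: "\<bar>bcut_slope p e t w\<bar> \<le> B * slope_env b w" "\<bar>bcut_slope p e t (-w)\<bar> \<le> B * slope_env b w" if "w > 0" for w
    using bcut_slope_bound[OF e p(1) p2, of w] bcut_slope_bound[OF e p(1) p2, of "-w"] that by (auto simp: B_def b_def)
  have HHp: "slope_env b w \<ge> 0" if "w > 0" for w using that by (simp add: slope_env_def)
  have scale: "(r n * w) powr (-\<alpha>) = r n powr (-\<alpha>) * w powr (-\<alpha>)" if "w > 0" for w n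
    using r(1)[of n] that by (simp add: powr_mult)
  define D where "D n w = B * C0 * r n powr (-\<alpha>) * H w" for n w
  have D: "integrable lborel (D n)" for n unfolding D_def using H by simp
  have D1: "\<bar>bcut_slope p e t w\<bar> * measure (P n) {r n * w<..} \<le> D n w"
    "\<bar>bcut_slope p e t (-w)\<bar> * measure (P n) {..<-(r n * w)} \<le> D n w" if w: "w > 0" for n w
  proof -
    have rw: "r n * w > 0" using r(1) w by simp
    have eq: "(B * slope_env b w) * (C0 * (r n * w) powr (-\<alpha>)) = D n w"
      using w by (simp add: D_def H_def scale)
    have "\<bar>bcut_slope p e t w\<bar> * measure (P n) {r n * w<..} \<le> (B * slope_env b w) * (C0 * (r n * w) powr (-\<alpha>))"
      by (intro mult_mono gb w tailC rw) (use B HHp[OF w] in auto)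
    then show "\<bar>bcut_slope p e t w\<bar> * measure (P n) {r n * w<..} \<le> D n w" unfolding eq .
    have "\<bar>bcut_slope p e t (-w)\<bar> * measure (P n) {..<-(r n * w)} \<le> (B * slope_env b w) * (C0 * (r n * w) powr (-\<alpha>))"
      by (intro mult_mono gb w tailC rw) (use B HHp[OF w] in auto)
    then show "\<bar>bcut_slope p e t (-w)\<bar> * measure (P n) {..<-(r n * w)} \<le> D n w" unfolding eq .
  qed
  have G: "(\<integral>w. indicator {0<..<s} w * bcut_slope p e t w \<partial>lborel) = bcut p e t (1 + s) - s"
     "(\<integral>w. indicator {0<..<s} w * - bcut_slope p e t (-w) \<partial>lborel) = bcut p e t (1 + - s) - - s" if "s \<ge> 0" for s
    using bcut_slope_integrals[OF e p(1) p2 that] by auto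
  note lc = layer_cake[OF prob sP bcut_slope_meas r(1) D D1(1) D1(2) G(1) G(2)]
  have i1: "integrable (P n) (\<lambda>t'. t' / r n)" for n using integrable_step[of n] by simp
  show i2: "integrable (P n) (\<lambda>t'. bcut p e t (1 + t' / r n))" for n
    using Bochner_Integration.integrable_add[OF lc(1)[of n] i1[of n]] by simp
  define k where "k n w = indicator {0<..} w * (bcut_slope p e t w * (r n powr \<alpha> * measure (P n) {r n * w<..})
     - bcut_slope p e t (-w) * (r n powr \<alpha> * measure (P n) {..<-(r n * w)}))" for n w
  have eq: "r n powr \<alpha> * ((\<integral>t'. bcut p e t (1 + t' / r n) \<partial>P n) - (\<integral>t'. t' \<partial>P n) / r n) = (\<integral>w. k n w \<partial>lborel)" for n
  proof -
    have "(\<integral>t'. bcut p e t (1 + t' / r n) \<partial>P n) - (\<integral>t'. t' \<partial>P n) / r n = (\<integral>t'. bcut p e t (1 + t' / r n) - t' / r n \<partial>P n)"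
      by (simp add: Bochner_Integration.integral_diff[OF i2 i1])
    also have "\<dots> = (\<integral>w. indicator {0<..} w * (bcut_slope p e t w * measure (P n) {r n * w<..} - bcut_slope p e t (-w) * measure (P n) {..<-(r n * w)}) \<partial>lborel)"
      by (rule lc(2))
    finally show ?thesis
      by (simp add: k_def algebra_simps flip: integral_mult_right_zero)
  qed
  \<comment> \<open>A tail is monotone in its level and therefore measurable.\<close>
  have [measurable]: "(\<lambda>w. measure (P n) {r n * w<..}) \<in> borel_measurable borel"
    "(\<lambda>w. measure (P n) {..<-(r n * w)}) \<in> borel_measurable borel" for n
  proof -
    interpret prob_space "P n" by (rule prob)
    have "mono (\<lambda>w. - prob {r n * w<..})" "mono (\<lambda>w. - prob {..<-(r n * w)})"
      using r(1)[of n] by (auto simp: mono_def intro!: finite_measure_mono dest: mult_left_mono[of _ _ "r n"])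
    then have "(\<lambda>w. - (- prob {r n * w<..})) \<in> borel_measurable borel"
      "(\<lambda>w. - (- prob {..<-(r n * w)})) \<in> borel_measurable borel"
      by (intro borel_measurable_uminus borel_measurable_mono; simp)+
    then show "(\<lambda>w. measure (P n) {r n * w<..}) \<in> borel_measurable borel"
      "(\<lambda>w. measure (P n) {..<-(r n * w)}) \<in> borel_measurable borel" by simp_all
  qed
  have "(\<lambda>n. \<integral>w. k n w \<partial>lborel) \<longlonglongrightarrow> (\<integral>w. indicator {0<..} w * (bcut_slope p e t w * (c * w powr (-\<alpha>)) - bcut_slope p e t (-w) * (c * w powr (-\<alpha>))) \<partial>lborel)"
  proof (rule integral_dominated_convergence[where w="\<lambda>w. 2 * (B * C0 * H w)"])
    show "integrable lborel (\<lambda>w. 2 * (B * C0 * H w))" using H by simp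
    show "AE w in lborel. (\<lambda>n. k n w) \<longlonglongrightarrow> indicator {0<..} w * (bcut_slope p e t w * (c * w powr (-\<alpha>)) - bcut_slope p e t (-w) * (c * w powr (-\<alpha>)))"
    proof (rule AE_I2)
      fix w :: real
      show "(\<lambda>n. k n w) \<longlonglongrightarrow> indicator {0<..} w * (bcut_slope p e t w * (c * w powr (-\<alpha>)) - bcut_slope p e t (-w) * (c * w powr (-\<alpha>)))"
        unfolding k_def by (cases "w > 0") (auto intro!: tendsto_intros tail)
    qed
    fix n
    show "AE w in lborel. norm (k n w) \<le> 2 * (B * C0 * H w)"
    proof (rule AE_I2)
      fix w :: real
      show "norm (k n w) \<le> 2 * (B * C0 * H w)"
      proof (cases "w > 0")
        case True
        have ra: "r n powr \<alpha> * r n powr (-\<alpha>) = 1" using r(1)[of n] by (simp add: powr_minus)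
        have "\<bar>k n w\<bar> \<le> r n powr \<alpha> * (\<bar>bcut_slope p e t w\<bar> * measure (P n) {r n * w<..}) + r n powr \<alpha> * (\<bar>bcut_slope p e t (-w)\<bar> * measure (P n) {..<-(r n * w)})"
          using True by (simp add: k_def abs_mult mult_ac order_trans[OF abs_triangle_ineq4])
        also have "\<dots> \<le> r n powr \<alpha> * D n w + r n powr \<alpha> * D n w"
          by (intro add_mono mult_left_mono D1 True) auto
        also have "\<dots> = 2 * (B * C0 * H w) * (r n powr \<alpha> * r n powr (-\<alpha>))" by (simp add: D_def)
        finally show ?thesis unfolding ra by simp
      qed (simp add: k_def H_def)
    qed
  qed (simp_all add: k_def)
  also have "(\<integral>w. indicator {0<..} w * (bcut_slope p e t w * (c * w powr (-\<alpha>)) - bcut_slope p e t (-w) * (c * w powr (-\<alpha>))) \<partial>lborel) = c * jump_int \<alpha> p e t"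
    unfolding jump_int_def by (subst integral_mult_right_zero[symmetric]) (simp add: algebra_simps)
  finally show "(\<lambda>n. r n powr \<alpha> * ((\<integral>t'. bcut p e t (1 + t' / r n) \<partial>P n) - (\<integral>t'. t' \<partial>P n) / r n)) \<longlonglongrightarrow> c * jump_int \<alpha> p e t"
    unfolding eq .
qed

end

subsection \<open>The jump integral\<close>

lemma jump_int_dominated:
  assumes e: "0 < e" "e < 1/2" and p: "- 1 \<le> p" "p \<le> 2" and w: "w > 0"
  shows "\<bar>(bcut_slope p e t w - bcut_slope p e t (-w)) * w powr (-a)\<bar>
    \<le> 2 * (16 + 1 / e\<^sup>2) * (slope_env (max (p - 1) 0) w * w powr (-a))"
proof -
  have "\<bar>bcut_slope p e t w - bcut_slope p e t (-w)\<bar> \<le> 2 * (16 + 1 / e\<^sup>2) * slope_env (max (p - 1) 0) w"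
  proof -
    define C where "C = (16 + 1 / e\<^sup>2) * slope_env (max (p - 1) 0) w"
    have "\<bar>bcut_slope p e t w\<bar> \<le> C" "\<bar>bcut_slope p e t (-w)\<bar> \<le> C"
      using bcut_slope_bound[OF e p, of w t] bcut_slope_bound[OF e p, of "-w" t] w by (auto simp: C_def)
    then have "\<bar>bcut_slope p e t w - bcut_slope p e t (-w)\<bar> \<le> 2 * C" by linarith
    then show ?thesis unfolding C_def by (simp only: mult.assoc)
  qed
  then show ?thesis by (simp add: abs_mult mult_right_mono flip: mult.assoc)
qed

lemma jump_int_integrable:
  assumes a: "1 < a" "a < 2" and e: "0 < e" "e < 1/2" and p: "- 1 \<le> p" "p \<le> 1"
  shows "integrable lborel (\<lambda>w. indicator {0<..} w * ((bcut_slope p e t w - bcut_slope p e t (-w)) * w powr (-a)))"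
proof (rule Bochner_Integration.integrable_bound)
  show "integrable lborel (\<lambda>w. 2 * (16 + 1 / e\<^sup>2) * (indicator {0<..} w * (slope_env 0 w * w powr (-a))))"
    using slope_env_integrable[of a 0] a by simp
  have p2: "p \<le> 2" "max (p - 1) 0 = 0" using p by auto
  show "AE w in lborel. norm (indicator {0<..} w * ((bcut_slope p e t w - bcut_slope p e t (-w)) * w powr (-a)))
    \<le> norm (2 * (16 + 1 / e\<^sup>2) * (indicator {0<..} w * (slope_env 0 w * w powr (-a))))"
  proof (rule AE_I2)
    fix w
    show "norm (indicator {0<..} w * ((bcut_slope p e t w - bcut_slope p e t (-w)) * w powr (-a)))
    \<le> norm (2 * (16 + 1 / e\<^sup>2) * (indicator {0<..} w * (slope_env 0 w * w powr (-a))))"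
    proof (cases "w > 0")
      case True
      show ?thesis using jump_int_dominated[OF e p(1) p2(1) True, of t a] True unfolding p2(2)
        by (simp add: order_trans[OF _ abs_ge_self])
    qed simp
  qed
qed measurable

text \<open>Carries the sign of the critical quantity from the logarithm to small negative powers.
  The cut-off e stays fixed, because the majorant grows like 1 / e^2.\<close>

lemma jump_int_tendsto_0:
  assumes a: "1 < a" "a < 2" and e: "0 < e" "e < 1/2"
    and p: "\<And>n. - 1 \<le> p n" "\<And>n. p n \<le> 1" "p \<longlonglongrightarrow> 0"
  shows "(\<lambda>n. jump_int a (p n) e t) \<longlonglongrightarrow> jump_int a 0 e t"
  unfolding jump_int_def
proof (rule integral_dominated_convergence[where w="\<lambda>w. 2 * (16 + 1 / e\<^sup>2) * (indicator {0<..} w * (slope_env 0 w * w powr (-a)))"])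
  show "integrable lborel (\<lambda>w. 2 * (16 + 1 / e\<^sup>2) * (indicator {0<..} w * (slope_env 0 w * w powr (-a))))"
    using slope_env_integrable[of a 0] a by simp
  have lim: "(\<lambda>n. bcut_slope (p n) e t v) \<longlonglongrightarrow> bcut_slope 0 e t v" for v
  proof -
    have "(\<lambda>n. u powr (p n - 1)) \<longlonglongrightarrow> u powr (0 - 1)" if "u > 0" for u :: real
      using that by (intro tendsto_powr tendsto_intros p) auto
    from this[of "1 + v"] this[of "- (1 + v)"] show ?thesis
      using e unfolding bcut_slope_def by (auto intro!: tendsto_intros)
  qed
  show "AE w in lborel. (\<lambda>n. indicator {0<..} w * ((bcut_slope (p n) e t w - bcut_slope (p n) e t (- w)) * w powr - a))
      \<longlonglongrightarrow> indicator {0<..} w * ((bcut_slope 0 e t w - bcut_slope 0 e t (- w)) * w powr - a)"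
    by (intro AE_I2 tendsto_intros lim)
  fix n
  have p2: "p n \<le> 2" "max (p n - 1) 0 = 0" using p(2)[of n] by auto
  show "AE w in lborel. norm (indicator {0<..} w * ((bcut_slope (p n) e t w - bcut_slope (p n) e t (- w)) * w powr - a))
      \<le> 2 * (16 + 1 / e\<^sup>2) * (indicator {0<..} w * (slope_env 0 w * w powr (-a)))"
  proof (rule AE_I2)
    fix w
    show "norm (indicator {0<..} w * ((bcut_slope (p n) e t w - bcut_slope (p n) e t (- w)) * w powr - a))
      \<le> 2 * (16 + 1 / e\<^sup>2) * (indicator {0<..} w * (slope_env 0 w * w powr (-a)))"
      using jump_int_dominated[OF e p(1) p2(1), of w t a] unfolding p2(2) by (cases "w > 0") auto
  qed
qed measurable

text \<open>Inward jumps give the integral of -1/(1 - w) up to w = 1 - e, which behaves like log e.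
  In the one-sided case jumps beyond the origin gain nothing back, so this logarithm is not
  cancelled and outweighs any given drift constant.\<close>

lemma jump_int_one_sided_unbounded:
  assumes a: "1 < a" "a < 2"
  shows "\<exists>e. 0 < e \<and> e < 1/2 \<and> jump_int a 0 e False \<le> - L"
proof -
  define Ka where "Ka = (\<integral>x. indicator {1/2..} x * x powr (-a) \<partial>lborel)"
  \<comment> \<open>Chosen so that \<open>ln (2 * e)\<close> absorbs both L and the constant
    \<open>Ka\<close>; the division by 2 keeps e below 1/2.\<close>
  define e where "e = exp (- \<bar>L\<bar> - \<bar>Ka\<bar> - 1) / 2"
  have e: "0 < e" "e < 1/2" by (auto simp: e_def)
  have le: "ln (2 * e) = - \<bar>L\<bar> - \<bar>Ka\<bar> - 1" by (simp add: e_def)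
  define h where "h w = 1 / (1 - w)" for w :: real
  have h: "integrable lborel (\<lambda>x. h x * indicator {1/2..1-e} x)"
    "(\<integral>x. h x * indicator {1/2..1-e} x \<partial>lborel) = - ln (1 - (1 - e)) - - ln (1 - 1/2)"
  proof -
    have [measurable]: "h \<in> borel_measurable borel" unfolding h_def by measurable
    have d: "((\<lambda>w. - ln (1 - w)) has_real_derivative h x) (at x)" if "x \<le> 1 - e" for x
      using that e unfolding h_def by (auto intro!: derivative_eq_intros simp: field_simps)
    have nn: "0 \<le> h x" if "x \<le> 1 - e" for x using that e by (simp add: h_def)
    show "integrable lborel (\<lambda>x. h x * indicator {1/2..1-e} x)"
      by (rule integrable_FTC_Icc_nonneg[where F="\<lambda>w. - ln (1 - w)"]) (use d nn e in \<open>auto intro: has_field_derivative_at_within\<close>)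
    show "(\<integral>x. h x * indicator {1/2..1-e} x \<partial>lborel) = - ln (1 - (1 - e)) - - ln (1 - 1/2)"
      by (rule integral_FTC_Icc_nonneg[where F="\<lambda>w. - ln (1 - w)"]) (use d nn e in \<open>auto intro: has_field_derivative_at_within\<close>)
  qed
  have i1: "integrable lborel (\<lambda>x::real. indicator {1/2..} x * x powr (-a))"
    by (rule powr_lborel_inf) (use a in auto)
  \<comment> \<open>Below 1/2 the integrand is nonpositive. From 1/2 on, 1/(1 + w) is replaced by 1;
    on the part up to 1 - e, w^(-a) \<ge> 1 is dropped in front of the singular term.\<close>
  have "jump_int a 0 e False \<le> (\<integral>x. indicator {1/2..} x * x powr (-a) - h x * indicator {1/2..1-e} x \<partial>lborel)"
    unfolding jump_int_def
  proof (rule integral_mono_AE)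
    show "integrable lborel (\<lambda>w. indicator {0<..} w * ((bcut_slope 0 e False w - bcut_slope 0 e False (-w)) * w powr (-a)))"
      by (rule jump_int_integrable) (use a e in auto)
    show "integrable lborel (\<lambda>x. indicator {1/2..} x * x powr (-a) - h x * indicator {1/2..1-e} x)"
      by (intro Bochner_Integration.integrable_diff i1 h)
    have "AE w in lborel. w \<noteq> 1 - e" by (rule AE_lborel_singleton)
    then show "AE w in lborel. indicator {0<..} w * ((bcut_slope 0 e False w - bcut_slope 0 e False (- w)) * w powr - a)
         \<le> indicator {1/2..} w * w powr - a - h w * indicator {1/2..1-e} w"
    proof eventually_elim
      case (elim w)
      show ?case
      proof (cases "w > 0")
        case False then show ?thesis by (auto simp: indicator_def)
      next
        case w: True
        have g1: "bcut_slope 0 e False w = 1 / (1 + w) - 1"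
          using w e by (simp add: bcut_slope_def powr_minus_divide)
        have g2: "bcut_slope 0 e False (- w) = (if w < 1 - e then 1 / (1 - w) else 0) - 1"
          using w e by (auto simp: bcut_slope_def powr_minus_divide)
        have l1: "1 / (1 + w) \<le> 1" using w by simp
        show ?thesis
        proof (cases "w < 1 - e")
          case True
          have neg: "1 / (1 + w) - 1 / (1 - w) \<le> 0"
          proof -
            have "1 \<le> 1 / (1 - w)" using True w e by (simp add: le_divide_eq)
            then show ?thesis using l1 by linarith
          qed
          show ?thesis
          proof (cases "w < 1/2")
            case True
            then show ?thesis using neg w \<open>w < 1 - e\<close>
              by (simp add: g1 g2 mult_nonpos_nonneg)
          next
            case False
            have pw: "w powr (-a) \<ge> 1"
            proof -
              have "w powr 0 \<le> w powr (-a)" using \<open>w < 1 - e\<close> w e a by (intro powr_mono') auto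
              then show ?thesis using w by simp
            qed
            have "1 / (1 + w) * w powr (-a) \<le> 1 * w powr (-a)" by (intro mult_right_mono l1) auto
            moreover have "1 / (1 - w) * 1 \<le> 1 / (1 - w) * w powr (-a)"
              using pw True e by (intro mult_left_mono) auto
            ultimately show ?thesis using w False \<open>w < 1 - e\<close>
              by (simp add: g1 g2 h_def left_diff_distrib)
          qed
        next
          case False
          have "1 / (1 + w) * w powr (-a) \<le> 1 * w powr (-a)" by (intro mult_right_mono l1) auto
          then show ?thesis using w False elim e by (simp add: g1 g2)
        qed
      qed
    qed
  qed
  also have "\<dots> = Ka - (- ln (1 - (1 - e)) - - ln (1 - 1/2))"
    unfolding Ka_def h(2)[symmetric] by (rule Bochner_Integration.integral_diff[OF i1 h(1)])
  also have "\<dots> = Ka + ln (2 * e)"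
    using e by (simp add: ln_mult ln_div)
  also have "\<dots> \<le> - L" unfolding le by linarith
  finally show ?thesis using e by blast
qed

section \<open>The value of the two-sided jump integral\<close>

text \<open>By the reflection formula, Gamma(x) Gamma(1 - x) sin(pi x) is constant on (0, 1). Its
  vanishing derivative at s is the reflection formula for Digamma, and the series of Digamma turns
  that into the stated sum.\<close>

lemma pi_cot_sums:
  fixes s :: real
  assumes s: "0 < s" "s < 1"
  shows "(\<Sum>k. 1 / (real k + s) - 1 / (real k + 1 - s)) = pi * cot (pi * s)"
proof -
  have rf: "Gamma x * Gamma (1 - x) * sin (pi * x) = pi" if "0 < x" "x < 1" for x :: real
  proof -
    have sn: "sin (pi * x) > 0" using that by (intro sin_gt_zero) auto
    have "complex_of_real (Gamma x * Gamma (1 - x)) = Gamma (of_real x) * Gamma (1 - of_real x)"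
      by (simp flip: Gamma_complex_of_real)
    also have "\<dots> = of_real pi / sin (of_real pi * of_real x)" by (rule Gamma_reflection_complex)
    also have "\<dots> = of_real (pi / sin (pi * x))" by (simp add: sin_of_real flip: of_real_mult)
    finally have "Gamma x * Gamma (1 - x) = pi / sin (pi * x)" by (simp only: of_real_eq_iff)
    then show ?thesis using sn by simp
  qed
  have "((\<lambda>x. Gamma x * Gamma (1 - x) * sin (pi * x)) has_real_derivative
      Gamma s * Gamma (1 - s) * ((Digamma s - Digamma (1 - s)) * sin (pi * s) + pi * cos (pi * s))) (at s)"
  proof -
    have ni: "s \<notin> \<int>\<^sub>\<le>\<^sub>0" "1 - s \<notin> \<int>\<^sub>\<le>\<^sub>0" using s by (auto elim!: nonpos_Ints_cases)
    show ?thesis using ni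
      by (auto intro!: derivative_eq_intros simp: algebra_simps)
  qed
  moreover have "((\<lambda>x. Gamma x * Gamma (1 - x) * sin (pi * x)) has_real_derivative 0) (at s)"
  proof -
    have "eventually (\<lambda>x. x > 0) (nhds s)" "eventually (\<lambda>x. x < 1) (nhds s)"
      using s by (auto intro!: order_tendstoD[OF filterlim_ident])
    then have "eventually (\<lambda>x. Gamma x * Gamma (1 - x) * sin (pi * x) = pi) (nhds s)"
      by eventually_elim (rule rf)
    then show ?thesis by (subst DERIV_cong_ev[OF refl _ refl]) auto
  qed
  ultimately have "Gamma s * Gamma (1 - s) * ((Digamma s - Digamma (1 - s)) * sin (pi * s) + pi * cos (pi * s)) = 0"
    by (rule DERIV_unique)
  moreover have "Gamma s * Gamma (1 - s) \<noteq> 0" using rf[OF s] by auto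
  ultimately have "(Digamma s - Digamma (1 - s)) * sin (pi * s) + pi * cos (pi * s) = 0" by simp
  moreover have sn: "sin (pi * s) > 0" using s by (intro sin_gt_zero) auto
  ultimately have 1: "Digamma (1 - s) - Digamma s = pi * cot (pi * s)"
    by (simp add: cot_def field_simps)
  have "Digamma (1 - s) - Digamma s = (\<Sum>k. (inverse (real (Suc k)) - inverse (1 - s + real k)) - (inverse (real (Suc k)) - inverse (s + real k)))"
    unfolding Digamma_def using suminf_diff[OF summable_Digamma[of "1 - s"] summable_Digamma[of s]] s by simp
  also have "\<dots> = (\<Sum>k. 1 / (real k + s) - 1 / (real k + 1 - s))"
    by (intro suminf_cong) (simp add: inverse_eq_divide algebra_simps)
  finally show ?thesis using 1 by simp
qed

lemma geometric_powr_sums: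
  fixes w :: real
  assumes "0 < w" "w < 1"
  shows "(\<lambda>k. w powr (2 * real k + b)) sums (w powr b / (1 - w\<^sup>2))"
proof -
  have "(\<lambda>k. w powr b * (w\<^sup>2) ^ k) sums (w powr b * (1 / (1 - w\<^sup>2)))"
    using assms by (intro sums_mult geometric_sums) (auto simp: power_less_one_iff abs_square_less_1)
  moreover have "w powr (2 * real k + b) = w powr b * (w\<^sup>2) ^ k" for k
  proof -
    have "w powr (2 * real k + b) = w powr b * w powr (real (2 * k))"
      by (simp add: powr_add mult.commute)
    also have "w powr (real (2 * k)) = (w\<^sup>2) ^ k" using assms by (subst powr_realpow) (auto simp: power_mult)
    finally show ?thesis .
  qed
  ultimately show ?thesis by simp
qed

text \<open>The slope difference is -2w/(1 - w^2) below the window [1 - e, 1 + e] and 2w/(w^2 - 1)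
  above it. These are geometric series in w^2 and in w^(-2), integrated term by term against w^(-a).
  Inside the window the reflected slope is cut off and only 1/(1 + w) survives.\<close>

lemma jump_int_series:
  assumes a: "1 < a" "a < 2" and e: "0 < e" "e < 1/2"
  shows "jump_int a 0 e True = (\<integral>w. indicator {1-e..1+e} w * (w powr (-a) / (1 + w)) \<partial>lborel)
    + (\<Sum>k. 2 * (1 + e) powr (- (2 * real k + a)) / (2 * real k + a) - 2 * (1 - e) powr (2 * real k + 2 - a) / (2 * real k + 2 - a))"
proof -
  \<comment> \<open>\<open>fA\<close> holds the powers below the window, \<open>fC\<close> those
    above it.\<close>
  define fA where "fA k w = indicator {0..1-e} w * w powr (2 * real k + 1 - a)" for k w
  define fC where "fC k w = indicator {1+e..} w * w powr (- 2 * real k - 1 - a)" for k w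
  define f where "f k w = 2 * fC k w - 2 * fA k w" for k w
  have A: "integrable lborel (fA k)" "(\<integral>w. fA k w \<partial>lborel) = (1 - e) powr (2 * real k + 2 - a) / (2 * real k + 2 - a)" for k
    unfolding fA_def using powr_lborel_0[of "2 * real k + 1 - a" "1 - e"] a e by (simp_all add: algebra_simps)
  have C: "integrable lborel (fC k)" "(\<integral>w. fC k w \<partial>lborel) = (1 + e) powr (- (2 * real k + a)) / (2 * real k + a)" for k
  proof -
    have *: "- 2 * real k - 1 - a + 1 = - (2 * real k + a)" by simp
    show "integrable lborel (fC k)" "(\<integral>w. fC k w \<partial>lborel) = (1 + e) powr (- (2 * real k + a)) / (2 * real k + a)"
      unfolding fC_def using powr_lborel_inf[of "- 2 * real k - 1 - a" "1 + e"] a e unfolding * by (auto simp only: minus_divide_divide)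
  qed
  have fi: "integrable lborel (f k)" for k unfolding f_def using A C by simp
  have fI: "(\<integral>w. f k w \<partial>lborel) = 2 * (1 + e) powr (- (2 * real k + a)) / (2 * real k + a) - 2 * (1 - e) powr (2 * real k + 2 - a) / (2 * real k + 2 - a)" for k
    unfolding f_def using A[of k] C[of k] by simp
  have sA: "(\<lambda>k. fA k w) sums (indicator {0<..1-e} w * (w powr (1 - a) / (1 - w\<^sup>2)))" for w
  proof (cases "0 < w \<and> w \<le> 1 - e")
    case True
    then show ?thesis using geometric_powr_sums[of w "1 - a"] e by (simp add: fA_def add_diff_eq)
  next
    case False
    then have "fA k w = 0" for k by (auto simp: fA_def indicator_def)
    moreover have "indicator {0<..1-e} w = (0::real)" using False by (auto simp: indicator_def)
    ultimately show ?thesis by simp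
  qed
  have sC: "(\<lambda>k. fC k w) sums (indicator {1+e..} w * (w powr (- 1 - a) / (1 - (1 / w)\<^sup>2)))" for w
  proof (cases "w \<ge> 1 + e")
    case True
    have inv: "(1 / w) powr b = w powr (- b)" for b
      using True e by (simp add: powr_divide powr_minus_divide)
    have "(1 / w) powr (2 * real k + (1 + a)) = w powr (- 2 * real k - 1 - a)" for k
      unfolding inv by (rule arg_cong[where f="\<lambda>z. w powr z"]) simp
    moreover have "(1 / w) powr (1 + a) = w powr (- 1 - a)"
      unfolding inv by (rule arg_cong[where f="\<lambda>z. w powr z"]) simp
    ultimately show ?thesis using geometric_powr_sums[of "1 / w" "1 + a"] True e by (simp add: fC_def)
  next
    case False
    then have "fC k w = 0" for k by (auto simp: fC_def indicator_def)
    then show ?thesis using False by (simp add: indicator_def)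
  qed
  have nA: "fA k w \<ge> 0" and nC: "fC k w \<ge> 0" for k w by (auto simp: fA_def fC_def)
  have sf: "(\<lambda>k. f k w) sums (2 * (indicator {1+e..} w * (w powr (- 1 - a) / (1 - (1 / w)\<^sup>2)))
       - 2 * (indicator {0<..1-e} w * (w powr (1 - a) / (1 - w\<^sup>2))))" for w
    unfolding f_def by (intro sums_diff sums_mult sA sC)
  \<comment> \<open>The positive e keeps the ratio of the comparison series at (1 - e)^2, away from
    1; above the window it is (1 + e)^(-2).\<close>
  have sumA: "summable (\<lambda>k. \<integral>w. fA k w \<partial>lborel)"
  proof (rule summable_comparison_test')
    show "summable (\<lambda>k. (1 - e) powr (2 * real k + (2 - a)) / (2 - a))"
      using geometric_powr_sums[of "1 - e" "2 - a"] e by (intro summable_divide) (auto simp: sums_iff)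
    show "norm (\<integral>w. fA k w \<partial>lborel) \<le> (1 - e) powr (2 * real k + (2 - a)) / (2 - a)" for k
      unfolding A(2) using a by (auto simp: add_diff_eq intro!: divide_left_mono)
  qed
  have sumC: "summable (\<lambda>k. \<integral>w. fC k w \<partial>lborel)"
  proof (rule summable_comparison_test')
    show "summable (\<lambda>k. (1 / (1 + e)) powr (2 * real k + a) / a)"
      using geometric_powr_sums[of "1 / (1 + e)" a] e by (intro summable_divide) (auto simp: sums_iff)
    show "norm (\<integral>w. fC k w \<partial>lborel) \<le> (1 / (1 + e)) powr (2 * real k + a) / a" for k
    proof -
      have "(1 / (1 + e)) powr (2 * real k + a) = (1 + e) powr (- (2 * real k + a))"
        using e by (simp add: powr_divide powr_minus_divide del: minus_add_distrib)
      then show ?thesis unfolding C(2) using a by (auto intro!: divide_left_mono)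
    qed
  qed
  have sums: "(\<lambda>k. \<integral>w. f k w \<partial>lborel) sums (\<integral>w. (\<Sum>k. f k w) \<partial>lborel)"
  proof (rule sums_integral[OF fi])
    have nf: "norm (f k w) \<le> 2 * fC k w + 2 * fA k w" for k w
      using nA[of k w] nC[of k w] by (simp add: f_def)
    show "AE w in lborel. summable (\<lambda>k. norm (f k w))"
    proof (rule AE_I2)
      fix w
      have "summable (\<lambda>k. 2 * fC k w + 2 * fA k w)"
        using sA[of w] sC[of w] by (intro summable_add summable_mult) (auto simp: sums_iff)
      then show "summable (\<lambda>k. norm (f k w))"
        by (rule summable_comparison_test') (use nf in auto)
    qed
    have "summable (\<lambda>k. 2 * (\<integral>w. fC k w \<partial>lborel) + 2 * (\<integral>w. fA k w \<partial>lborel))"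
      by (intro summable_add summable_mult sumA sumC)
    then show "summable (\<lambda>k. \<integral>w. norm (f k w) \<partial>lborel)"
    proof (rule summable_comparison_test')
      fix k
      have "(\<integral>w. norm (f k w) \<partial>lborel) \<le> (\<integral>w. 2 * fC k w + 2 * fA k w \<partial>lborel)"
        using A C fi nf by (intro integral_mono) auto
      then show "norm (\<integral>w. norm (f k w) \<partial>lborel) \<le> 2 * (\<integral>w. fC k w \<partial>lborel) + 2 * (\<integral>w. fA k w \<partial>lborel)"
        using A(1)[of k] C(1)[of k] by simp
    qed
  qed
  define mid where "mid w = indicator {1-e..1+e} w * (w powr (-a) / (1 + w))" for w :: real
  define S where "S w = (\<Sum>k. f k w)" for w
  have midi: "integrable lborel mid"
    unfolding mid_def
  proof (rule Bochner_Integration.integrable_bound)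
    show "integrable lborel (\<lambda>x::real. indicator {1-e..} x * x powr (-a))"
      by (rule powr_lborel_inf) (use a e in auto)
    show "AE w in lborel. norm (indicator {1-e..1+e} w * (w powr (-a) / (1 + w))) \<le> norm (indicator {1-e..} w * w powr (-a))"
    proof (rule AE_I2)
      fix w :: real
      have "w powr (-a) / (1 + w) \<le> w powr (-a) / 1" if "w \<ge> 1 - e"
        using that e by (intro divide_left_mono) auto
      then show "norm (indicator {1-e..1+e} w * (w powr (-a) / (1 + w))) \<le> norm (indicator {1-e..} w * w powr (-a))"
        using e by (auto simp: indicator_def)
    qed
  qed measurable
  have pw: "AE w in lborel. indicator {0<..} w * ((bcut_slope 0 e True w - bcut_slope 0 e True (-w)) * w powr (-a)) - mid w = S w"
    using AE_lborel_singleton[of "1 - e"] AE_lborel_singleton[of "1 + e"]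
  proof eventually_elim
    case (elim w)
    have Sw: "S w = 2 * (indicator {1+e..} w * (w powr (- 1 - a) / (1 - (1 / w)\<^sup>2)))
       - 2 * (indicator {0<..1-e} w * (w powr (1 - a) / (1 - w\<^sup>2)))"
      unfolding S_def using sf[of w] by (simp add: sums_iff)
    consider "w \<le> 0" | "0 < w" "w < 1 - e" | "1 - e < w" "w < 1 + e" | "1 + e < w" using elim by linarith
    then show ?case
    proof cases
      case 1 then show ?thesis using e by (simp add: Sw mid_def)
    next
      case 2
      have g: "bcut_slope 0 e True w - bcut_slope 0 e True (-w) = 1 / (1 + w) - 1 / (1 - w)"
        using 2 e by (simp add: bcut_slope_def powr_minus_divide)
      have "w powr (1 - a) = w * w powr (-a)" using 2 by (simp add: powr_diff powr_minus_divide)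
      moreover have "1 / (1 + w) - 1 / (1 - w) = - 2 * w / (1 - w\<^sup>2)"
      proof -
        have "1 - w\<^sup>2 = (1 + w) * (1 - w)" by (simp add: power2_eq_square algebra_simps)
        moreover have "1 + w \<noteq> 0" "1 - w \<noteq> 0" using 2 e by auto
        ultimately show ?thesis by (simp add: field_simps)
      qed
      ultimately show ?thesis using 2 e by (simp add: Sw mid_def g)
    next
      case 3
      have g: "bcut_slope 0 e True w - bcut_slope 0 e True (-w) = 1 / (1 + w)"
        using 3 e by (simp add: bcut_slope_def powr_minus_divide)
      then show ?thesis using 3 e by (simp add: Sw mid_def)
    next
      case 4
      have g: "bcut_slope 0 e True w - bcut_slope 0 e True (-w) = 1 / (1 + w) + 1 / (w - 1)"
        using 4 e by (simp add: bcut_slope_def powr_minus_divide)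
      have "w powr (- 1 - a) = w powr (-a) / w" using 4 e by (simp add: powr_diff powr_minus_divide)
      moreover have "1 / (1 + w) + 1 / (w - 1) = 2 / w / (1 - (1 / w)\<^sup>2)"
      proof -
        have n: "1 + w \<noteq> 0" "w - 1 \<noteq> 0" "w \<noteq> 0" using 4 e by auto
        have "w * (1 - (1 / w)\<^sup>2) = (w + 1) * (w - 1) / w"
          using n by (simp add: power2_eq_square field_simps)
        then have "2 / w / (1 - (1 / w)\<^sup>2) = 2 * w / ((w + 1) * (w - 1))"
          using n by (simp add: divide_divide_eq_left)
        also have "\<dots> = 1 / (1 + w) + 1 / (w - 1)" using n by (simp add: divide_simps)
        finally show ?thesis by simp
      qed
      ultimately show ?thesis using 4 e by (simp add: Sw mid_def g)
    qed
  qed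
  note Ji = jump_int_integrable[OF a e, of 0 True]
  have "jump_int a 0 e True - (\<integral>w. mid w \<partial>lborel)
     = (\<integral>w. indicator {0<..} w * ((bcut_slope 0 e True w - bcut_slope 0 e True (-w)) * w powr (-a)) - mid w \<partial>lborel)"
    unfolding jump_int_def by (rule Bochner_Integration.integral_diff[symmetric]) (use Ji midi in auto)
  also have "\<dots> = (\<integral>w. S w \<partial>lborel)"
  proof (rule integral_cong_AE[OF _ _ pw])
    have [measurable]: "f k \<in> borel_measurable borel" for k unfolding f_def fA_def fC_def by measurable
    show "S \<in> borel_measurable lborel" unfolding S_def by measurable
    have [measurable]: "mid \<in> borel_measurable borel" unfolding mid_def by measurable
    show "(\<lambda>w. indicator {0<..} w * ((bcut_slope 0 e True w - bcut_slope 0 e True (- w)) * w powr - a) - mid w) \<in> borel_measurable lborel"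
      by measurable
  qed
  also have "\<dots> = (\<Sum>k. \<integral>w. f k w \<partial>lborel)" using sums unfolding S_def by (simp add: sums_iff)
  finally show ?thesis unfolding fI mid_def by simp
qed

text \<open>The window contributes at most its length times a constant. The series converges by
  Tannery's theorem, for which a summable bound uniform in e is required: either part of the k-th
  term alone is only of order 1/k, so their difference has to be estimated.\<close>

lemma jump_int_tendsto_pi_cot:
  assumes a: "1 < a" "a < 2"
  shows "((\<lambda>e. jump_int a 0 e True) \<longlongrightarrow> pi * cot (pi * a / 2)) (at_right 0)"
proof -
  define mid where "mid e = (\<integral>w. indicator {1-e..1+e} w * (w powr (-a) / (1 + w)) \<partial>lborel)" for e :: real
  define b where "b k e = 2 * (1 + e) powr (- (2 * real k + a)) / (2 * real k + a) - 2 * (1 - e) powr (2 * real k + 2 - a) / (2 * real k + 2 - a)" for k and e :: real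
  have ev: "eventually (\<lambda>e. 0 < e \<and> e < 1/2) (at_right (0::real))"
    by (auto simp: eventually_at_right_field intro!: exI[of _ "1/2"])
  have "(mid \<longlongrightarrow> 0) (at_right 0)"
  proof (rule tendsto_sandwich[where f="\<lambda>_. 0" and h="\<lambda>e. 2 * e * (1/2) powr (-a)"])
    show "eventually (\<lambda>e. mid e \<ge> 0) (at_right 0)"
      using ev by eventually_elim
        (auto intro!: Bochner_Integration.integral_nonneg simp: mid_def indicator_def)
    show "eventually (\<lambda>e. mid e \<le> 2 * e * (1/2) powr (-a)) (at_right 0)"
      using ev
    proof eventually_elim
      case (elim e)
      have "mid e \<le> (\<integral>w. indicator {1-e..1+e} w *\<^sub>R (1/2) powr (-a) \<partial>lborel)"
        unfolding mid_def
      proof (rule integral_mono_AE')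
        show "integrable lborel (\<lambda>w. indicator {1-e..1+e} w *\<^sub>R (1/2::real) powr (-a))"
          by (intro integrable_scaleR_left integrable_real_indicator) (use elim in auto)
        show "AE w in lborel. indicator {1-e..1+e} w * (w powr (-a) / (1 + w)) \<le> indicator {1-e..1+e} w *\<^sub>R (1/2) powr (-a)"
        proof (rule AE_I2)
          fix w :: real
          have "w powr (-a) / (1 + w) \<le> (1/2) powr (-a)" if "w \<ge> 1 - e"
          proof -
            have "w powr (-a) / (1 + w) \<le> w powr (-a) / 1" using that elim by (intro divide_left_mono) auto
            also have "\<dots> \<le> (1/2) powr (-a)" using that elim a by (simp, intro powr_mono2') auto
            finally show ?thesis .
          qed
          then show "indicator {1-e..1+e} w * (w powr (-a) / (1 + w)) \<le> indicator {1-e..1+e} w *\<^sub>R (1/2) powr (-a)"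
            by (auto simp: indicator_def)
        qed
        show "AE w in lborel. 0 \<le> indicator {1-e..1+e} w *\<^sub>R (1/2::real) powr (-a)" by (rule AE_I2) auto
      qed
      also have "\<dots> = 2 * e * (1/2) powr (-a)" using elim by simp
      finally show ?case .
    qed
    show "((\<lambda>e. 2 * e * (1/2) powr (-a)) \<longlongrightarrow> 0) (at_right (0::real))"
      by (auto intro!: tendsto_eq_intros)
  qed auto
  moreover have "((\<lambda>e. \<Sum>k. b k e) \<longlongrightarrow> (\<Sum>k. 2 / (2 * real k + a) - 2 / (2 * real k + 2 - a))) (at_right 0)"
  proof -
    have lim: "((\<lambda>e. b k e) \<longlongrightarrow> 2 / (2 * real k + a) - 2 / (2 * real k + 2 - a)) (at_right 0)" for k
    proof -
      have "2 * real k + a \<noteq> 0" "2 * real k + 2 - a \<noteq> 0" using a by auto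
      moreover have "((\<lambda>e::real. (1 + e) powr (- (2 * real k + a))) \<longlongrightarrow> (1 + 0) powr (- (2 * real k + a))) (at_right 0)"
        by (intro tendsto_powr tendsto_intros) auto
      moreover have "((\<lambda>e::real. (1 - e) powr (2 * real k + 2 - a)) \<longlongrightarrow> (1 - 0) powr (2 * real k + 2 - a)) (at_right 0)"
        by (intro tendsto_powr tendsto_intros) auto
      ultimately have "((\<lambda>e. b k e) \<longlongrightarrow> 2 * (1 + 0) powr (- (2 * real k + a)) / (2 * real k + a) - 2 * (1 - 0) powr (2 * real k + 2 - a) / (2 * real k + 2 - a)) (at_right 0)"
        unfolding b_def by (intro tendsto_diff tendsto_divide tendsto_mult tendsto_const)
      then show ?thesis by simp
    qed
    \<comment> \<open>The difference is split at q^A / A: \<open>t1\<close> changes the base from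
      1/(1 + e) to 1 - e, and \<open>t2\<close> changes the exponent from A to B.\<close>
    have bound: "norm (b k e) \<le> 4 * (1 / (real k)\<^sup>2)" if k: "k \<ge> 1" and e: "0 < e \<and> e < 1/2" for k e
    proof -
      define A where "A = 2 * real k + a"
      define B where "B = 2 * real k + 2 - a"
      define \<rho> where "\<rho> = 1 / (1 + e)"
      define q where "q = 1 - e"
      have A: "A \<ge> 2 * real k + 1" and B: "B \<ge> 2 * real k" using a by (auto simp: A_def B_def)
      have q: "0 < q" "q < 1" using e by (auto simp: q_def)
      have \<rho>q: "q < \<rho>" "\<rho> - q \<le> e\<^sup>2" "0 < \<rho>" "\<rho> < 1"
        using e by (auto simp: q_def \<rho>_def field_simps power2_eq_square)
      \<comment> \<open>The bases differ by at most e^2, and Bernoulli's inequality gives (1 + e)^k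
        \<ge> k e, which turns e^2 / (1 + e)^(2k) into 1 / k^2.\<close>
      have t1: "\<bar>\<rho> powr A / A - q powr A / A\<bar> \<le> 1 / (real k)\<^sup>2"
      proof -
        have "\<exists>z. q < z \<and> z < \<rho> \<and> \<rho> powr A - q powr A = (\<rho> - q) * (A * z powr (A - 1))"
          by (rule MVT2) (use \<rho>q q in \<open>auto intro!: derivative_eq_intros\<close>)
        then obtain z where z: "q < z" "z < \<rho>" "\<rho> powr A - q powr A = (\<rho> - q) * (A * z powr (A - 1))" by blast
        have "z powr (A - 1) \<le> \<rho> powr (A - 1)" using z q A by (intro powr_mono2) auto
        also have "\<dots> \<le> \<rho> powr (2 * real k)" using \<rho>q A by (intro powr_mono') auto
        also have "\<dots> = 1 / ((1 + e) ^ k)\<^sup>2"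
        proof -
          have "\<rho> powr (real (2 * k)) = \<rho> ^ (2 * k)" using \<rho>q by (subst powr_realpow) auto
          then show ?thesis by (simp add: \<rho>_def power_divide power_mult mult.commute)
        qed
        finally have zb: "z powr (A - 1) \<le> 1 / ((1 + e) ^ k)\<^sup>2" .
        have "1 + real k * e \<le> (1 + e) ^ k" using e by (intro Bernoulli_inequality) auto
        then have "real k * e \<le> (1 + e) ^ k" by simp
        then have "(real k * e)\<^sup>2 \<le> ((1 + e) ^ k)\<^sup>2" using e by (intro power_mono) auto
        then have ek: "e\<^sup>2 * (1 / ((1 + e) ^ k)\<^sup>2) \<le> 1 / (real k)\<^sup>2"
          using k e by (simp add: field_simps power_mult_distrib)
        have "\<bar>\<rho> powr A / A - q powr A / A\<bar> = (\<rho> - q) * z powr (A - 1)"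
        proof -
          have "\<rho> powr A / A - q powr A / A = (\<rho> powr A - q powr A) / A" by (simp add: diff_divide_distrib)
          also have "\<dots> = (\<rho> - q) * z powr (A - 1)" unfolding z(3) using A by simp
          finally show ?thesis using \<rho>q by simp
        qed
        also have "\<dots> \<le> e\<^sup>2 * (1 / ((1 + e) ^ k)\<^sup>2)" using zb \<rho>q by (intro mult_mono) auto
        finally show ?thesis using ek by linarith
      qed
      \<comment> \<open>The derivative of q^s / s is at most 1 / s^2 in modulus, uniformly in q,
        because exp(-y) (1 + y) \<le> 1 for y = - s ln q. The exponents differ by 2a - 2, which is
        less than 2.\<close>
      have t2: "\<bar>q powr A / A - q powr B / B\<bar> \<le> 1 / (real k)\<^sup>2"
      proof -
        define h where "h s = q powr s / s" for s
        define h' where "h' s = q powr s * (s * ln q - 1) / s\<^sup>2" for s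
        have "norm (h A - h B) \<le> (1 / (2 * real k)\<^sup>2) * norm (A - B)"
        proof (rule field_differentiable_bound[where S="{2 * real k..}" and f'=h'])
          show "(h has_field_derivative h' z) (at z within {2 * real k..})" if "z \<in> {2 * real k..}" for z
          proof -
            have "h = (\<lambda>s. exp (s * ln q) / s)" using q by (auto simp: h_def powr_def fun_eq_iff)
            moreover have "((\<lambda>s. exp (s * ln q) / s) has_field_derivative h' z) (at z within {2 * real k..})"
              unfolding h'_def using that k q
              by (auto intro!: derivative_eq_intros simp: powr_def field_simps power2_eq_square)
            ultimately show ?thesis by simp
          qed
          show "norm (h' z) \<le> 1 / (2 * real k)\<^sup>2" if z: "z \<in> {2 * real k..}" for z
          proof -
            have z0: "z > 0" using z k by auto
            define y where "y = - z * ln q"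
            have y: "y \<ge> 0" using z0 q by (simp add: y_def mult_nonneg_nonpos)
            have qz: "q powr z = exp (- y)" using q by (simp add: powr_def y_def)
            have "\<bar>h' z\<bar> = exp (- y) * (1 + y) / z\<^sup>2"
            proof -
              have "z * ln q - 1 = - (1 + y)" by (simp add: y_def)
              then show ?thesis unfolding h'_def qz using y by (simp add: abs_mult)
            qed
            also have "\<dots> \<le> 1 / z\<^sup>2"
            proof -
              have "exp (- y) * (1 + y) \<le> exp (- y) * exp y" by (intro mult_left_mono exp_ge_add_one_self) auto
              also have "\<dots> = 1" by (simp flip: exp_add)
              finally show ?thesis by (intro divide_right_mono) auto
            qed
            also have "\<dots> \<le> 1 / (2 * real k)\<^sup>2"
              using z k by (intro divide_left_mono power_mono) auto
            finally show ?thesis by simp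
          qed
        qed (use A B in auto)
        also have "\<dots> \<le> (1 / (2 * real k)\<^sup>2) * 2"
          using a by (intro mult_left_mono) (auto simp: A_def B_def)
        also have "\<dots> \<le> 1 / (real k)\<^sup>2" using k by (simp add: power_mult_distrib field_simps)
        finally show ?thesis by (simp add: h_def)
      qed
      have "(1 + e) powr (- A) = \<rho> powr A"
        using e by (simp add: \<rho>_def powr_divide powr_minus_divide)
      then have "b k e = 2 * (\<rho> powr A / A - q powr A / A) + 2 * (q powr A / A - q powr B / B)"
        by (simp add: b_def A_def B_def q_def)
      then show ?thesis using t1 t2 by simp
    qed
    have "eventually (\<lambda>(k, e). norm (b k e) \<le> 4 * (1 / (real k)\<^sup>2)) (at_top \<times>\<^sub>F at_right 0)"
      using eventually_prodI[OF eventually_ge_at_top[of "1::nat"] ev]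
      by eventually_elim (use bound in auto)
    moreover have "summable (\<lambda>k. 4 * (1 / (real k)\<^sup>2))"
      using inverse_power_summable[of 2, where 'a=real] by (intro summable_mult) (simp add: inverse_eq_divide)
    ultimately show ?thesis using tannerys_theorem[OF lim] by simp
  qed
  ultimately have "((\<lambda>e. mid e + (\<Sum>k. b k e)) \<longlongrightarrow> 0 + (\<Sum>k. 2 / (2 * real k + a) - 2 / (2 * real k + 2 - a))) (at_right 0)"
    by (intro tendsto_add)
  moreover have "(\<Sum>k. 2 / (2 * real k + a) - 2 / (2 * real k + 2 - a)) = pi * cot (pi * a / 2)"
  proof -
    have "(\<Sum>k. 2 / (2 * real k + a) - 2 / (2 * real k + 2 - a)) = (\<Sum>k. 1 / (real k + a / 2) - 1 / (real k + 1 - a / 2))"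
      by (intro suminf_cong) (use a in \<open>simp add: field_simps\<close>)
    then show ?thesis using pi_cot_sums[of "a / 2"] a by simp
  qed
  moreover have "eventually (\<lambda>e. mid e + (\<Sum>k. b k e) = jump_int a 0 e True) (at_right 0)"
    using ev by eventually_elim (simp add: jump_int_series[OF a] mid_def b_def)
  ultimately show ?thesis by (auto intro: Lim_transform_eventually)
qed

subsection \<open>One-step asymptotics of the chain\<close>

lemma powr_neg_tendsto_0:
  assumes "filterlim (r :: nat \<Rightarrow> real) at_top sequentially" "s > 0"
  shows "(\<lambda>n. r n powr (-s)) \<longlonglongrightarrow> 0"
  using tendsto_neg_powr[OF _ assms(1), of "-s"] assms(2) by simp

lemma tendsto_0_eventually_bound:
  assumes "s > 0" "k > 0"
  shows "\<exists>R>0. \<forall>r\<ge>R. C * r powr (-s) \<le> (k::real)"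
proof -
  have "((\<lambda>r::real. C * r powr (-s)) \<longlongrightarrow> C * 0) at_top"
    by (intro tendsto_mult tendsto_const tendsto_neg_powr filterlim_ident) (use assms in auto)
  then have "eventually (\<lambda>r. C * r powr (-s) < k) at_top"
    using assms by (intro order_tendstoD(2)[of _ 0]) auto
  then obtain R where "\<And>r. r \<ge> R \<Longrightarrow> C * r powr (-s) < k" by (auto simp: eventually_at_top_linorder)
  then show ?thesis by (intro exI[of _ "max R 1"]) (auto intro: less_imp_le)
qed

locale balanced_chain = chain X K M \<xi>
  for X :: "real set" and K :: "real \<Rightarrow> real measure"
    and M :: "real \<Rightarrow> 'a measure" and \<xi> :: "nat \<Rightarrow> 'a \<Rightarrow> real" +
  fixes \<alpha> c :: real
  assumes T: "cond_Tbal X K \<alpha> c"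
begin

lemma alpha: "1 < \<alpha>" "\<alpha> < 2" and c_pos: "c > 0"
  using T unfolding cond_Tbal_def by auto

text \<open>The sign orients the step so that positive values lead away from the origin. The tail
  condition is symmetric under this flip and the drift condition has it built in, so both half-lines
  are treated at once.\<close>

definition law :: "real \<Rightarrow> real measure" where
  "law x = distr (Q x) borel (\<lambda>z. sgn x * (z - x))"

lemma sets_law [simp, measurable_cong]: "sets (law x) = sets borel"
  by (simp add: law_def)

lemma prob_law: "prob_space (law x)"
  unfolding law_def by (rule prob_space.prob_space_distr[OF prob_Q]) simp

lemma law_tail:
  assumes "x \<in> X" "x \<noteq> 0" "y \<ge> 0"
  shows "measure (law x) {y<..} = (if x > 0 then tail_plus K x y else tail_minus K x y)"
    "measure (law x) {..<-y} = (if x > 0 then tail_minus K x y else tail_plus K x y)"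
proof -
  have QK: "Q x = K x" using Q_eq assms by simp
  have m: "measure (law x) S = measure (Q x) {z. sgn x * (z - x) \<in> S}" if "S \<in> sets borel" for S
    using that unfolding law_def by (subst measure_distr) (auto simp: vimage_def)
  show "measure (law x) {y<..} = (if x > 0 then tail_plus K x y else tail_minus K x y)"
    "measure (law x) {..<-y} = (if x > 0 then tail_minus K x y else tail_plus K x y)"
    using assms unfolding m[OF borel_open[OF open_greaterThan]] m[OF borel_open[OF open_lessThan]] QK
    by (auto simp: tail_plus_def tail_minus_def pos_part_r_def neg_part_r_def sgn_if intro!: arg_cong[where f="measure (K x)"])
qed

lemma mean_law:
  assumes "x \<in> X"
  shows "(\<integral>t. t \<partial>law x) = sgn x * drift K x"
proof -
  have "(\<integral>t. t \<partial>law x) = (\<integral>z. sgn x * (z - x) \<partial>Q x)"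
    unfolding law_def by (subst integral_distr) auto
  then show ?thesis using Q_eq[OF assms] by (simp add: drift_def)
qed

lemma law_nn_integral:
  assumes "x \<noteq> 0" and [measurable]: "f \<in> borel_measurable borel"
  shows "(\<integral>\<^sup>+z. f (sgn x * z) \<partial>Q x) = (\<integral>\<^sup>+t. f (\<bar>x\<bar> + t) \<partial>law x)"
proof -
  have "\<bar>x\<bar> + sgn x * (z - x) = sgn x * z" for z
    using assms by (cases "x > 0") (auto simp: sgn_if)
  then show ?thesis unfolding law_def by (subst nn_integral_distr) auto
qed

text \<open>Passes from Bochner integrals, in which the asymptotics are computed, to the nonnegative
  integrals of the Lyapunov inequalities; g is an integrable majorant such as a rescaled
  \<open>bcut\<close>.\<close>

lemma one_step_bound:
  fixes f g :: "real \<Rightarrow> real"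
  assumes x: "x \<noteq> 0" and [measurable]: "f \<in> borel_measurable borel"
    and f: "\<And>t. 0 \<le> f (\<bar>x\<bar> + t)" "\<And>t. f (\<bar>x\<bar> + t) \<le> g t"
    and g: "integrable (law x) g" "(\<integral>t. g t \<partial>law x) \<le> B"
  shows "(\<integral>\<^sup>+z. ennreal (f (sgn x * z)) \<partial>Q x) \<le> ennreal B"
proof -
  have "(\<integral>\<^sup>+z. ennreal (f (sgn x * z)) \<partial>Q x) = (\<integral>\<^sup>+t. ennreal (f (\<bar>x\<bar> + t)) \<partial>law x)"
    using law_nn_integral[OF x, of "\<lambda>z. ennreal (f z)"] by simp
  also have "\<dots> \<le> (\<integral>\<^sup>+t. ennreal (g t) \<partial>law x)"
    by (intro nn_integral_mono ennreal_leI f)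
  also have "\<dots> = ennreal (\<integral>t. g t \<partial>law x)"
    by (rule nn_integral_eq_integral[OF g(1)]) (use f in \<open>auto intro: order_trans\<close>)
  also have "\<dots> \<le> ennreal B" by (rule ennreal_leI[OF g(2)])
  finally show ?thesis .
qed

definition tails_from :: "real \<Rightarrow> real \<Rightarrow> bool" where
  "tails_from R C \<longleftrightarrow> 1 \<le> R \<and> 0 < C \<and>
    (\<forall>x\<in>X. R \<le> \<bar>x\<bar> \<longrightarrow> (\<forall>y>0. measure (law x) {y<..} \<le> C * y powr (-\<alpha>)
      \<and> measure (law x) {..<-y} \<le> C * y powr (-\<alpha>))) \<and>
    (\<forall>e>0. \<exists>Y. \<forall>y\<ge>Y. \<forall>x\<in>X. R \<le> \<bar>x\<bar> \<longrightarrow> \<bar>y powr \<alpha> * measure (law x) {y<..} - c\<bar> \<le> e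
      \<and> \<bar>y powr \<alpha> * measure (law x) {..<-y} - c\<bar> \<le> e)"

lemma ex_tails_from: "\<exists>R C. tails_from R C"
proof -
  from T obtain x0 where x0: "x0 \<ge> 0" and T': "\<And>e. e > 0 \<Longrightarrow> \<exists>Y. \<forall>y\<ge>Y. tail_dev_bound X K \<alpha> c x0 y e"
    unfolding cond_Tbal_def by blast
  define R0 where "R0 = max x0 1"
  have dev: "\<exists>Y. \<forall>y\<ge>Y. \<forall>x\<in>X. R0 \<le> \<bar>x\<bar> \<longrightarrow> \<bar>y powr \<alpha> * measure (law x) {y<..} - c\<bar> \<le> e \<and> \<bar>y powr \<alpha> * measure (law x) {..<-y} - c\<bar> \<le> e"
    if e: "e > 0" for e
  proof -
    obtain Y where Y: "\<And>y. y \<ge> Y \<Longrightarrow> tail_dev_bound X K \<alpha> c x0 y e" using T'[OF e] by blast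
    have "\<bar>y powr \<alpha> * measure (law x) {y<..} - c\<bar> \<le> e \<and> \<bar>y powr \<alpha> * measure (law x) {..<-y} - c\<bar> \<le> e"
      if y: "y \<ge> max Y 0" and x: "x \<in> X" "R0 \<le> \<bar>x\<bar>" for x y
    proof -
      have "x \<noteq> 0" "y \<ge> 0" using x y by (auto simp: R0_def)
      have "x > 0 \<Longrightarrow> x \<ge> x0" "x < 0 \<Longrightarrow> x \<le> - x0" using x by (auto simp: R0_def)
      then show ?thesis using Y[of y] y x(1) \<open>x \<noteq> 0\<close> law_tail[OF x(1) \<open>x \<noteq> 0\<close> \<open>y \<ge> 0\<close>]
        unfolding tail_dev_bound_def by (cases "x > 0") auto
    qed
    then show ?thesis by blast
  qed
  obtain Y where Y: "\<And>y x. y \<ge> Y \<Longrightarrow> x \<in> X \<Longrightarrow> R0 \<le> \<bar>x\<bar> \<Longrightarrow> \<bar>y powr \<alpha> * measure (law x) {y<..} - c\<bar> \<le> 1 \<and> \<bar>y powr \<alpha> * measure (law x) {..<-y} - c\<bar> \<le> 1"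
    using dev[of 1] by auto
  \<comment> \<open>The part c + 1 serves y \<ge> Y, where the deviation is at most 1; for y < Y a
    probability is at most 1, which is below (max Y 1)^\<alpha> y^(-\<alpha>).\<close>
  define C0 where "C0 = c + 1 + (max Y 1) powr \<alpha>"
  have C0: "C0 > 0" using c_pos by (simp add: C0_def add_pos_nonneg)
  have bound: "p \<le> C0 * y powr (-\<alpha>)" if y: "y > 0" and p: "p \<le> 1" and Yp: "y \<ge> Y \<Longrightarrow> \<bar>y powr \<alpha> * p - c\<bar> \<le> 1" for p y
  proof (cases "y \<ge> Y")
    case True
    then have "y powr \<alpha> * p \<le> c + 1" using Yp by auto
    also have "\<dots> \<le> C0" by (simp add: C0_def)
    finally show ?thesis using y by (simp add: powr_minus field_simps)
  next
    case False
    then have "y powr \<alpha> \<le> (max Y 1) powr \<alpha>" using y alpha by (intro powr_mono2) auto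
    also have "\<dots> \<le> C0" using c_pos by (simp add: C0_def)
    finally have "1 \<le> C0 * y powr (-\<alpha>)" using y by (simp add: powr_minus field_simps)
    then show ?thesis using p by linarith
  qed
  have "measure (law x) {y<..} \<le> C0 * y powr (-\<alpha>) \<and> measure (law x) {..<-y} \<le> C0 * y powr (-\<alpha>)"
    if "x \<in> X" "R0 \<le> \<bar>x\<bar>" "y > 0" for x y
    using Y[of y x] that prob_space.prob_le_1[OF prob_law] by (intro conjI bound) auto
  moreover have "R0 \<ge> 1" by (simp add: R0_def)
  ultimately show ?thesis unfolding tails_from_def using dev C0 by (intro exI[of _ R0] exI[of _ C0]) auto
qed

definition R0 :: real where "R0 = (SOME R. \<exists>C. tails_from R C)"

definition C0 :: real where "C0 = (SOME C. tails_from R0 C)"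

lemma tails_from_R0: "tails_from R0 C0"
  using someI_ex[OF someI_ex[OF ex_tails_from]] unfolding C0_def R0_def .

lemma R0_ge_1: "1 \<le> R0"
  using tails_from_R0 unfolding tails_from_def by blast

lemma law_tail_limit:
  "e > 0 \<Longrightarrow> \<exists>Y. \<forall>y\<ge>Y. \<forall>x\<in>X. R0 \<le> \<bar>x\<bar> \<longrightarrow> \<bar>y powr \<alpha> * measure (law x) {y<..} - c\<bar> \<le> e
    \<and> \<bar>y powr \<alpha> * measure (law x) {..<-y} - c\<bar> \<le> e"
  using tails_from_R0 unfolding tails_from_def by blast

lemma C0_props:
  "C0 > 0"
  "\<And>x y. x \<in> X \<Longrightarrow> R0 \<le> \<bar>x\<bar> \<Longrightarrow> y > 0 \<Longrightarrow> measure (law x) {y<..} \<le> C0 * y powr (-\<alpha>)"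
  "\<And>x y. x \<in> X \<Longrightarrow> R0 \<le> \<bar>x\<bar> \<Longrightarrow> y > 0 \<Longrightarrow> measure (law x) {..<-y} \<le> C0 * y powr (-\<alpha>)"
  using tails_from_R0 unfolding tails_from_def by blast+

text \<open>Asymptotic one-step estimates are proved along arbitrary sequences of starting points;
  the sign of the points may vary along the sequence.\<close>

lemma uniform_from_sequences:
  assumes "\<And>xs. (\<And>n. xs n \<in> X) \<Longrightarrow> (\<And>n. R0 \<le> \<bar>xs n\<bar>) \<Longrightarrow> filterlim (\<lambda>n. \<bar>xs n\<bar>) at_top sequentially \<Longrightarrow> \<exists>n::nat. \<Phi> (xs n)"
  shows "\<exists>R\<ge>R0. \<forall>x\<in>X. R \<le> \<bar>x\<bar> \<longrightarrow> \<Phi> x"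
proof (rule ccontr)
  assume neg: "\<not> ?thesis"
  have "\<exists>x. x \<in> X \<and> max R0 (real n) \<le> \<bar>x\<bar> \<and> \<not> \<Phi> x" for n
    using neg by (metis max.cobounded1)
  then obtain xs where xs: "\<And>n. xs n \<in> X \<and> max R0 (real n) \<le> \<bar>xs n\<bar> \<and> \<not> \<Phi> (xs n)" by metis
  have "filterlim (\<lambda>n. \<bar>xs n\<bar>) at_top sequentially"
    by (rule filterlim_at_top_mono[OF filterlim_real_sequentially]) (use xs in auto)
  then show False using assms[of xs] xs by auto
qed

lemma balanced_sequence:
  assumes xs: "\<And>n. xs n \<in> X" "\<And>n. R0 \<le> \<bar>xs n\<bar>" "filterlim (\<lambda>n. \<bar>xs n\<bar>) at_top sequentially"
  shows "balanced_tails \<alpha> c C0 (\<lambda>n. law (xs n)) (\<lambda>n. \<bar>xs n\<bar>)"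
proof -
  have pos: "\<bar>xs n\<bar> > 0" for n using xs(2)[of n] R0_ge_1 by linarith
  \<comment> \<open>\<open>h\<close> stands for either tail. For fixed w the level |xs n| w tends to
    infinity, so the uniform asymptotics apply there; the factor w^(-\<alpha>) only
    rescales.\<close>
  have lim: "(\<lambda>n. \<bar>xs n\<bar> powr \<alpha> * h n (\<bar>xs n\<bar> * w)) \<longlonglongrightarrow> c * w powr (-\<alpha>)"
    if w: "w > 0" and h: "\<And>e. e > 0 \<Longrightarrow> \<exists>Y. \<forall>y\<ge>Y. \<forall>n. \<bar>y powr \<alpha> * h n y - c\<bar> \<le> e" for w h
  proof -
    have "(\<lambda>n. (\<bar>xs n\<bar> * w) powr \<alpha> * h n (\<bar>xs n\<bar> * w)) \<longlonglongrightarrow> c"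
    proof (rule LIMSEQ_I)
      fix e :: real assume "e > 0"
      then obtain Y where Y: "\<And>y n. y \<ge> Y \<Longrightarrow> \<bar>y powr \<alpha> * h n y - c\<bar> \<le> e / 2" using h[of "e / 2"] by auto
      have "eventually (\<lambda>n. \<bar>xs n\<bar> \<ge> Y / w) sequentially" using xs(3) by (auto simp: filterlim_at_top)
      then obtain N where "\<And>n. n \<ge> N \<Longrightarrow> \<bar>xs n\<bar> \<ge> Y / w" by (auto simp: eventually_sequentially)
      then have "\<bar>(\<bar>xs n\<bar> * w) powr \<alpha> * h n (\<bar>xs n\<bar> * w) - c\<bar> \<le> e / 2" if "n \<ge> N" for n
        using that w by (intro Y) (auto simp: pos_divide_le_eq)
      then show "\<exists>no. \<forall>n\<ge>no. norm ((\<bar>xs n\<bar> * w) powr \<alpha> * h n (\<bar>xs n\<bar> * w) - c) < e"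
        using \<open>e > 0\<close> by (intro exI[of _ N]) (force simp: field_simps)
    qed
    then have "(\<lambda>n. w powr (-\<alpha>) * ((\<bar>xs n\<bar> * w) powr \<alpha> * h n (\<bar>xs n\<bar> * w))) \<longlonglongrightarrow> w powr (-\<alpha>) * c"
      by (intro tendsto_intros)
    moreover have "w powr (-\<alpha>) * ((\<bar>xs n\<bar> * w) powr \<alpha> * h n (\<bar>xs n\<bar> * w)) = \<bar>xs n\<bar> powr \<alpha> * h n (\<bar>xs n\<bar> * w)" for n
    proof -
      have "w powr (-\<alpha>) * w powr \<alpha> = 1" using w by (simp add: powr_minus)
      moreover have "(\<bar>xs n\<bar> * w) powr \<alpha> = \<bar>xs n\<bar> powr \<alpha> * w powr \<alpha>" using w by (simp add: powr_mult)
      ultimately show ?thesis by (simp add: algebra_simps)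
    qed
    ultimately show ?thesis unfolding mult.commute[of c] by (simp only:)
  qed
  have tails: "(\<lambda>n. \<bar>xs n\<bar> powr \<alpha> * measure (law (xs n)) {\<bar>xs n\<bar> * w<..}) \<longlonglongrightarrow> c * w powr (-\<alpha>)"
    "(\<lambda>n. \<bar>xs n\<bar> powr \<alpha> * measure (law (xs n)) {..<-(\<bar>xs n\<bar> * w)}) \<longlonglongrightarrow> c * w powr (-\<alpha>)" if "w > 0" for w
    using lim[OF that, of "\<lambda>n y. measure (law (xs n)) {y<..}"] lim[OF that, of "\<lambda>n y. measure (law (xs n)) {..<-y}"]
      law_tail_limit xs by meson+
  show ?thesis
    by (rule balanced_tails.intro[OF alpha c_pos prob_law sets_law pos xs(3)
          C0_props(2)[OF xs(1,2)] C0_props(3)[OF xs(1,2)] tails])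
qed

text \<open>The drift condition in terms of the outward step; a single limit in |x| covers both
  half-lines.\<close>

definition drift_limit :: "real \<Rightarrow> real \<Rightarrow> bool" where
  "drift_limit \<gamma> b \<longleftrightarrow> (\<forall>e>0. \<exists>R. \<forall>x\<in>X. R \<le> \<bar>x\<bar> \<longrightarrow> \<bar>\<bar>x\<bar> powr \<gamma> * (\<integral>t. t \<partial>law x) - b\<bar> < e)"

lemma drift_limit_cond_D':
  assumes "cond_D' X K \<gamma> b"
  shows "drift_limit \<gamma> b"
  unfolding drift_limit_def
proof (intro allI impI)
  fix e :: real assume e: "e > 0"
  have "eventually (\<lambda>x. dist (x powr \<gamma> * drift K x) b < e) (inf at_top (principal X))"
    "eventually (\<lambda>x. dist (- (\<bar>x\<bar> powr \<gamma> * drift K x)) b < e) (inf at_bot (principal X))"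
    using assms e unfolding cond_D'_def by (auto dest: tendstoD)
  then obtain R1 R2 where R1: "\<And>x. x \<ge> R1 \<Longrightarrow> x \<in> X \<Longrightarrow> dist (x powr \<gamma> * drift K x) b < e"
    and R2: "\<And>x. x \<le> R2 \<Longrightarrow> x \<in> X \<Longrightarrow> dist (- (\<bar>x\<bar> powr \<gamma> * drift K x)) b < e"
    unfolding eventually_inf_principal eventually_at_top_linorder eventually_at_bot_linorder by blast
  have "\<bar>\<bar>x\<bar> powr \<gamma> * (\<integral>t. t \<partial>law x) - b\<bar> < e" if x: "x \<in> X" "\<bar>R1\<bar> + \<bar>R2\<bar> + 1 \<le> \<bar>x\<bar>" for x
  proof (cases "x > 0")
    case True
    then show ?thesis using R1[of x] x by (simp add: mean_law[OF x(1)] dist_real_def)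
  next
    case False
    then have "x < 0" using x by auto
    then show ?thesis using R2[of x] x by (simp add: mean_law[OF x(1)] dist_real_def)
  qed
  then show "\<exists>R. \<forall>x\<in>X. R \<le> \<bar>x\<bar> \<longrightarrow> \<bar>\<bar>x\<bar> powr \<gamma> * (\<integral>t. t \<partial>law x) - b\<bar> < e" by blast
qed

lemma drift_limit_sequence:
  assumes D: "drift_limit \<gamma> b"
    and xs: "\<And>n. xs n \<in> X" "filterlim (\<lambda>n. \<bar>xs n\<bar>) at_top sequentially"
  shows "(\<lambda>n. \<bar>xs n\<bar> powr \<gamma> * (\<integral>t. t \<partial>law (xs n))) \<longlonglongrightarrow> b"
proof (rule tendstoI)
  fix e :: real assume "e > 0"
  then obtain R where R: "\<And>x. x \<in> X \<Longrightarrow> R \<le> \<bar>x\<bar> \<Longrightarrow> \<bar>\<bar>x\<bar> powr \<gamma> * (\<integral>t. t \<partial>law x) - b\<bar> < e"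
    using D unfolding drift_limit_def by blast
  have "eventually (\<lambda>n. R \<le> \<bar>xs n\<bar>) sequentially" using xs(2) by (auto simp: filterlim_at_top)
  then show "eventually (\<lambda>n. dist (\<bar>xs n\<bar> powr \<gamma> * (\<integral>t. t \<partial>law (xs n))) b < e) sequentially"
    by eventually_elim (use R xs in \<open>auto simp: dist_real_def\<close>)
qed

text \<open>Reduces \<gamma> > \<alpha> - 1 to the critical exponent with drift constant 0.\<close>

lemma drift_limit_weaken:
  assumes D: "drift_limit \<gamma> b" and \<delta>: "\<delta> < \<gamma>"
  shows "drift_limit \<delta> 0"
  unfolding drift_limit_def
proof (intro allI impI)
  fix e :: real assume e: "e > 0"
  have "\<exists>R\<ge>R0. \<forall>x\<in>X. R \<le> \<bar>x\<bar> \<longrightarrow> \<bar>\<bar>x\<bar> powr \<delta> * (\<integral>t. t \<partial>law x) - 0\<bar> < e"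
  proof (rule uniform_from_sequences)
    fix xs :: "nat \<Rightarrow> real"
    assume xs: "\<And>n. xs n \<in> X" "\<And>n. R0 \<le> \<bar>xs n\<bar>" "filterlim (\<lambda>n. \<bar>xs n\<bar>) at_top sequentially"
    have "(\<lambda>n. \<bar>xs n\<bar> powr (-(\<gamma> - \<delta>)) * (\<bar>xs n\<bar> powr \<gamma> * (\<integral>t. t \<partial>law (xs n)))) \<longlonglongrightarrow> 0 * b"
      by (intro tendsto_mult powr_neg_tendsto_0 drift_limit_sequence[OF D] xs) (use \<delta> in auto)
    moreover have "\<bar>xs n\<bar> powr (-(\<gamma> - \<delta>)) * (\<bar>xs n\<bar> powr \<gamma> * (\<integral>t. t \<partial>law (xs n))) = \<bar>xs n\<bar> powr \<delta> * (\<integral>t. t \<partial>law (xs n))" for n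
      by (simp add: mult.assoc[symmetric] powr_add[symmetric])
    ultimately have "(\<lambda>n. \<bar>xs n\<bar> powr \<delta> * (\<integral>t. t \<partial>law (xs n))) \<longlonglongrightarrow> 0" by (simp only: mult_zero_left)
    then have "eventually (\<lambda>n. dist (\<bar>xs n\<bar> powr \<delta> * (\<integral>t. t \<partial>law (xs n))) 0 < e) sequentially"
      using e by (rule tendstoD)
    then show "\<exists>n. \<bar>\<bar>xs n\<bar> powr \<delta> * (\<integral>t. t \<partial>law (xs n)) - 0\<bar> < e"
      by (auto simp: eventually_sequentially dist_real_def)
  qed
  then show "\<exists>R. \<forall>x\<in>X. R \<le> \<bar>x\<bar> \<longrightarrow> \<bar>\<bar>x\<bar> powr \<delta> * (\<integral>t. t \<partial>law x) - 0\<bar> < e" by blast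
qed

abbreviation mean_bcut :: "real \<Rightarrow> real \<Rightarrow> bool \<Rightarrow> real \<Rightarrow> real" where
  "mean_bcut p e t x \<equiv> (\<integral>s. bcut p e t (1 + s / \<bar>x\<bar>) \<partial>law x)"

abbreviation integrable_bcut :: "real \<Rightarrow> real \<Rightarrow> bool \<Rightarrow> real \<Rightarrow> bool" where
  "integrable_bcut p e t x \<equiv> integrable (law x) (\<lambda>s. bcut p e t (1 + s / \<bar>x\<bar>))"

text \<open>The linear part of the increment contributes |x|^\<gamma> times the mean, with limit b.
  The rest is of order |x|^(-\<alpha>), hence carries the factor |x|^(-(\<alpha> - 1 - \<gamma>)):
  it survives exactly at criticality.\<close>

lemma generator_limit:
  assumes D: "drift_limit \<gamma> b" and \<gamma>: "\<gamma> \<le> \<alpha> - 1" and e: "0 < e" "e < 1/2" and p: "- 1 \<le> p" "p < \<alpha>" and \<eta>: "\<eta> > 0"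
  shows "\<exists>R\<ge>R0. \<forall>x\<in>X. R \<le> \<bar>x\<bar> \<longrightarrow> integrable_bcut p e t x \<and>
     \<bar>\<bar>x\<bar> powr (1 + \<gamma>) * mean_bcut p e t x - (b + (if \<gamma> = \<alpha> - 1 then c * jump_int \<alpha> p e t else 0))\<bar> < \<eta>"
  (is "\<exists>R\<ge>R0. \<forall>x\<in>X. _ \<longrightarrow> _ \<and> \<bar>_ - ?L\<bar> < \<eta>")
proof (rule uniform_from_sequences)
  fix xs :: "nat \<Rightarrow> real"
  assume xs: "\<And>n. xs n \<in> X" "\<And>n. R0 \<le> \<bar>xs n\<bar>" "filterlim (\<lambda>n. \<bar>xs n\<bar>) at_top sequentially"
  interpret balanced_tails \<alpha> c C0 "\<lambda>n. law (xs n)" "\<lambda>n. \<bar>xs n\<bar>" by (rule balanced_sequence[OF xs])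
  have "(\<lambda>n. \<bar>xs n\<bar> powr (-(\<alpha> - 1 - \<gamma>))) \<longlonglongrightarrow> (if \<gamma> = \<alpha> - 1 then 1 else 0)"
  proof (cases "\<gamma> = \<alpha> - 1")
    case True
    have "\<bar>xs n\<bar> powr (-(\<alpha> - 1 - \<gamma>)) = 1" for n using r(1)[of n] True by simp
    then show ?thesis using True by simp
  next
    case False
    then show ?thesis using powr_neg_tendsto_0[OF xs(3), of "\<alpha> - 1 - \<gamma>"] \<gamma> by simp
  qed
  then have "(\<lambda>n. \<bar>xs n\<bar> powr \<gamma> * (\<integral>t. t \<partial>law (xs n)) + \<bar>xs n\<bar> powr (-(\<alpha> - 1 - \<gamma>)) * (\<bar>xs n\<bar> powr \<alpha> * (mean_bcut p e t (xs n) - (\<integral>t. t \<partial>law (xs n)) / \<bar>xs n\<bar>)))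
     \<longlonglongrightarrow> b + (if \<gamma> = \<alpha> - 1 then 1 else 0) * (c * jump_int \<alpha> p e t)"
    by (intro tendsto_add tendsto_mult drift_limit_sequence[OF D] bcut_limit xs e p)
  moreover have "\<bar>xs n\<bar> powr \<gamma> * (\<integral>t. t \<partial>law (xs n)) + \<bar>xs n\<bar> powr (-(\<alpha> - 1 - \<gamma>)) * (\<bar>xs n\<bar> powr \<alpha> * (mean_bcut p e t (xs n) - (\<integral>t. t \<partial>law (xs n)) / \<bar>xs n\<bar>))
     = \<bar>xs n\<bar> powr (1 + \<gamma>) * mean_bcut p e t (xs n)" for n
  proof -
    have "\<bar>xs n\<bar> powr (-(\<alpha> - 1 - \<gamma>)) * \<bar>xs n\<bar> powr \<alpha> = \<bar>xs n\<bar> powr (1 + \<gamma>)"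
      by (simp add: powr_add[symmetric] algebra_simps)
    moreover have "\<bar>xs n\<bar> powr \<gamma> = \<bar>xs n\<bar> powr (1 + \<gamma>) / \<bar>xs n\<bar>"
      using r(1)[of n] by (simp add: powr_add)
    ultimately show ?thesis by (simp add: mult.assoc[symmetric] right_diff_distrib)
  qed
  ultimately have "(\<lambda>n. \<bar>xs n\<bar> powr (1 + \<gamma>) * mean_bcut p e t (xs n)) \<longlonglongrightarrow> ?L"
    by (simp split: if_splits)
  then have "eventually (\<lambda>n. dist (\<bar>xs n\<bar> powr (1 + \<gamma>) * mean_bcut p e t (xs n)) ?L < \<eta>) sequentially"
    using \<eta> by (rule tendstoD)
  then show "\<exists>n. integrable_bcut p e t (xs n) \<and>
     \<bar>\<bar>xs n\<bar> powr (1 + \<gamma>) * mean_bcut p e t (xs n) - ?L\<bar> < \<eta>"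
    using bcut_limit(1)[OF e p] by (auto simp: eventually_sequentially dist_real_def split del: if_split)
qed

lemma generator_critical:
  assumes "drift_limit (\<alpha> - 1) b" "0 < e" "e < 1/2" "- 1 \<le> p" "p < \<alpha>" "\<eta> > 0"
  shows "\<exists>R\<ge>R0. \<forall>x\<in>X. R \<le> \<bar>x\<bar> \<longrightarrow> integrable_bcut p e t x \<and>
     \<bar>\<bar>x\<bar> powr \<alpha> * mean_bcut p e t x - (b + c * jump_int \<alpha> p e t)\<bar> < \<eta>"
  using generator_limit[of "\<alpha> - 1" b e p \<eta> t] assms by simp

lemma generator_subcritical:
  assumes "drift_limit \<gamma> b" "\<gamma> < \<alpha> - 1" "0 < e" "e < 1/2" "- 1 \<le> p" "p < \<alpha>" "\<eta> > 0"
  shows "\<exists>R\<ge>R0. \<forall>x\<in>X. R \<le> \<bar>x\<bar> \<longrightarrow> integrable_bcut p e t x \<and>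
     \<bar>\<bar>x\<bar> powr (1 + \<gamma>) * mean_bcut p e t x - b\<bar> < \<eta>"
  using generator_limit[of \<gamma> b e p \<eta> t] assms by simp

end

subsection \<open>Lyapunov functions\<close>

lemma bcut_powr:
  assumes "e > 0" "p \<noteq> 0"
  shows "1 + p * bcut p e True u = (max \<bar>u\<bar> e) powr p" "1 + p * bcut p e False u = (max u e) powr p"
  using assms by (auto simp: bcut_def box_cox_def)

context balanced_chain
begin

text \<open>With the exponent 1 + \<gamma> the expected decrease is of constant order, as a bound on
  hitting times requires. The cut-off only enlarges the power, so it yields a majorant, and it does
  not enter the subcritical limit; 1/4 is one admissible value.\<close>

lemma power_drift:
  assumes D: "drift_limit \<gamma> b" and \<gamma>: "0 \<le> \<gamma>" "\<gamma> < \<alpha> - 1" and b: "b < 0"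
  shows "\<exists>A>0. \<exists>R\<ge>R0. \<forall>x\<in>X. R \<le> \<bar>x\<bar> \<longrightarrow>
    1 + (\<integral>\<^sup>+z. ennreal (A * \<bar>z\<bar> powr (1 + \<gamma>)) \<partial>Q x) \<le> ennreal (A * \<bar>x\<bar> powr (1 + \<gamma>))"
proof -
  define \<nu> where "\<nu> = 1 + \<gamma>"
  have \<nu>: "1 \<le> \<nu>" "\<nu> < \<alpha>" using \<gamma> by (auto simp: \<nu>_def)
  \<comment> \<open>The rescaled increment stays below b / 2, so this A makes the decrease A * \<nu>
    * (b / 2) equal to -1.\<close>
  define A where "A = - 2 / (\<nu> * b)"
  have A: "A > 0" using \<nu> b by (auto simp: A_def intro!: divide_neg_neg mult_pos_neg)
  obtain R where R: "R \<ge> R0" "\<And>x. x \<in> X \<Longrightarrow> R \<le> \<bar>x\<bar> \<Longrightarrow> integrable_bcut \<nu> (1/4) True x"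
    "\<And>x. x \<in> X \<Longrightarrow> R \<le> \<bar>x\<bar> \<Longrightarrow> \<bar>\<bar>x\<bar> powr \<nu> * mean_bcut \<nu> (1/4) True x - b\<bar> < - b / 2"
    using generator_subcritical[OF D \<gamma>(2), of "1/4" \<nu> "- b / 2" True] \<nu> b by (auto simp: \<nu>_def)
  have "1 + (\<integral>\<^sup>+z. ennreal (A * \<bar>z\<bar> powr \<nu>) \<partial>Q x) \<le> ennreal (A * \<bar>x\<bar> powr \<nu>)" if x: "x \<in> X" "R \<le> \<bar>x\<bar>" for x
  proof -
    interpret prob_space "law x" by (rule prob_law)
    define r where "r = \<bar>x\<bar>"
    have r: "r > 0" "x \<noteq> 0" using x R(1) R0_ge_1 by (auto simp: r_def)
    define I where "I = (\<integral>s. bcut \<nu> (1/4) True (1 + s / r) \<partial>law x)"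
    define g where "g s = A * r powr \<nu> * (1 + \<nu> * bcut \<nu> (1/4) True (1 + s / r))" for s
    have gi: "integrable (law x) g" unfolding g_def
      by (intro integrable_mult_right Bochner_Integration.integrable_add integrable_const R(2)[OF x, folded r_def])
    have g: "(\<integral>s. g s \<partial>law x) = A * r powr \<nu> * (1 + \<nu> * I)"
      using R(2)[OF x, folded r_def] unfolding g_def I_def by (simp add: prob_space)
    have rI: "r powr \<nu> * I < b / 2" using R(3)[OF x] by (auto simp: I_def r_def abs_less_iff)
    have fg: "A * \<bar>r + s\<bar> powr \<nu> \<le> g s" for s
    proof -
      have "\<bar>r + s\<bar> = r * \<bar>1 + s / r\<bar>" using r by (simp add: abs_mult_pos[symmetric] field_simps)
      also have "\<dots> \<le> r * max \<bar>1 + s / r\<bar> (1/4)" using r by (intro mult_left_mono) auto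
      finally have "\<bar>r + s\<bar> powr \<nu> \<le> (r * max \<bar>1 + s / r\<bar> (1/4)) powr \<nu>"
        using \<nu> by (intro powr_mono2) auto
      also have "\<dots> = r powr \<nu> * (1 + \<nu> * bcut \<nu> (1/4) True (1 + s / r))"
        using r \<nu> by (subst bcut_powr) (auto simp: powr_mult)
      finally show ?thesis using A by (simp add: g_def mult.assoc)
    qed
    have "(\<integral>s. g s \<partial>law x) = A * r powr \<nu> + A * \<nu> * (r powr \<nu> * I)" unfolding g by (simp add: algebra_simps)
    also have "\<dots> \<le> A * r powr \<nu> + A * \<nu> * (b / 2)" using A \<nu> rI by (intro add_left_mono mult_left_mono) auto
    also have "A * \<nu> * (b / 2) = - 1" using b \<nu> by (simp add: A_def)
    finally have gB: "(\<integral>s. g s \<partial>law x) \<le> A * r powr \<nu> - 1" by simp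
    have "g s \<ge> 0" for s using fg[of s] A by (meson mult_nonneg_nonneg less_imp_le order_trans powr_ge_zero)
    then have "0 \<le> (\<integral>s. g s \<partial>law x)" by (intro Bochner_Integration.integral_nonneg)
    then have B0: "0 \<le> A * r powr \<nu> - 1" using gB by linarith
    have "(\<integral>\<^sup>+z. ennreal (A * \<bar>sgn x * z\<bar> powr \<nu>) \<partial>Q x) \<le> ennreal (A * r powr \<nu> - 1)"
      by (rule one_step_bound[OF r(2) _ _ _ gi gB]) (use A fg in \<open>auto simp: r_def\<close>)
    then have "(\<integral>\<^sup>+z. ennreal (A * \<bar>z\<bar> powr \<nu>) \<partial>Q x) \<le> ennreal (A * r powr \<nu> - 1)"
      using r by (simp add: abs_mult abs_sgn_eq)
    then have "1 + (\<integral>\<^sup>+z. ennreal (A * \<bar>z\<bar> powr \<nu>) \<partial>Q x) \<le> ennreal 1 + ennreal (A * r powr \<nu> - 1)"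
      by (simp add: add_left_mono)
    also have "\<dots> = ennreal (A * r powr \<nu>)" using B0 by (subst ennreal_plus[symmetric]) auto
    finally show ?thesis by (simp add: r_def)
  qed
  then show ?thesis unfolding \<nu>_def using A R(1) by blast
qed

text \<open>Equal to 1 up to level y and decaying beyond it, so that it dominates the indicator of
  {z \<le> y} and can bound hitting probabilities. The scale y varies only in the estimate for slow
  return.\<close>

definition trunc_pow :: "real \<Rightarrow> real \<Rightarrow> real \<Rightarrow> real" where
  "trunc_pow \<nu> y z = (max (z / y) 1) powr (-\<nu>)"

lemma trunc_pow_meas [measurable]: "trunc_pow \<nu> y \<in> borel_measurable borel"
  unfolding trunc_pow_def by measurable

lemma trunc_pow_ge_0 [simp]: "0 \<le> trunc_pow \<nu> y z" by (simp add: trunc_pow_def)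

lemma trunc_pow_le_1: "0 \<le> \<nu> \<Longrightarrow> trunc_pow \<nu> y z \<le> 1"
  using powr_mono2'[of "-\<nu>" 1 "max (z / y) 1"] by (simp add: trunc_pow_def)

lemma trunc_pow_eq: "0 < y \<Longrightarrow> y \<le> z \<Longrightarrow> trunc_pow \<nu> y z = (z / y) powr (-\<nu>)"
  by (simp add: trunc_pow_def max_def pos_le_divide_eq)

lemma trunc_pow_eq_1: "0 < y \<Longrightarrow> z \<le> y \<Longrightarrow> trunc_pow \<nu> y z = 1"
  by (simp add: trunc_pow_def max_def pos_le_divide_eq)

text \<open>Where 1 + s / r \<ge> 1/4, the cut-off power is a majorant. Otherwise the step is below
  -r/2, which has probability at most C0 (r / 2)^(-\<alpha>), and there the truncated power is at
  most 1.\<close>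

lemma trunc_pow_step:
  assumes x: "x \<in> X" "R0 \<le> \<bar>x\<bar>" and y: "y > 0" and \<nu>: "0 < \<nu>" "\<nu> \<le> 1"
    and int: "integrable_bcut (-\<nu>) (1/4) False x"
  shows "(\<integral>\<^sup>+z. ennreal (trunc_pow \<nu> y (sgn x * z)) \<partial>Q x) \<le>
    ennreal ((\<bar>x\<bar> / y) powr (-\<nu>) * (1 - \<nu> * mean_bcut (-\<nu>) (1/4) False x) + C0 * (\<bar>x\<bar> / 2) powr (-\<alpha>))"
proof -
  interpret prob_space "law x" by (rule prob_law)
  define r where "r = \<bar>x\<bar>"
  have r: "r > 0" "x \<noteq> 0" using x R0_ge_1 by (auto simp: r_def)
  define g where "g s = (r / y) powr (-\<nu>) * (1 + (-\<nu>) * bcut (-\<nu>) (1/4) False (1 + s / r)) + indicator {..<-(r/2)} s" for s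
  have i2: "integrable (law x) (indicator {..<-(r/2)} :: real \<Rightarrow> real)"
    by (intro integrable_real_indicator) (auto simp: emeasure_eq_measure)
  have i1: "integrable (law x) (\<lambda>s. (r / y) powr (-\<nu>) * (1 + (-\<nu>) * bcut (-\<nu>) (1/4) False (1 + s / r)))"
    by (intro integrable_mult_right Bochner_Integration.integrable_add integrable_const int[folded r_def])
  have gi: "integrable (law x) g" unfolding g_def by (rule Bochner_Integration.integrable_add[OF i1 i2])
  have "space (law x) = UNIV" by (simp add: law_def)
  then have "(\<integral>s. g s \<partial>law x) = (r / y) powr (-\<nu>) * (1 - \<nu> * (\<integral>s. bcut (-\<nu>) (1/4) False (1 + s / r) \<partial>law x)) + prob {..<-(r/2)}"
    unfolding g_def Bochner_Integration.integral_add[OF i1 i2] using int[folded r_def]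
    by (simp add: prob_space[unfolded \<open>space (law x) = UNIV\<close>])
  also have "\<dots> \<le> (r / y) powr (-\<nu>) * (1 - \<nu> * (\<integral>s. bcut (-\<nu>) (1/4) False (1 + s / r) \<partial>law x)) + C0 * (r / 2) powr (-\<alpha>)"
    using C0_props(3)[OF x, of "r / 2"] r by simp
  finally have gB: "(\<integral>s. g s \<partial>law x) \<le> \<dots>" .
  have "trunc_pow \<nu> y (r + s) \<le> g s" for s
  proof -
    have pos: "0 \<le> (r / y) powr (-\<nu>) * (1 + (-\<nu>) * bcut (-\<nu>) (1/4) False (1 + s / r))"
      using \<nu> by (subst bcut_powr) auto
    show ?thesis
    proof (cases "1 + s / r < 1/4")
      case True
      then have "s < - (r / 2)" using r by (simp add: field_simps)
      then show ?thesis using pos trunc_pow_le_1[of \<nu> y "r + s"] \<nu> by (simp add: g_def)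
    next
      case False
      have p: "0 < 1 + s / r" using False by linarith
      have eq: "(r + s) / y = (r / y) * (1 + s / r)" using r y by (simp add: field_simps)
      have "(max ((r + s) / y) 1) powr (-\<nu>) \<le> ((r / y) * (1 + s / r)) powr (-\<nu>)"
      proof -
        have "0 < (r / y) * (1 + s / r)" using p r y by (intro mult_pos_pos) auto
        then show ?thesis using \<nu> unfolding eq by (intro powr_mono2') auto
      qed
      also have "\<dots> = (r / y) powr (-\<nu>) * (1 + s / r) powr (-\<nu>)"
        by (rule powr_mult)
      also have "(1 + s / r) powr (-\<nu>) = 1 + (-\<nu>) * bcut (-\<nu>) (1/4) False (1 + s / r)"
        using bcut_powr(2)[of "1/4" "-\<nu>" "1 + s / r"] \<nu> False by (simp add: max_absorb1)
      finally show ?thesis by (simp add: g_def trunc_pow_def indicator_def)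
    qed
  qed
  then show ?thesis
    using one_step_bound[OF r(2) trunc_pow_meas _ _ gi gB, of \<nu> y] unfolding r_def by simp
qed

text \<open>The outward drift lowers the negative power by order r^(-\<nu> - 1 - \<gamma>); a jump
  towards the other side costs at most order r^(-\<alpha>). The drift wins if \<nu> + 1 + \<gamma> <
  \<alpha>.\<close>

lemma directional_drift:
  assumes D: "drift_limit \<gamma> b" and \<gamma>: "0 \<le> \<gamma>" "\<gamma> < \<alpha> - 1" and b: "b > 0"
  shows "\<exists>\<nu>>0. \<exists>R\<ge>R0. \<forall>x\<in>X. R \<le> \<bar>x\<bar> \<longrightarrow>
    (\<integral>\<^sup>+z. ennreal (trunc_pow \<nu> 1 (sgn x * z)) \<partial>Q x) \<le> ennreal (trunc_pow \<nu> 1 \<bar>x\<bar>)"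
proof -
  \<comment> \<open>Half of the available room: \<alpha> exceeds \<nu> + 1 + \<gamma> by exactly
    \<nu>.\<close>
  define \<nu> where "\<nu> = (\<alpha> - 1 - \<gamma>) / 2"
  have \<nu>: "0 < \<nu>" "\<nu> \<le> 1" "\<alpha> = 1 + \<gamma> + 2 * \<nu>" using \<gamma> alpha by (auto simp: \<nu>_def field_simps)
  obtain R where R: "R \<ge> R0" "\<And>x. x \<in> X \<Longrightarrow> R \<le> \<bar>x\<bar> \<Longrightarrow> integrable_bcut (-\<nu>) (1/4) False x"
    "\<And>x. x \<in> X \<Longrightarrow> R \<le> \<bar>x\<bar> \<Longrightarrow> \<bar>\<bar>x\<bar> powr (1 + \<gamma>) * mean_bcut (-\<nu>) (1/4) False x - b\<bar> < b / 2"
    using generator_subcritical[OF D \<gamma>(2), of "1/4" "-\<nu>" "b / 2" False] \<nu> b alpha by auto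
  obtain R' where R': "\<And>r. r \<ge> R' \<Longrightarrow> C0 * 2 powr \<alpha> * r powr (-\<nu>) \<le> \<nu> * (b / 2)"
    using tendsto_0_eventually_bound[of \<nu> "\<nu> * (b / 2)" "C0 * 2 powr \<alpha>"] \<nu> b by auto
  have "(\<integral>\<^sup>+z. ennreal (trunc_pow \<nu> 1 (sgn x * z)) \<partial>Q x) \<le> ennreal (trunc_pow \<nu> 1 \<bar>x\<bar>)"
    if x: "x \<in> X" "max R R' \<le> \<bar>x\<bar>" for x
  proof -
    define r where "r = \<bar>x\<bar>"
    have xR: "R0 \<le> \<bar>x\<bar>" "R \<le> \<bar>x\<bar>" "R' \<le> r" using x R(1) by (auto simp: r_def)
    have r: "r \<ge> 1" using xR R0_ge_1 by (simp add: r_def)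
    define I where "I = (\<integral>s. bcut (-\<nu>) (1/4) False (1 + s / r) \<partial>law x)"
    have "r powr (1 + \<gamma>) * I > b / 2" using R(3)[OF x(1) xR(2)] unfolding I_def r_def by linarith
    then have "r powr (- (\<nu> + 1 + \<gamma>)) * (\<nu> * (b / 2)) \<le> r powr (- (\<nu> + 1 + \<gamma>)) * (\<nu> * (r powr (1 + \<gamma>) * I))"
      using \<nu> by (intro mult_left_mono) auto
    also have "\<dots> = \<nu> * r powr (-\<nu>) * I"
    proof -
      have "r powr (- (\<nu> + 1 + \<gamma>)) * r powr (1 + \<gamma>) = r powr (-\<nu>)" by (simp flip: powr_add)
      then show ?thesis by (metis (no_types, lifting) mult.assoc mult.commute)
    qed
    finally have 1: "r powr (- (\<nu> + 1 + \<gamma>)) * (\<nu> * (b / 2)) \<le> \<nu> * r powr (-\<nu>) * I" .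
    have "C0 * (r / 2) powr (-\<alpha>) = r powr (- (\<nu> + 1 + \<gamma>)) * (C0 * 2 powr \<alpha> * r powr (-\<nu>))"
    proof -
      have "r powr (-\<alpha>) = r powr (- (\<nu> + 1 + \<gamma>)) * r powr (-\<nu>)" unfolding \<nu>(3) by (simp flip: powr_add)
      then show ?thesis using r by (simp add: powr_divide powr_minus_divide[of 2])
    qed
    also have "\<dots> \<le> r powr (- (\<nu> + 1 + \<gamma>)) * (\<nu> * (b / 2))"
      by (intro mult_left_mono R' xR) auto
    finally have "C0 * (r / 2) powr (-\<alpha>) \<le> \<nu> * r powr (-\<nu>) * I" using 1 by linarith
    then have "(r / 1) powr (-\<nu>) * (1 - \<nu> * I) + C0 * (r / 2) powr (-\<alpha>) \<le> trunc_pow \<nu> 1 r"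
      using r by (simp add: trunc_pow_eq algebra_simps)
    moreover have "(\<integral>\<^sup>+z. ennreal (trunc_pow \<nu> 1 (sgn x * z)) \<partial>Q x) \<le> ennreal ((r / 1) powr (-\<nu>) * (1 - \<nu> * I) + C0 * (r / 2) powr (-\<alpha>))"
      unfolding I_def r_def by (rule trunc_pow_step) (use x xR \<nu> R(2) in auto)
    ultimately show ?thesis unfolding r_def by (meson ennreal_leI order_trans)
  qed
  moreover have "max R R' \<ge> R0" using R(1) by simp
  ultimately show ?thesis using \<nu>(1) by blast
qed

text \<open>For x > y the expected increment is of order x^(-\<alpha>) \<le> y^(-\<alpha>), whatever
  its sign; for x \<le> y the function already has its maximum 1. Descending from 2y to y therefore
  takes on the order of y^\<alpha> steps.\<close>

lemma slow_return:
  assumes D: "drift_limit (\<alpha> - 1) b"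
  shows "\<exists>R\<ge>R0. \<exists>C>0. \<forall>y\<ge>R. \<forall>x\<in>X.
    (\<integral>\<^sup>+z. ennreal (trunc_pow 1 y z) \<partial>Q x) \<le> ennreal (trunc_pow 1 y x) + ennreal (C * y powr (-\<alpha>))"
proof -
  \<comment> \<open>The modulus of the limit plus 1, which bounds the rescaled increment for all
    large |x|.\<close>
  define B where "B = \<bar>b + c * jump_int \<alpha> (-1) (1/4) False\<bar> + 1"
  obtain R where R: "R \<ge> R0" "\<And>x. x \<in> X \<Longrightarrow> R \<le> \<bar>x\<bar> \<Longrightarrow> integrable_bcut (-1) (1/4) False x"
    "\<And>x. x \<in> X \<Longrightarrow> R \<le> \<bar>x\<bar> \<Longrightarrow> \<bar>\<bar>x\<bar> powr \<alpha> * mean_bcut (-1) (1/4) False x - (b + c * jump_int \<alpha> (-1) (1/4) False)\<bar> < 1"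
    using generator_critical[OF D, of "1/4" "-1" 1 False] alpha by auto
  define C where "C = B + C0 * 2 powr \<alpha>"
  have "B > 0" by (simp add: B_def)
  then have C: "C > 0" using C0_props(1) by (simp add: C_def add_pos_pos)
  have "(\<integral>\<^sup>+z. ennreal (trunc_pow 1 y z) \<partial>Q x) \<le> ennreal (trunc_pow 1 y x) + ennreal (C * y powr (-\<alpha>))"
    if y: "y \<ge> R" and x: "x \<in> X" for x y
  proof (cases "x \<le> y")
    case True
    have "(\<integral>\<^sup>+z. ennreal (trunc_pow 1 y z) \<partial>Q x) \<le> (\<integral>\<^sup>+z. 1 \<partial>Q x)"
      by (intro nn_integral_mono) (use trunc_pow_le_1 in auto)
    also have "\<dots> = ennreal (trunc_pow 1 y x)" using True y R(1) R0_ge_1 by (simp add: trunc_pow_eq_1)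
    also have "\<dots> \<le> ennreal (trunc_pow 1 y x) + ennreal (C * y powr (-\<alpha>))" by (simp add: add_increasing2)
    finally show ?thesis .
  next
    case False
    then have xy: "y \<le> x" "x > 0" "y > 0" "\<bar>x\<bar> = x" "sgn x = 1" "R \<le> \<bar>x\<bar>" using y R(1) R0_ge_1 by auto
    define I where "I = mean_bcut (-1) (1/4) False x"
    have "\<bar>x powr \<alpha> * I\<bar> \<le> B" using R(3)[OF x xy(6)] xy(4) by (auto simp: B_def I_def)
    then have "\<bar>I\<bar> \<le> B * x powr (-\<alpha>)" using xy by (simp add: abs_mult powr_minus field_simps)
    also have "\<dots> \<le> B * y powr (-\<alpha>)"
      using xy alpha by (intro mult_left_mono powr_mono2') (auto simp: B_def)
    finally have I: "\<bar>I\<bar> \<le> B * y powr (-\<alpha>)" .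
    have d1: "(x / y) powr (-1) \<le> 1" using trunc_pow_le_1[of 1 y x] xy by (simp add: trunc_pow_eq)
    have "(x / y) powr (-1) * (1 - 1 * I) + C0 * (x / 2) powr (-\<alpha>) \<le> trunc_pow 1 y x + C * y powr (-\<alpha>)"
    proof -
      have "(x / y) powr (-1) * (- I) \<le> 1 * \<bar>I\<bar>"
        using d1 by (intro order_trans[OF mult_left_mono[of "-I" "\<bar>I\<bar>"] mult_right_mono]) auto
      moreover have "C0 * (x / 2) powr (-\<alpha>) \<le> C0 * (y / 2) powr (-\<alpha>)"
        using xy alpha C0_props(1) by (intro mult_left_mono powr_mono2') auto
      moreover have "C0 * (y / 2) powr (-\<alpha>) = C0 * 2 powr \<alpha> * y powr (-\<alpha>)"
        using xy by (simp add: powr_divide powr_minus_divide[of 2])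
      moreover have "(x / y) powr (-1) = trunc_pow 1 y x" using xy by (simp add: trunc_pow_eq)
      moreover have "(x / y) powr (-1) * (1 - 1 * I) = (x / y) powr (-1) + (x / y) powr (-1) * (- I)"
        by (simp only: distrib_left mult_1_left mult_1_right diff_conv_add_uminus)
      moreover have "C * y powr (-\<alpha>) = B * y powr (-\<alpha>) + C0 * 2 powr \<alpha> * y powr (-\<alpha>)"
        by (simp only: C_def distrib_right)
      ultimately show ?thesis using I by linarith
    qed
    moreover have "(\<integral>\<^sup>+z. ennreal (trunc_pow 1 y z) \<partial>Q x) \<le> ennreal ((x / y) powr (-1) * (1 - 1 * I) + C0 * (x / 2) powr (-\<alpha>))"
      using trunc_pow_step[OF x _ xy(3), of 1] R(2)[OF x xy(6)] R(1) xy unfolding I_def by simp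
    ultimately have "(\<integral>\<^sup>+z. ennreal (trunc_pow 1 y z) \<partial>Q x) \<le> ennreal (trunc_pow 1 y x + C * y powr (-\<alpha>))"
      by (meson ennreal_leI order_trans)
    also have "\<dots> = ennreal (trunc_pow 1 y x) + ennreal (C * y powr (-\<alpha>))" using C by (intro ennreal_plus) auto
    finally show ?thesis .
  qed
  then show ?thesis using R(1) C by blast
qed

definition trunc_log :: "bool \<Rightarrow> real \<Rightarrow> real" where
  "trunc_log t z = ln (max (if t then \<bar>z\<bar> else z) 1)"

lemma trunc_log_meas [measurable]: "trunc_log t \<in> borel_measurable borel"
  unfolding trunc_log_def by measurable

lemma trunc_log_ge_0 [simp]: "0 \<le> trunc_log t z" by (simp add: trunc_log_def)

text \<open>Once r e \<ge> 1, the truncation at 1 lies below the cut-off at r e, so the cut-off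
  logarithm is a majorant and its negative mean increment suffices. This explains the threshold 1 /
  e.\<close>

lemma log_drift:
  assumes D: "drift_limit (\<alpha> - 1) b" and e: "0 < e" "e < 1/2" and neg: "b + c * jump_int \<alpha> 0 e t < 0"
  shows "\<exists>R\<ge>R0. \<forall>x\<in>X. R \<le> \<bar>x\<bar> \<longrightarrow>
    (\<integral>\<^sup>+z. ennreal (trunc_log t (sgn x * z)) \<partial>Q x) \<le> ennreal (trunc_log t \<bar>x\<bar>)"
proof -
  obtain R where R: "R \<ge> R0" "\<And>x. x \<in> X \<Longrightarrow> R \<le> \<bar>x\<bar> \<Longrightarrow> integrable_bcut 0 e t x"
    "\<And>x. x \<in> X \<Longrightarrow> R \<le> \<bar>x\<bar> \<Longrightarrow> \<bar>\<bar>x\<bar> powr \<alpha> * mean_bcut 0 e t x - (b + c * jump_int \<alpha> 0 e t)\<bar> < - (b + c * jump_int \<alpha> 0 e t)"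
    using generator_critical[OF D e, of 0 "- (b + c * jump_int \<alpha> 0 e t)" t] alpha neg by auto
  have "(\<integral>\<^sup>+z. ennreal (trunc_log t (sgn x * z)) \<partial>Q x) \<le> ennreal (trunc_log t \<bar>x\<bar>)" if x: "x \<in> X" "max R (1 / e) \<le> \<bar>x\<bar>" for x
  proof -
    interpret prob_space "law x" by (rule prob_law)
    define r where "r = \<bar>x\<bar>"
    have xR: "R \<le> \<bar>x\<bar>" "1 / e \<le> r" using x by (auto simp: r_def)
    have r: "r \<ge> 1" "x \<noteq> 0" using xR R(1) R0_ge_1 by (auto simp: r_def)
    have re: "1 \<le> r * e" using xR(2) e by (simp add: field_simps)
    define g where "g s = ln r + bcut 0 e t (1 + s / r)" for s
    note int = R(2)[OF x(1) xR(1), folded r_def]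
    have gi: "integrable (law x) g" unfolding g_def by (intro Bochner_Integration.integrable_add integrable_const int)
    have "(\<integral>s. g s \<partial>law x) = ln r + (\<integral>s. bcut 0 e t (1 + s / r) \<partial>law x)"
      unfolding g_def using int by (simp add: prob_space)
    moreover have "(\<integral>s. bcut 0 e t (1 + s / r) \<partial>law x) \<le> 0"
    proof -
      have "r powr \<alpha> * (\<integral>s. bcut 0 e t (1 + s / r) \<partial>law x) < 0"
        using R(3)[OF x(1) xR(1), folded r_def] by linarith
      then show ?thesis using r by (simp add: mult_less_0_iff)
    qed
    ultimately have gB: "(\<integral>s. g s \<partial>law x) \<le> ln r" by simp
    have fg: "trunc_log t (r + s) \<le> g s" for s
    proof -
      define m where "m = (if t then \<bar>1 + s / r\<bar> else 1 + s / r)"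
      have "(if t then \<bar>r + s\<bar> else r + s) = r * m"
      proof -
        have "r + s = r * (1 + s / r)" using r by (simp add: field_simps)
        then show ?thesis using r by (simp add: m_def abs_mult)
      qed
      moreover have "max (r * m) 1 \<le> r * max m e"
      proof -
        have "r * m \<le> r * max m e" "r * e \<le> r * max m e" using r by (intro mult_left_mono; simp)+
        then show ?thesis using re by simp
      qed
      ultimately have "trunc_log t (r + s) \<le> ln (r * max m e)" unfolding trunc_log_def by (intro ln_mono) auto
      also have "\<dots> = ln r + ln (max m e)" using r e by (intro ln_mult_pos) auto
      also have "ln (max m e) = bcut 0 e t (1 + s / r)" by (simp add: bcut_def box_cox_def m_def)
      finally show ?thesis by (simp add: g_def)
    qed
    have "(\<integral>\<^sup>+z. ennreal (trunc_log t (sgn x * z)) \<partial>Q x) \<le> ennreal (ln r)"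
      by (rule one_step_bound[OF r(2) trunc_log_meas _ _ gi gB]) (use fg in \<open>auto simp: r_def\<close>)
    also have "ln r = trunc_log t \<bar>x\<bar>" using r by (simp add: trunc_log_def r_def max_def)
    finally show ?thesis .
  qed
  moreover have "max R (1 / e) \<ge> R0" using R(1) by simp
  ultimately show ?thesis by blast
qed

end

section \<open>Steps into a small ball and transience at criticality\<close>

context balanced_chain
begin

text \<open>Landing in the ball is a difference of two tails. Their main parts differ by order w
  r^(-\<alpha> - 1), by the mean value theorem, and the rate bounds the rest by order r^(-\<alpha> -
  \<delta>). Bare convergence of the tails would leave an error that is merely o(r^(-\<alpha>)),
  with no power to spare.\<close>

lemma small_ball:
  assumes rate: "cond_Tbal_rate X K \<alpha> c"
  shows "\<exists>R\<ge>R0. \<exists>C1\<ge>0. \<exists>C2\<ge>0. \<exists>\<delta>>0. \<forall>x\<in>X. R \<le> \<bar>x\<bar> \<longrightarrow> (\<forall>w. 0 < w \<longrightarrow> w \<le> \<bar>x\<bar> / 4 \<longrightarrow>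
    measure (law x) {s. \<bar>\<bar>x\<bar> + s\<bar> \<le> w} \<le> C1 * w * \<bar>x\<bar> powr (-\<alpha> - 1) + C2 * \<bar>x\<bar> powr (-\<alpha> - \<delta>))"
proof -
  obtain x0 \<delta> C Y where x0: "x0 \<ge> 0" "\<delta> > 0"
    and dev: "\<And>y. y \<ge> Y \<Longrightarrow> tail_dev_bound X K \<alpha> c x0 y (C * y powr (-\<delta>))"
    using rate unfolding cond_Tbal_rate_def by blast
  \<comment> \<open>The constant in the rate condition may be negative; the monotonicity steps
    require a nonnegative one.\<close>
  define C' where "C' = max C 0"
  define C1 where "C1 = 3 * c * \<alpha> * 2 powr (\<alpha> + 1)"
  define C2 where "C2 = 2 * C' * 2 powr (\<alpha> + \<delta>)"
  define R where "R = R0 + x0 + 2 * \<bar>Y\<bar> + 1"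
  have bound: "measure (law x) {s. \<bar>\<bar>x\<bar> + s\<bar> \<le> w} \<le> C1 * w * \<bar>x\<bar> powr (-\<alpha> - 1) + C2 * \<bar>x\<bar> powr (-\<alpha> - \<delta>)"
    if x: "x \<in> X" "R \<le> \<bar>x\<bar>" and w: "0 < w" "w \<le> \<bar>x\<bar> / 4" for x w
  proof -
    interpret prob_space "law x" by (rule prob_law)
    define r where "r = \<bar>x\<bar>"
    have xx: "x \<noteq> 0" "\<bar>x\<bar> \<ge> x0" "r \<ge> 2 * \<bar>Y\<bar> + 1" "r > 0" using x x0 R0_ge_1 by (auto simp: R_def r_def)
    define F where "F y = prob {..<-y}" for y
    have Fd: "\<bar>y powr \<alpha> * F y - c\<bar> \<le> C' * y powr (-\<delta>)" if "y \<ge> Y" "y \<ge> 0" for y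
    proof -
      have "\<bar>y powr \<alpha> * F y - c\<bar> \<le> C * y powr (-\<delta>)"
        using dev[OF that(1)] xx(2) x(1) unfolding F_def law_tail(2)[OF x(1) xx(1) that(2)]
        by (cases "x > 0") (auto simp: tail_dev_bound_def)
      also have "\<dots> \<le> C' * y powr (-\<delta>)" by (intro mult_right_mono) (auto simp: C'_def)
      finally show ?thesis .
    qed
    \<comment> \<open>The offset 2w instead of w lets the half-open interval [-y2, -y1) contain the
      closed ball; the bound w \<le> r/4 keeps y1 above r/2. The factor 3 of \<open>C1\<close> is
      (y2 - y1) / w.\<close>
    define y1 where "y1 = r - 2 * w"
    define y2 where "y2 = r + w"
    have y: "r / 2 \<le> y1" "r / 2 \<le> y2" "y1 < y2" "y1 \<ge> Y" "y2 \<ge> Y" "y1 > 0" "y2 > 0"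
      using w xx by (auto simp: y1_def y2_def r_def)
    have small: "y powr (-\<delta>) * y powr (-\<alpha>) \<le> (r / 2) powr (-\<alpha> - \<delta>)" if "r / 2 \<le> y" for y
    proof -
      have "y powr (-\<delta>) * y powr (-\<alpha>) = y powr (-\<alpha> - \<delta>)" by (simp add: powr_add[symmetric] add.commute)
      also have "\<dots> \<le> (r / 2) powr (-\<alpha> - \<delta>)" using that xx alpha x0 by (intro powr_mono2') auto
      finally show ?thesis .
    qed
    have inv: "z powr \<alpha> * z powr (-\<alpha>) = 1" if "z > 0" for z :: real
      using that by (simp add: powr_minus)
    have F1: "F y1 \<le> c * y1 powr (-\<alpha>) + C' * (r / 2) powr (-\<alpha> - \<delta>)"
    proof -
      have "y1 powr \<alpha> * F y1 \<le> c + C' * y1 powr (-\<delta>)" using Fd[of y1] y by auto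
      then have "y1 powr (-\<alpha>) * (y1 powr \<alpha> * F y1) \<le> y1 powr (-\<alpha>) * (c + C' * y1 powr (-\<delta>))"
        by (intro mult_left_mono) auto
      moreover have "y1 powr (-\<alpha>) * (y1 powr \<alpha> * F y1) = F y1" using inv[of y1] y by (simp add: mult.assoc[symmetric] mult.commute[of "y1 powr (-\<alpha>)"])
      moreover have "C' * (y1 powr (-\<delta>) * y1 powr (-\<alpha>)) \<le> C' * (r / 2) powr (-\<alpha> - \<delta>)"
        by (intro mult_left_mono small y) (auto simp: C'_def)
      moreover have "y1 powr (-\<alpha>) * (c + C' * y1 powr (-\<delta>)) = c * y1 powr (-\<alpha>) + C' * (y1 powr (-\<delta>) * y1 powr (-\<alpha>))"
        by (simp only: algebra_simps)
      ultimately show ?thesis by linarith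
    qed
    have F2: "F y2 \<ge> c * y2 powr (-\<alpha>) - C' * (r / 2) powr (-\<alpha> - \<delta>)"
    proof -
      have "y2 powr \<alpha> * F y2 \<ge> c - C' * y2 powr (-\<delta>)" using Fd[of y2] y by auto
      then have "y2 powr (-\<alpha>) * (y2 powr \<alpha> * F y2) \<ge> y2 powr (-\<alpha>) * (c - C' * y2 powr (-\<delta>))"
        by (intro mult_left_mono) auto
      moreover have "y2 powr (-\<alpha>) * (y2 powr \<alpha> * F y2) = F y2" using inv[of y2] y by (simp add: mult.assoc[symmetric] mult.commute[of "y2 powr (-\<alpha>)"])
      moreover have "C' * (y2 powr (-\<delta>) * y2 powr (-\<alpha>)) \<le> C' * (r / 2) powr (-\<alpha> - \<delta>)"
        by (intro mult_left_mono small y) (auto simp: C'_def)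
      moreover have "y2 powr (-\<alpha>) * (c - C' * y2 powr (-\<delta>)) = c * y2 powr (-\<alpha>) - C' * (y2 powr (-\<delta>) * y2 powr (-\<alpha>))"
        by (simp only: algebra_simps)
      ultimately show ?thesis by linarith
    qed
    have diff: "y1 powr (-\<alpha>) - y2 powr (-\<alpha>) \<le> 3 * w * (\<alpha> * (r / 2) powr (-\<alpha> - 1))"
    proof -
      have "\<exists>z. y1 < z \<and> z < y2 \<and> y2 powr (-\<alpha>) - y1 powr (-\<alpha>) = (y2 - y1) * (- \<alpha> * z powr (-\<alpha> - 1))"
        by (rule MVT2) (use y in \<open>auto intro!: derivative_eq_intros\<close>)
      then obtain z where z: "y1 < z" "z < y2" "y2 powr (-\<alpha>) - y1 powr (-\<alpha>) = (y2 - y1) * (- \<alpha> * z powr (-\<alpha> - 1))"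
        by blast
      have "y1 powr (-\<alpha>) - y2 powr (-\<alpha>) = 3 * w * (\<alpha> * z powr (-\<alpha> - 1))"
        using z(3) by (simp add: y1_def y2_def algebra_simps)
      also have "\<dots> \<le> 3 * w * (\<alpha> * (r / 2) powr (-\<alpha> - 1))"
        using z y w alpha xx by (intro mult_left_mono powr_mono2') auto
      finally show ?thesis .
    qed
    have "prob {s. \<bar>\<bar>x\<bar> + s\<bar> \<le> w} \<le> prob ({..<-y1} - {..<-y2})"
      using w by (intro finite_measure_mono) (auto simp: y1_def y2_def r_def)
    also have "\<dots> = F y1 - F y2"
      unfolding F_def using y by (intro finite_measure_Diff) auto
    also have "\<dots> \<le> c * (y1 powr (-\<alpha>) - y2 powr (-\<alpha>)) + 2 * C' * (r / 2) powr (-\<alpha> - \<delta>)"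
      using F1 F2 by (simp add: algebra_simps)
    also have "\<dots> \<le> c * (3 * w * (\<alpha> * (r / 2) powr (-\<alpha> - 1))) + 2 * C' * (r / 2) powr (-\<alpha> - \<delta>)"
      using diff c_pos by (intro add_right_mono mult_left_mono) auto
    also have "(r / 2) powr (-\<alpha> - 1) = 2 powr (\<alpha> + 1) * r powr (-\<alpha> - 1)"
    proof -
      have "(r / 2) powr (-\<alpha> - 1) = r powr (-\<alpha> - 1) / 2 powr (- (\<alpha> + 1))"
        using xx by (subst powr_divide) auto
      then show ?thesis unfolding powr_minus_divide by simp
    qed
    also have "(r / 2) powr (-\<alpha> - \<delta>) = 2 powr (\<alpha> + \<delta>) * r powr (-\<alpha> - \<delta>)"
    proof -
      have "(r / 2) powr (-\<alpha> - \<delta>) = r powr (-\<alpha> - \<delta>) / 2 powr (- (\<alpha> + \<delta>))"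
        using xx by (subst powr_divide) auto
      then show ?thesis unfolding powr_minus_divide by simp
    qed
    finally show ?thesis by (simp add: C1_def C2_def r_def mult_ac)
  qed
  moreover have "R \<ge> R0" "C1 \<ge> 0" "C2 \<ge> 0" using x0 c_pos alpha by (auto simp: R_def C1_def C2_def C'_def)
  ultimately show ?thesis using x0(2) by blast
qed

text \<open>The excess of the negative power over its value at N is the integral of \<nu> w^(-\<nu>
  - 1) from the landing distance to N. Exchanging integrals leaves small-ball probabilities, and the
  bound \<nu> \<le> 1/2 replaces 1/(1 - \<nu>) by 2.\<close>

lemma small_ball_remainder:
  assumes x: "x \<noteq> 0" and r: "r = \<bar>x\<bar>" and N: "1 \<le> N" and \<nu>: "0 < \<nu>" "\<nu> \<le> 1/2" and k: "0 \<le> k1" "0 \<le> k2"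
    and ball: "\<And>w. 1 \<le> w \<Longrightarrow> w \<le> N \<Longrightarrow> measure (law x) {s. \<bar>r + s\<bar> \<le> w} \<le> k1 * w + k2"
  shows "(\<integral>\<^sup>+s. ennreal (max 0 ((max \<bar>r + s\<bar> 1) powr (-\<nu>) - N powr (-\<nu>))) \<partial>law x)
    \<le> ennreal (2 * \<nu> * k1 * N powr (1 - \<nu>) + k2)"
proof -
  interpret prob_space "law x" by (rule prob_law)
  interpret pair_sigma_finite lborel "law x" ..
  \<comment> \<open>Integrated over w this dominates the excess; integrated over s it gives the
    weight times the probability of the ball of radius w.\<close>
  define u where "u w s = ennreal (\<nu> * w powr (-\<nu> - 1)) * indicator {max \<bar>r + s\<bar> 1..N} w" for w s :: real
  have um[measurable]: "case_prod u \<in> borel_measurable (lborel \<Otimes>\<^sub>M law x)"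
  proof -
    have "case_prod u = (\<lambda>p. ennreal (\<nu> * fst p powr (-\<nu> - 1)) * (if max \<bar>r + snd p\<bar> 1 \<le> fst p \<and> fst p \<le> N then 1 else 0))"
      by (auto simp: u_def fun_eq_iff indicator_def)
    then show ?thesis by (simp only:) measurable
  qed
  have rem: "ennreal (max 0 ((max \<bar>r + s\<bar> 1) powr (-\<nu>) - N powr (-\<nu>))) \<le> (\<integral>\<^sup>+w. u w s \<partial>lborel)" for s
  proof (cases "max \<bar>r + s\<bar> 1 \<le> N")
    case True
    have "(\<integral>\<^sup>+w. u w s \<partial>lborel) = ennreal (- (N powr (-\<nu>)) - - ((max \<bar>r + s\<bar> 1) powr (-\<nu>)))"
      unfolding u_def
    proof (rule nn_integral_FTC_Icc[where F="\<lambda>w. - (w powr (-\<nu>))"])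
      show "((\<lambda>w. - (w powr (-\<nu>))) has_real_derivative \<nu> * w powr (-\<nu> - 1)) (at w)"
        if "w \<in> {max \<bar>r + s\<bar> 1..N}" for w
        using that by (auto intro!: derivative_eq_intros)
    qed (use True \<nu> in auto)
    moreover have "N powr (-\<nu>) \<le> (max \<bar>r + s\<bar> 1) powr (-\<nu>)" using True \<nu> by (intro powr_mono2') auto
    ultimately show ?thesis by simp
  next
    case False
    then have "(max \<bar>r + s\<bar> 1) powr (-\<nu>) \<le> N powr (-\<nu>)" using N \<nu> by (intro powr_mono2') auto
    then show ?thesis by simp
  qed
  have "(\<integral>\<^sup>+s. ennreal (max 0 ((max \<bar>r + s\<bar> 1) powr (-\<nu>) - N powr (-\<nu>))) \<partial>law x) \<le> (\<integral>\<^sup>+s. (\<integral>\<^sup>+w. u w s \<partial>lborel) \<partial>law x)"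
    by (intro nn_integral_mono rem)
  also have "\<dots> = (\<integral>\<^sup>+w. (\<integral>\<^sup>+s. u w s \<partial>law x) \<partial>lborel)"
    by (rule Fubini'[OF um])
  also have "\<dots> \<le> (\<integral>\<^sup>+w. ennreal (k1 * \<nu> * w powr (-\<nu>) + k2 * \<nu> * w powr (-\<nu> - 1)) * indicator {1..N} w \<partial>lborel)"
  proof (rule nn_integral_mono)
    fix w :: real
    show "(\<integral>\<^sup>+s. u w s \<partial>law x) \<le> ennreal (k1 * \<nu> * w powr (-\<nu>) + k2 * \<nu> * w powr (-\<nu> - 1)) * indicator {1..N} w"
    proof (cases "1 \<le> w \<and> w \<le> N")
      case True
      have "(\<integral>\<^sup>+s. u w s \<partial>law x) = (\<integral>\<^sup>+s. ennreal (\<nu> * w powr (-\<nu> - 1)) * indicator {s. \<bar>r + s\<bar> \<le> w} s \<partial>law x)"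
        using True by (intro nn_integral_cong) (auto simp: u_def indicator_def)
      also have "\<dots> = ennreal (\<nu> * w powr (-\<nu> - 1)) * emeasure (law x) {s. \<bar>r + s\<bar> \<le> w}"
        by (subst nn_integral_cmult_indicator) auto
      also have "\<dots> = ennreal (\<nu> * w powr (-\<nu> - 1) * prob {s. \<bar>r + s\<bar> \<le> w})"
        using \<nu> by (simp add: emeasure_eq_measure ennreal_mult)
      also have "\<dots> \<le> ennreal (\<nu> * w powr (-\<nu> - 1) * (k1 * w + k2))"
        using True \<nu> by (intro ennreal_leI mult_left_mono ball) auto
      also have "\<nu> * w powr (-\<nu> - 1) * (k1 * w + k2) = k1 * \<nu> * w powr (-\<nu>) + k2 * \<nu> * w powr (-\<nu> - 1)"
      proof -
        have "w powr (-\<nu> - 1) * w = w powr (-\<nu>)" using True by (simp add: powr_diff)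
        then show ?thesis by (simp add: algebra_simps)
      qed
      finally show ?thesis using True by simp
    next
      case False
      then have "u w s = 0" for s by (auto simp: u_def indicator_def)
      then show ?thesis by simp
    qed
  qed
  also have "\<dots> = ennreal ((k1 * \<nu> * N powr (1 - \<nu>) / (1 - \<nu>) - k2 * N powr (-\<nu>)) - (k1 * \<nu> * 1 powr (1 - \<nu>) / (1 - \<nu>) - k2 * 1 powr (-\<nu>)))"
  proof (rule nn_integral_FTC_Icc[where F="\<lambda>w. k1 * \<nu> * w powr (1 - \<nu>) / (1 - \<nu>) - k2 * w powr (-\<nu>)"])
    show "((\<lambda>w. k1 * \<nu> * w powr (1 - \<nu>) / (1 - \<nu>) - k2 * w powr (-\<nu>)) has_real_derivative
       k1 * \<nu> * w powr (-\<nu>) + k2 * \<nu> * w powr (-\<nu> - 1)) (at w)" if "w \<in> {1..N}" for w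
      using that \<nu> by (auto intro!: derivative_eq_intros)
  qed (use k \<nu> N in auto)
  also have "\<dots> \<le> ennreal (2 * \<nu> * k1 * N powr (1 - \<nu>) + k2)"
  proof (rule ennreal_leI)
    have "k1 * \<nu> * N powr (1 - \<nu>) / (1 - \<nu>) \<le> k1 * \<nu> * N powr (1 - \<nu>) / (1/2)"
      using k \<nu> by (intro divide_left_mono) auto
    moreover have "0 \<le> k2 * N powr (-\<nu>)" "0 \<le> k1 * \<nu> * 1 powr (1 - \<nu>) / (1 - \<nu>)" using k \<nu> by auto
    moreover have "k1 * \<nu> * N powr (1 - \<nu>) / (1/2) = 2 * \<nu> * k1 * N powr (1 - \<nu>)" "k2 * 1 powr (-\<nu>) = k2" by simp_all
    ultimately show "(k1 * \<nu> * N powr (1 - \<nu>) / (1 - \<nu>) - k2 * N powr (-\<nu>)) - (k1 * \<nu> * 1 powr (1 - \<nu>) / (1 - \<nu>) - k2 * 1 powr (-\<nu>))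
       \<le> 2 * \<nu> * k1 * N powr (1 - \<nu>) + k2" by linarith
  qed
  finally show ?thesis .
qed

text \<open>All terms are multiples of r^(-\<nu> - \<alpha>): the drift gains at least \<nu>
  \<Lambda> / 2, the part of the ball estimate linear in w costs 2 \<nu> C1 e^(1 - \<nu>), and the
  rate error has the extra decay r^(-(\<delta> - \<nu>)). Gain and main cost are both proportional
  to \<nu>, so e must be chosen small before \<nu> is.\<close>

lemma radial_drift:
  assumes rate: "cond_Tbal_rate X K \<alpha> c" and D: "drift_limit (\<alpha> - 1) b"
    and pos: "b + c * pi * cot (pi * \<alpha> / 2) > 0"
  shows "\<exists>\<nu>>0. \<exists>R\<ge>R0. \<forall>x\<in>X. R \<le> \<bar>x\<bar> \<longrightarrow>
    (\<integral>\<^sup>+z. ennreal (trunc_pow \<nu> 1 \<bar>z\<bar>) \<partial>Q x) \<le> ennreal (trunc_pow \<nu> 1 \<bar>x\<bar>)"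
proof -
  define \<Lambda> where "\<Lambda> = b + c * pi * cot (pi * \<alpha> / 2)"
  have \<Lambda>: "\<Lambda> > 0" using pos by (simp add: \<Lambda>_def)
  obtain Ra C1 C2 \<delta> where ball: "Ra \<ge> R0" "C1 \<ge> 0" "C2 \<ge> 0" "\<delta> > 0"
    "\<And>x w. x \<in> X \<Longrightarrow> Ra \<le> \<bar>x\<bar> \<Longrightarrow> 0 < w \<Longrightarrow> w \<le> \<bar>x\<bar> / 4 \<Longrightarrow>
    measure (law x) {s. \<bar>\<bar>x\<bar> + s\<bar> \<le> w} \<le> C1 * w * \<bar>x\<bar> powr (-\<alpha> - 1) + C2 * \<bar>x\<bar> powr (-\<alpha> - \<delta>)"
    using small_ball[OF rate] by blast
  \<comment> \<open>For \<nu> \<le> 1/2 one has e^(1 - \<nu>) \<le> sqrt e, so the smallness of e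
    does not depend on the later \<nu>; nor does \<open>C1\<close> depend on e.\<close>
  obtain e where e: "0 < e" "e < 1/4" "b + c * jump_int \<alpha> 0 e True > 3/4 * \<Lambda>" "2 * C1 * sqrt e < \<Lambda> / 4"
  proof -
    have "((\<lambda>e. b + c * jump_int \<alpha> 0 e True) \<longlongrightarrow> b + c * (pi * cot (pi * \<alpha> / 2))) (at_right 0)"
      by (intro tendsto_intros jump_int_tendsto_pi_cot alpha)
    then have "eventually (\<lambda>e. b + c * jump_int \<alpha> 0 e True > 3/4 * \<Lambda>) (at_right 0)"
    proof (rule order_tendstoD(1))
      have "b + c * (pi * cot (pi * \<alpha> / 2)) = \<Lambda>" by (simp add: \<Lambda>_def)
      then show "3/4 * \<Lambda> < b + c * (pi * cot (pi * \<alpha> / 2))" using \<Lambda> by simp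
    qed
    moreover have "((\<lambda>e. 2 * C1 * sqrt e) \<longlongrightarrow> 2 * C1 * sqrt 0) (at_right 0)"
      by (intro tendsto_intros)
    then have "eventually (\<lambda>e. 2 * C1 * sqrt e < \<Lambda> / 4) (at_right 0)"
      by (rule order_tendstoD(2)) (use \<Lambda> in simp)
    moreover have "eventually (\<lambda>e. 0 < e \<and> e < 1/4) (at_right (0::real))"
      by (auto simp: eventually_at_right_field intro!: exI[of _ "1/4"])
    ultimately have "eventually (\<lambda>e. 0 < e \<and> e < 1/4 \<and> b + c * jump_int \<alpha> 0 e True > 3/4 * \<Lambda> \<and> 2 * C1 * sqrt e < \<Lambda> / 4) (at_right 0)"
      by eventually_elim auto
    from eventually_happens[OF this] show ?thesis using that by auto
  qed
  have e2: "e < 1/2" using e by simp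
  obtain \<nu> where \<nu>: "0 < \<nu>" "\<nu> \<le> 1/2" "\<nu> < \<delta>" "b + c * jump_int \<alpha> (-\<nu>) e True > 5/8 * \<Lambda>"
  proof -
    \<comment> \<open>The shift by 2 makes every resulting \<nu> = - p n at most 1/2.\<close>
    define p where "p n = - (1 / (real n + 2))" for n
    have p01: "- 1 \<le> p n" "p n \<le> 1" for n
    proof -
      have "0 \<le> 1 / (real n + 2)" "1 / (real n + 2) \<le> 1" by (simp_all add: divide_le_eq)
      then show "- 1 \<le> p n" "p n \<le> 1" unfolding p_def by linarith+
    qed
    have plim: "p \<longlonglongrightarrow> 0" unfolding p_def by real_asymp
    have "(\<lambda>n. b + c * jump_int \<alpha> (p n) e True) \<longlonglongrightarrow> b + c * jump_int \<alpha> 0 e True"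
      by (intro tendsto_intros jump_int_tendsto_0[OF alpha e(1) e2 p01 plim])
    then have "eventually (\<lambda>n. b + c * jump_int \<alpha> (p n) e True > 5/8 * \<Lambda>) sequentially"
      by (rule order_tendstoD(1)) (use e \<Lambda> in simp)
    moreover have "eventually (\<lambda>n. p n > - \<delta>) sequentially"
      by (rule order_tendstoD(1)[OF plim]) (use ball in simp)
    ultimately have "eventually (\<lambda>n. b + c * jump_int \<alpha> (p n) e True > 5/8 * \<Lambda> \<and> p n > - \<delta>) sequentially"
      by eventually_elim auto
    from eventually_happens[OF this] obtain n where "b + c * jump_int \<alpha> (p n) e True > 5/8 * \<Lambda>" "p n > - \<delta>" by auto
    then show ?thesis by (intro that[of "- p n"]) (auto simp: p_def)
  qed
  obtain Rb where Rb: "Rb \<ge> R0" "\<And>x. x \<in> X \<Longrightarrow> Rb \<le> \<bar>x\<bar> \<Longrightarrow> integrable_bcut (-\<nu>) e True x"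
    "\<And>x. x \<in> X \<Longrightarrow> Rb \<le> \<bar>x\<bar> \<Longrightarrow> \<bar>\<bar>x\<bar> powr \<alpha> * mean_bcut (-\<nu>) e True x - (b + c * jump_int \<alpha> (-\<nu>) e True)\<bar> < \<Lambda> / 8"
    using generator_critical[OF D e(1) e2, of "-\<nu>" "\<Lambda> / 8" True] \<nu> alpha \<Lambda> by auto
  obtain Rc where Rc: "\<And>r. r \<ge> Rc \<Longrightarrow> C2 * r powr (- (\<delta> - \<nu>)) \<le> \<nu> * \<Lambda> / 4"
    using tendsto_0_eventually_bound[of "\<delta> - \<nu>" "\<nu> * \<Lambda> / 4" C2] \<nu> \<Lambda> by auto
  define R where "R = max (max Ra Rb) (max Rc (1 / e))"
  have "(\<integral>\<^sup>+z. ennreal (trunc_pow \<nu> 1 \<bar>z\<bar>) \<partial>Q x) \<le> ennreal (trunc_pow \<nu> 1 \<bar>x\<bar>)" if x: "x \<in> X" "R \<le> \<bar>x\<bar>" for x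
  proof -
    interpret prob_space "law x" by (rule prob_law)
    define r where "r = \<bar>x\<bar>"
    have xR: "Ra \<le> \<bar>x\<bar>" "Rb \<le> \<bar>x\<bar>" "Rc \<le> r" "1 / e \<le> r" using x by (auto simp: R_def r_def)
    have r: "r \<ge> 1" "r > 0" "x \<noteq> 0" using xR ball(1) R0_ge_1 by (auto simp: r_def)
    \<comment> \<open>The cut-off in absolute terms. Between 1 and N the capped power exceeds the
      cut-off power g by \<open>rem\<close>; beyond N the two agree.\<close>
    define N where "N = e * r"
    have N: "1 \<le> N" using xR(4) e by (simp add: N_def field_simps)
    define I where "I = (\<integral>s. bcut (-\<nu>) e True (1 + s / r) \<partial>law x)"
    have I: "r powr \<alpha> * I > \<Lambda> / 2" using Rb(3)[OF x(1) xR(2)] \<nu>(4) unfolding I_def r_def by linarith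
    note int = Rb(2)[OF x(1) xR(2), folded r_def]
    define g where "g s = r powr (-\<nu>) * (1 + (-\<nu>) * bcut (-\<nu>) e True (1 + s / r))" for s
    have gi: "integrable (law x) g"
      unfolding g_def by (intro integrable_mult_right Bochner_Integration.integrable_add integrable_const int)
    have gI: "(\<integral>s. g s \<partial>law x) = r powr (-\<nu>) * (1 - \<nu> * I)"
      using int unfolding g_def I_def by (simp add: prob_space)
    have geq: "g s = (max \<bar>r + s\<bar> N) powr (-\<nu>)" for s
    proof -
      have "r * \<bar>1 + s / r\<bar> = \<bar>r + s\<bar>"
      proof -
        have "r + s = r * (1 + s / r)" using r by (simp add: field_simps)
        then show ?thesis using r by (simp add: abs_mult)
      qed
      moreover have "r * max \<bar>1 + s / r\<bar> e = max (r * \<bar>1 + s / r\<bar>) (r * e)"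
        using r by (simp add: max_mult_distrib_left)
      ultimately have "max \<bar>r + s\<bar> N = r * max \<bar>1 + s / r\<bar> e" by (simp add: N_def mult.commute)
      then have "(max \<bar>r + s\<bar> N) powr (-\<nu>) = r powr (-\<nu>) * (max \<bar>1 + s / r\<bar> e) powr (-\<nu>)"
        by (simp add: powr_mult)
      also have "(max \<bar>1 + s / r\<bar> e) powr (-\<nu>) = 1 + (-\<nu>) * bcut (-\<nu>) e True (1 + s / r)"
        using bcut_powr(1)[of e "-\<nu>"] e \<nu> by simp
      finally show ?thesis by (simp add: g_def)
    qed
    define rem where "rem s = max 0 ((max \<bar>r + s\<bar> 1) powr (-\<nu>) - N powr (-\<nu>))" for s
    have rem_le: "trunc_pow \<nu> 1 \<bar>r + s\<bar> \<le> g s + rem s" for s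
    proof (cases "\<bar>r + s\<bar> \<le> N")
      case True then show ?thesis by (simp add: geq trunc_pow_def rem_def max_def)
    next
      case False then show ?thesis using N by (simp add: geq trunc_pow_def rem_def max_def)
    qed
    have gm[measurable]: "g \<in> borel_measurable borel" using borel_measurable_integrable[OF gi] by simp
    have rm[measurable]: "rem \<in> borel_measurable borel" unfolding rem_def by measurable
    have g0: "0 \<le> g s" and rem0: "0 \<le> rem s" for s by (simp_all add: geq rem_def)
    have remB: "(\<integral>\<^sup>+s. ennreal (rem s) \<partial>law x) \<le> ennreal (2 * \<nu> * (C1 * r powr (-\<alpha> - 1)) * N powr (1 - \<nu>) + C2 * r powr (-\<alpha> - \<delta>))"
      unfolding rem_def
    proof (rule small_ball_remainder[OF r(3) r_def N \<nu>(1,2)])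
      fix w assume w: "1 \<le> w" "w \<le> N"
      have "e * r \<le> 1/4 * r" using e r by (intro mult_right_mono) auto
      then have "w \<le> \<bar>x\<bar> / 4" using w by (simp add: N_def r_def)
      then show "prob {s. \<bar>r + s\<bar> \<le> w} \<le> C1 * r powr (-\<alpha> - 1) * w + C2 * r powr (-\<alpha> - \<delta>)"
        using ball(5)[OF x(1) xR(1), of w] w by (simp add: r_def mult_ac)
    qed (use ball in auto)
    have gE: "(\<integral>\<^sup>+s. ennreal (g s) \<partial>law x) = ennreal (r powr (-\<nu>) * (1 - \<nu> * I))"
      using nn_integral_eq_integral[OF gi] g0 gI by simp
    have gI0: "0 \<le> r powr (-\<nu>) * (1 - \<nu> * I)"
      unfolding gI[symmetric] using g0 by (intro Bochner_Integration.integral_nonneg)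
    have "(\<integral>\<^sup>+s. ennreal (trunc_pow \<nu> 1 \<bar>r + s\<bar>) \<partial>law x) \<le> (\<integral>\<^sup>+s. ennreal (g s) + ennreal (rem s) \<partial>law x)"
      using rem_le g0 rem0 by (intro nn_integral_mono) (simp flip: ennreal_plus add: ennreal_leI)
    also have "\<dots> = (\<integral>\<^sup>+s. ennreal (g s) \<partial>law x) + (\<integral>\<^sup>+s. ennreal (rem s) \<partial>law x)"
      by (rule nn_integral_add) auto
    also have "\<dots> \<le> ennreal (r powr (-\<nu>) * (1 - \<nu> * I)) + ennreal (2 * \<nu> * (C1 * r powr (-\<alpha> - 1)) * N powr (1 - \<nu>) + C2 * r powr (-\<alpha> - \<delta>))"
      unfolding gE by (rule add_left_mono[OF remB])
    also have "\<dots> = ennreal (r powr (-\<nu>) * (1 - \<nu> * I) + (2 * \<nu> * (C1 * r powr (-\<alpha> - 1)) * N powr (1 - \<nu>) + C2 * r powr (-\<alpha> - \<delta>)))"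
      using gI0 ball \<nu> by (intro ennreal_plus[symmetric]) auto
    also have "\<dots> \<le> ennreal (r powr (-\<nu>))"
    proof (rule ennreal_leI)
      \<comment> \<open>The common factor of the three terms. The gain exceeds \<Lambda> (5/8 - 1/8)
        = \<Lambda> / 2, times \<nu>, and the two costs are at most \<nu> \<Lambda> / 4
        each.\<close>
      define q where "q = r powr (-\<nu> - \<alpha>)"
      have q: "q \<ge> 0" by (simp add: q_def)
      have a1: "r powr (-\<nu>) * I = q * (r powr \<alpha> * I)"
        by (simp add: q_def mult.assoc[symmetric] powr_add[symmetric])
      have a2: "r powr (-\<alpha> - 1) * N powr (1 - \<nu>) = q * e powr (1 - \<nu>)"
      proof -
        have "N powr (1 - \<nu>) = e powr (1 - \<nu>) * r powr (1 - \<nu>)" by (simp add: N_def powr_mult)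
        moreover have "r powr (-\<alpha> - 1) * r powr (1 - \<nu>) = q"
          unfolding q_def powr_add[symmetric] by (rule arg_cong[where f="\<lambda>z. r powr z"]) simp
        ultimately show ?thesis by (simp add: mult_ac)
      qed
      have a3: "r powr (-\<alpha> - \<delta>) = q * r powr (- (\<delta> - \<nu>))"
        unfolding q_def powr_add[symmetric] by (rule arg_cong[where f="\<lambda>z. r powr z"]) simp
      have "e powr (1 - \<nu>) \<le> e powr (1/2)" using e \<nu> by (intro powr_mono') auto
      then have "2 * C1 * e powr (1 - \<nu>) \<le> 2 * C1 * sqrt e"
        using ball e by (intro mult_left_mono) (auto simp: powr_half_sqrt)
      then have "2 * C1 * e powr (1 - \<nu>) \<le> \<Lambda> / 4" using e by linarith
      then have b2: "\<nu> * (2 * C1 * e powr (1 - \<nu>)) \<le> \<nu> * (\<Lambda> / 4)" using \<nu> by (intro mult_left_mono) auto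
      have b1: "\<nu> * (\<Lambda> / 2) \<le> \<nu> * (r powr \<alpha> * I)" using I \<nu> by (intro mult_left_mono) auto
      have b3: "C2 * r powr (- (\<delta> - \<nu>)) \<le> \<nu> * \<Lambda> / 4" by (rule Rc[OF xR(3)])
      have "q * (- (\<nu> * (r powr \<alpha> * I)) + \<nu> * (2 * C1 * e powr (1 - \<nu>)) + C2 * r powr (- (\<delta> - \<nu>))) \<le> q * 0"
        using q by (rule mult_left_mono[rotated]) (use b1 b2 b3 in \<open>simp add: field_simps\<close>)
      moreover have "r powr (-\<nu>) * (1 - \<nu> * I) = r powr (-\<nu>) - \<nu> * (q * (r powr \<alpha> * I))"
        unfolding a1[symmetric] by (simp add: algebra_simps)
      moreover have "q * (- (\<nu> * (r powr \<alpha> * I)) + \<nu> * (2 * C1 * e powr (1 - \<nu>)) + C2 * r powr (- (\<delta> - \<nu>)))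
         = - (\<nu> * (q * (r powr \<alpha> * I))) + \<nu> * (2 * C1 * (q * e powr (1 - \<nu>))) + C2 * (q * r powr (- (\<delta> - \<nu>)))"
        by (simp only: distrib_left mult_minus_right mult_ac)
      moreover have "2 * \<nu> * (C1 * r powr (-\<alpha> - 1)) * N powr (1 - \<nu>) = \<nu> * (2 * C1 * (q * e powr (1 - \<nu>)))"
        unfolding a2[symmetric] by (simp only: mult_ac)
      moreover have "C2 * r powr (-\<alpha> - \<delta>) = C2 * (q * r powr (- (\<delta> - \<nu>)))" unfolding a3 ..
      ultimately show "r powr (-\<nu>) * (1 - \<nu> * I) + (2 * \<nu> * (C1 * r powr (-\<alpha> - 1)) * N powr (1 - \<nu>) + C2 * r powr (-\<alpha> - \<delta>)) \<le> r powr (-\<nu>)"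
        by linarith
    qed
    also have "r powr (-\<nu>) = trunc_pow \<nu> 1 \<bar>x\<bar>" using r by (simp add: trunc_pow_eq r_def)
    finally have "(\<integral>\<^sup>+s. ennreal (trunc_pow \<nu> 1 \<bar>r + s\<bar>) \<partial>law x) \<le> ennreal (trunc_pow \<nu> 1 \<bar>x\<bar>)" .
    moreover have "(\<integral>\<^sup>+z. ennreal (trunc_pow \<nu> 1 \<bar>sgn x * z\<bar>) \<partial>Q x) = (\<integral>\<^sup>+s. ennreal (trunc_pow \<nu> 1 \<bar>r + s\<bar>) \<partial>law x)"
      unfolding r_def by (rule law_nn_integral[OF r(3)]) measurable
    ultimately show ?thesis using r by (simp add: abs_mult abs_sgn_eq)
  qed
  moreover have "R \<ge> R0" using ball(1) by (simp add: R_def)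
  ultimately show ?thesis using \<nu>(1) by blast
qed

section \<open>Infinite return times\<close>

text \<open>A finite moment would make its tail contribution vanish by dominated convergence,
  whereas y^\<alpha> times the upper tail stays above c / 2. Jumps to the right suffice from either
  half-line, the tails being balanced.\<close>

lemma infinite_moment:
  assumes x: "x \<in> X" "R0 \<le> \<bar>x\<bar>"
  shows "(\<integral>\<^sup>+z. ennreal (z powr \<alpha>) * indicator {a..} z \<partial>Q x) = \<infinity>"
proof (rule ccontr)
  interpret prob_space "Q x" by (rule prob_Q)
  define h where "h z = ennreal (z powr \<alpha>) * indicator {a..} z" for z
  have [measurable]: "h \<in> borel_measurable borel" unfolding h_def by measurable
  assume "\<not> ?thesis"
  then have fin: "(\<integral>\<^sup>+z. h z \<partial>Q x) < \<infinity>" by (simp add: h_def top.not_eq_extremum)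
  have "(\<lambda>n. \<integral>\<^sup>+z. h z * indicator {x + real n<..} z \<partial>Q x) \<longlonglongrightarrow> (\<integral>\<^sup>+z. 0 \<partial>Q x)"
  proof (rule nn_integral_dominated_convergence[where w=h])
    show "AE z in Q x. (\<lambda>n. h z * indicator {x + real n<..} z) \<longlonglongrightarrow> 0"
    proof (rule AE_I2)
      fix z
      obtain n0 :: nat where n0: "z - x \<le> real n0" using real_arch_simple by blast
      have "eventually (\<lambda>n. 0 = h z * indicator {x + real n<..} z) sequentially"
        by (rule eventually_sequentiallyI[of n0]) (use n0 in auto)
      then show "(\<lambda>n. h z * indicator {x + real n<..} z) \<longlonglongrightarrow> 0" by (rule Lim_transform_eventually[OF tendsto_const])
    qed
  qed (use fin in \<open>auto simp: indicator_def\<close>)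
  then have lim: "(\<lambda>n. \<integral>\<^sup>+z. h z * indicator {x + real n<..} z \<partial>Q x) \<longlonglongrightarrow> 0" by simp
  obtain Y where Y: "\<And>y. y \<ge> Y \<Longrightarrow> \<bar>y powr \<alpha> * measure (law x) {y<..} - c\<bar> \<le> c / 2 \<and> \<bar>y powr \<alpha> * measure (law x) {..<-y} - c\<bar> \<le> c / 2"
    using law_tail_limit[of "c / 2"] c_pos x by auto
  have x0: "x \<noteq> 0" using x R0_ge_1 by auto
  have tl: "c / 2 \<le> y powr \<alpha> * prob {x + y<..}" if "y \<ge> max Y 0" for y
  proof -
    have y: "y \<ge> Y" "y \<ge> 0" using that by auto
    have "prob {x + y<..} = tail_plus K x y"
      unfolding tail_plus_def Q_eq[OF x(1)] using y by (intro arg_cong[where f="measure (K x)"]) (auto simp: pos_part_r_def)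
    then have "prob {x + y<..} = (if x > 0 then measure (law x) {y<..} else measure (law x) {..<-y})"
      using law_tail[OF x(1) x0 y(2)] by simp
    then show ?thesis using Y[OF y(1)] by (cases "x > 0"; simp only: if_True if_False; linarith)
  qed
  \<comment> \<open>Beyond x + n one has z \<ge> n / 2 once n \<ge> 2 |x|, and the tail there is at
    least (c / 2) n^(-\<alpha>).\<close>
  define k where "k = (1/2) powr \<alpha> * (c / 2)"
  have k: "k > 0" using c_pos by (simp add: k_def)
  obtain n0 :: nat where n0: "\<bar>Y\<bar> + 2 * \<bar>x\<bar> + 2 * \<bar>a\<bar> + 1 \<le> real n0" using real_arch_simple by blast
  have low: "ennreal k \<le> (\<integral>\<^sup>+z. h z * indicator {x + real n<..} z \<partial>Q x)" if n: "n \<ge> n0" for n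
  proof -
    have n': "\<bar>Y\<bar> + 2 * \<bar>x\<bar> + 2 * \<bar>a\<bar> + 1 \<le> real n" using n0 n by (meson of_nat_le_iff order_trans)
    have "k \<le> (real n / 2) powr \<alpha> * prob {x + real n<..}"
    proof -
      have "(real n / 2) powr \<alpha> = (1/2) powr \<alpha> * real n powr \<alpha>" using powr_mult[of "1/2" "real n" \<alpha>] by simp
      moreover have "c / 2 \<le> real n powr \<alpha> * prob {x + real n<..}" by (rule tl) (use n' in auto)
      ultimately show ?thesis by (simp add: k_def mult.assoc)
    qed
    then have "ennreal k \<le> ennreal ((real n / 2) powr \<alpha>) * emeasure (Q x) {x + real n<..}"
      by (simp add: emeasure_eq_measure ennreal_leI flip: ennreal_mult)
    also have "\<dots> = (\<integral>\<^sup>+z. ennreal ((real n / 2) powr \<alpha>) * indicator {x + real n<..} z \<partial>Q x)"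
      by (subst nn_integral_cmult_indicator) auto
    also have "\<dots> \<le> (\<integral>\<^sup>+z. h z * indicator {x + real n<..} z \<partial>Q x)"
    proof (rule nn_integral_mono)
      fix z
      have "(real n / 2) powr \<alpha> \<le> z powr \<alpha>" "a \<le> z" if "x + real n < z"
        using that n' alpha by (auto intro!: powr_mono2)
      then show "ennreal ((real n / 2) powr \<alpha>) * indicator {x + real n<..} z \<le> h z * indicator {x + real n<..} z"
        by (auto simp: h_def indicator_def ennreal_leI)
    qed
    finally show ?thesis .
  qed
  have "ennreal k \<le> 0"
    by (rule LIMSEQ_le_const[OF lim]) (use low in blast)
  then show False using k by simp
qed

text \<open>From z \<ge> 2a the expected time to reach [-a, a] is at least k z^\<alpha>. Averaging
  over the first jump from x gives a multiple of the infinite moment.\<close>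

lemma infinite_hit_time:
  assumes D: "drift_limit (\<alpha> - 1) b"
  shows "\<exists>a0. \<forall>a\<ge>a0. \<forall>x\<in>X. \<bar>x\<bar> > a \<longrightarrow> (\<Sum>m. surv {-a..a} m x) = \<infinity>"
proof -
  obtain R C where R: "R \<ge> R0" and C: "C > 0"
    and step: "\<And>y x. y \<ge> R \<Longrightarrow> x \<in> X \<Longrightarrow> (\<integral>\<^sup>+z. ennreal (trunc_pow 1 y z) \<partial>Q x) \<le> ennreal (trunc_pow 1 y x) + ennreal (C * y powr (-\<alpha>))"
    using slow_return[OF D] by blast
  have "(\<Sum>m. surv {-a..a} m x) = \<infinity>" if a: "a \<ge> R" and x: "x \<in> X" "\<bar>x\<bar> > a" for a x
  proof -
    define A where "A = {-a..a}"
    have [measurable]: "A \<in> sets borel" by (simp add: A_def)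
    have a1: "a \<ge> 1" using a R R0_ge_1 by linarith
    \<comment> \<open>Set so that k z^\<alpha> = 1 / (16 \<kappa>): about 1 / (4 \<kappa>) steps,
      each survived with probability at least 1/4.\<close>
    define k where "k = (1/2) powr \<alpha> / (16 * C)"
    have k: "k > 0" using C by (simp add: k_def)
    have far: "ennreal (k * z powr \<alpha>) \<le> (\<Sum>m. surv A m z)" if z: "z \<in> X" "z \<ge> 2 * a" for z
    proof -
      \<comment> \<open>At half the distance the truncated power of z equals 1/2, and [-a, a] still
        lies below level y.\<close>
      define y where "y = z / 2"
      have y: "y \<ge> a" "y \<ge> R" "y > 0" "z / y = 2" using z a a1 by (auto simp: y_def)
      have dz: "trunc_pow 1 y z = 1/2" using y by (simp add: trunc_pow_def powr_minus_divide)
      define \<kappa> where "\<kappa> = C * y powr (-\<alpha>)"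
      have \<kappa>: "\<kappa> > 0" using C y by (simp add: \<kappa>_def)
      have s: "1 \<le> ennreal (1/2) + of_nat m * ennreal \<kappa> + surv A m z" for m
        unfolding dz[symmetric]
      proof (rule surv_exit[where f="\<lambda>z. ennreal (trunc_pow 1 y z)"])
        show "1 \<le> ennreal (trunc_pow 1 y z)" if "z \<in> A" for z
          using that y by (simp add: A_def trunc_pow_eq_1)
        show "(\<integral>\<^sup>+y'. ennreal (trunc_pow 1 y y') \<partial>Q z) \<le> ennreal (trunc_pow 1 y z) + ennreal \<kappa>" if "z \<in> X" "z \<notin> A" for z
          unfolding \<kappa>_def by (rule step[OF y(2) that(1)])
      qed (use z in auto)
      \<comment> \<open>For m < N the accumulated defect m \<kappa> is at most 1/4, which leaves
        survival probability at least 1 - 1/2 - 1/4.\<close>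
      define N where "N = nat \<lceil>1 / (4 * \<kappa>)\<rceil>"
      have quarter: "ennreal (1/4) \<le> surv A m z" if m: "m < N" for m
      proof -
        have "real m < 1 / (4 * \<kappa>)" using m \<kappa> unfolding N_def by linarith
        then have mk: "real m * \<kappa> \<le> 1/4" using \<kappa> by (simp add: field_simps)
        have fin: "surv A m z < \<top>" using surv_le_1[of A m z] by (simp add: le_less_trans)
        obtain v where v: "surv A m z = ennreal v" "v \<ge> 0" using fin by (cases "surv A m z") auto
        have p: "0 \<le> real m * \<kappa>" using \<kappa> by simp
        have "of_nat m * ennreal \<kappa> = ennreal (real m * \<kappa>)"
          using \<kappa> by (simp add: ennreal_of_nat_eq_real_of_nat ennreal_mult)
        then have "1 \<le> ennreal (1/2) + ennreal (real m * \<kappa>) + ennreal v" using s[of m] v(1) by (simp only:)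
        also have "\<dots> = ennreal (1/2 + real m * \<kappa> + v)" using p v by simp
        finally have "1 \<le> 1/2 + real m * \<kappa> + v" by (simp only: ennreal_ge_1)
        then show ?thesis using mk v by (simp add: ennreal_leI)
      qed
      have "k * z powr \<alpha> = 1 / (16 * \<kappa>)"
      proof -
        have "z powr \<alpha> = 2 powr \<alpha> * y powr \<alpha>" using powr_mult[of 2 y \<alpha>] by (simp add: y_def)
        moreover have "(1/2) powr \<alpha> * 2 powr \<alpha> = (1::real)" using powr_mult[of "1/2" 2 \<alpha>] by simp
        ultimately have "(1/2) powr \<alpha> * z powr \<alpha> = y powr \<alpha>" by (simp add: mult.assoc[symmetric])
        then show ?thesis using y C by (simp add: k_def \<kappa>_def powr_minus field_simps)
      qed
      also have "\<dots> \<le> real N * (1/4)"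
      proof -
        have "1 / (4 * \<kappa>) \<le> real N" unfolding N_def by linarith
        then show ?thesis by (simp add: field_simps)
      qed
      finally have "ennreal (k * z powr \<alpha>) \<le> ennreal (real N * (1/4))" by (rule ennreal_leI)
      also have "\<dots> = (\<Sum>m<N. ennreal (1/4))" by (subst sum_ennreal) auto
      also have "\<dots> \<le> (\<Sum>m<N. surv A m z)" by (intro sum_mono quarter) auto
      also have "\<dots> \<le> (\<Sum>m. surv A m z)" by (rule sum_le_suminf) auto
      finally show ?thesis .
    qed
    have "\<infinity> = ennreal k * (\<integral>\<^sup>+z. ennreal (z powr \<alpha>) * indicator {2*a..} z \<partial>Q x)"
      using infinite_moment[of x "2 * a"] x a R k by (simp add: ennreal_mult_top)
    also have "\<dots> = (\<integral>\<^sup>+z. ennreal (k * z powr \<alpha>) * indicator {2*a..} z \<partial>Q x)"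
      using k by (subst nn_integral_cmult[symmetric]) (auto simp: ennreal_mult mult.assoc)
    also have "\<dots> \<le> (\<integral>\<^sup>+z. (\<Sum>m. surv A m z) \<partial>Q x)"
      by (rule Q_mono[OF x(1)]) (use far in \<open>auto simp: indicator_def\<close>)
    also have "\<dots> = (\<Sum>m. \<integral>\<^sup>+z. surv A m z \<partial>Q x)" by (rule nn_integral_suminf) simp
    \<comment> \<open>As x is outside A, one kernel step raises the index by one; the term for m = 0
      is then added back as a nonnegative one.\<close>
    also have "\<dots> = (\<Sum>m. surv A (Suc m) x)"
    proof -
      have "x \<notin> A" using x by (auto simp: A_def)
      then show ?thesis by simp
    qed
    also have "\<dots> \<le> (\<Sum>m. surv A m x)"
      using suminf_offset[of "\<lambda>m. surv A m x" 1] by simp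
    finally show ?thesis by (simp add: A_def top.extremum_unique)
  qed
  then show ?thesis by blast
qed

end

subsection \<open>Classification\<close>

lemma liminf_le_INFM:
  assumes "\<exists>\<^sub>\<infinity>n. u n \<le> (R::real)"
  shows "liminf (\<lambda>n. ereal (u n)) \<le> ereal R"
proof (rule ccontr)
  assume "\<not> ?thesis"
  then have "ereal R < liminf (\<lambda>n. ereal (u n))" by simp
  then have "eventually (\<lambda>n. ereal R < ereal (u n)) sequentially" by (rule less_LiminfD)
  then have "\<forall>\<^sub>\<infinity>n. R < u n" by (simp add: cofinite_eq_sequentially)
  with assms have "\<exists>\<^sub>\<infinity>n. u n \<le> R \<and> R < u n" by (rule INFM_conjI)
  then show False by (auto dest!: INFM_EX)
qed

lemma liminf_eq_minus_infinity:
  assumes "\<And>B. \<exists>\<^sub>\<infinity>n. u n \<le> - (B::real)"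
  shows "liminf (\<lambda>n. ereal (u n)) = - \<infinity>"
proof (rule ereal_bot)
  fix B show "liminf (\<lambda>n. ereal (u n)) \<le> ereal B"
    using liminf_le_INFM[OF assms[of "- B"]] by simp
qed

lemma limsup_eq_infinity:
  assumes "\<And>B. \<exists>\<^sub>\<infinity>n. (B::real) \<le> u n"
  shows "limsup (\<lambda>n. ereal (u n)) = \<infinity>"
proof -
  have "liminf (\<lambda>n. ereal (- u n)) = - \<infinity>"
    by (rule liminf_eq_minus_infinity) (use assms in simp)
  moreover have "liminf (\<lambda>n. ereal (- u n)) = - limsup (\<lambda>n. ereal (u n))"
    using ereal_Liminf_uminus[of sequentially "\<lambda>n. ereal (u n)"] by simp
  ultimately show ?thesis by (simp add: ereal_uminus_eq_reorder)
qed

lemma eventually_sequentially_shift: "\<forall>j. P (n + j) \<Longrightarrow> eventually P sequentially"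
  unfolding eventually_sequentially by (metis le_iff_add)

text \<open>Puts drift constant 0 on the recurrent side of the critical threshold.\<close>

lemma cot_neg:
  assumes "1 < a" "a < 2"
  shows "cot (pi * a / 2) < 0"
proof -
  have "sin (pi * a / 2) > 0" using assms by (intro sin_gt_zero) auto
  moreover have "sin (pi * a / 2 - pi / 2) > 0"
    using assms by (intro sin_gt_zero) (auto simp: field_simps)
  then have "cos (pi * a / 2) < 0" by (simp add: sin_diff)
  ultimately show ?thesis by (simp add: cot_def divide_neg_pos)
qed

context balanced_chain
begin

lemma trunc_log_bounded: "\<exists>B. \<forall>z. \<bar>z\<bar> \<le> k \<longrightarrow> trunc_log t z \<le> B"
proof (intro exI allI impI)
  fix z :: real assume "\<bar>z\<bar> \<le> k"
  then show "trunc_log t z \<le> ln (max k 1)" unfolding trunc_log_def by (intro ln_mono) auto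
qed

lemma trunc_log_unbounded: "\<exists>r. \<forall>z. r \<le> \<bar>z\<bar> \<longrightarrow> (t \<or> 0 < z) \<longrightarrow> L \<le> trunc_log t z"
proof (intro exI allI impI)
  fix z :: real assume z: "exp L \<le> \<bar>z\<bar>" "t \<or> 0 < z"
  have "L = ln (exp L)" by simp
  also have "\<dots> \<le> trunc_log t z" unfolding trunc_log_def using z by (intro ln_mono) auto
  finally show "L \<le> trunc_log t z" .
qed

text \<open>The threshold inequality is strict, so it persists for the jump integral with some fixed
  cut-off e, and the two-sided logarithm becomes a supermartingale outside a bounded set.\<close>

lemma infinitely_often_bounded:
  assumes N': "cond_N' X M \<xi>" and D: "drift_limit (\<alpha> - 1) b"
    and neg: "b + c * pi * cot (pi * \<alpha> / 2) < 0"
  shows "\<exists>R. \<forall>x\<in>X. AE \<omega> in M x. \<exists>\<^sub>\<infinity>n. \<bar>\<xi> n \<omega>\<bar> \<le> R"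
proof -
  have "((\<lambda>e. b + c * jump_int \<alpha> 0 e True) \<longlongrightarrow> b + c * (pi * cot (pi * \<alpha> / 2))) (at_right 0)"
    by (intro tendsto_intros jump_int_tendsto_pi_cot alpha)
  then have "eventually (\<lambda>e. b + c * jump_int \<alpha> 0 e True < 0) (at_right 0)"
  proof (rule order_tendstoD(2))
    show "b + c * (pi * cot (pi * \<alpha> / 2)) < 0" using neg by (simp only: mult.assoc)
  qed
  moreover have "eventually (\<lambda>e. 0 < e \<and> e < 1/2) (at_right (0::real))"
    by (auto simp: eventually_at_right_field intro!: exI[of _ "1/2"])
  ultimately have "eventually (\<lambda>e. 0 < e \<and> e < 1/2 \<and> b + c * jump_int \<alpha> 0 e True < 0) (at_right 0)"
    by eventually_elim auto
  from eventually_happens[OF this] obtain e where e: "0 < e" "e < 1/2" "b + c * jump_int \<alpha> 0 e True < 0" by auto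
  obtain R where R: "R \<ge> R0" "\<And>x. x \<in> X \<Longrightarrow> R \<le> \<bar>x\<bar> \<Longrightarrow> (\<integral>\<^sup>+z. ennreal (trunc_log True (sgn x * z)) \<partial>Q x) \<le> ennreal (trunc_log True \<bar>x\<bar>)"
    using log_drift[OF D e] by blast
  have "AE \<omega> in M x. \<exists>\<^sub>\<infinity>n. \<xi> n \<omega> \<in> {-R..R}" if x: "x \<in> X" for x
  proof (rule recurrence_criterion[OF N' x, where f="trunc_log True"])
    show "(\<integral>\<^sup>+y. ennreal (trunc_log True y) \<partial>Q z) \<le> ennreal (trunc_log True z)" if "z \<in> X" "z \<notin> {-R..R}" for z
    proof -
      have z: "R \<le> \<bar>z\<bar>" "z \<noteq> 0" using that R(1) R0_ge_1 by auto
      have "trunc_log True (sgn z * y) = trunc_log True y" for y using z by (simp add: trunc_log_def abs_mult abs_sgn_eq)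
      then show ?thesis using R(2)[OF that(1) z(1)] by (simp add: trunc_log_def)
    qed
    show "\<exists>B. \<forall>z. \<bar>z\<bar> \<le> k \<longrightarrow> trunc_log True z \<le> B" for k by (rule trunc_log_bounded)
    show "\<exists>r. \<forall>z. z \<notin> {-R..R} \<longrightarrow> r \<le> \<bar>z\<bar> \<longrightarrow> L \<le> trunc_log True z" for L
      using trunc_log_unbounded[of True L] by auto
  qed auto
  moreover have "y \<in> {-R..R} \<longleftrightarrow> \<bar>y\<bar> \<le> R" for y by auto
  ultimately show ?thesis by (intro exI[of _ R] ballI) (simp only:)
qed

lemma critical_null_recurrent:
  assumes N': "cond_N' X M \<xi>" and D: "drift_limit (\<alpha> - 1) b"
    and neg: "b + c * pi * cot (pi * \<alpha> / 2) < 0"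
  shows "null_recurrent X M \<xi>"
  unfolding null_recurrent_def
proof
  obtain R where R: "\<And>x. x \<in> X \<Longrightarrow> AE \<omega> in M x. \<exists>\<^sub>\<infinity>n. \<bar>\<xi> n \<omega>\<bar> \<le> R"
    using infinitely_often_bounded[OF N' D neg] by blast
  have "AE \<omega> in M x. liminf (\<lambda>n. ereal \<bar>\<xi> n \<omega>\<bar>) \<le> ereal R" if "x \<in> X" for x
    using R[OF that] by eventually_elim (rule liminf_le_INFM)
  then show "recurrent X M \<xi>" unfolding recurrent_def by blast
  show "\<exists>a0. \<forall>a\<ge>a0. \<forall>x\<in>X. a < \<bar>x\<bar> \<longrightarrow> (\<integral>\<^sup>+\<omega>. hit_time \<xi> a \<omega> \<partial>M x) = \<infinity>"
    using infinite_hit_time[OF D] expected_hit_time by simp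
qed

lemma subcritical_positive_recurrent:
  assumes D: "drift_limit \<gamma> b" and \<gamma>: "0 \<le> \<gamma>" "\<gamma> < \<alpha> - 1" and b: "b < 0"
  shows "positive_recurrent X M \<xi>"
proof -
  obtain A R where R: "R \<ge> R0" and step: "\<And>x. x \<in> X \<Longrightarrow> R \<le> \<bar>x\<bar> \<Longrightarrow>
    1 + (\<integral>\<^sup>+z. ennreal (A * \<bar>z\<bar> powr (1 + \<gamma>)) \<partial>Q x) \<le> ennreal (A * \<bar>x\<bar> powr (1 + \<gamma>))"
    using power_drift[OF D \<gamma> b] by blast
  have "(\<integral>\<^sup>+\<omega>. hit_time \<xi> a \<omega> \<partial>M x) < \<infinity>" if a: "a \<ge> R" and x: "x \<in> X" for a x
  proof -
    have "(\<Sum>m<N. surv {-a..a} m x) \<le> ennreal (A * \<bar>x\<bar> powr (1 + \<gamma>))" for N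
      by (rule surv_foster[OF _ _ x]) (use a step in auto)
    then have "(\<Sum>m. surv {-a..a} m x) \<le> ennreal (A * \<bar>x\<bar> powr (1 + \<gamma>))"
      unfolding suminf_eq_SUP by (intro SUP_least)
    also have "\<dots> < \<infinity>" by simp
    finally show ?thesis by (simp add: expected_hit_time[OF x])
  qed
  then show ?thesis unfolding positive_recurrent_def by blast
qed

text \<open>By (N') the region |z| \<ge> H is reached for every H, so the bound 1 - e on the escape
  probability is available for every e > 0. The event itself does not depend on e.\<close>

lemma escape_almost_surely:
  assumes N': "cond_N' X M \<xi>" and x: "x \<in> X"
    and [measurable]: "A1 \<in> sets borel" "A2 \<in> sets borel"
    and esc: "\<And>e. e > 0 \<Longrightarrow> \<exists>H. \<forall>z\<in>X. (H \<le> z \<longrightarrow> (\<forall>m. 1 \<le> ennreal e + surv A1 m z)) \<and> (z \<le> - H \<longrightarrow> (\<forall>m. 1 \<le> ennreal e + surv A2 m z))"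
  shows "AE \<omega> in M x. \<exists>n. (\<forall>j. \<xi> (n + j) \<omega> \<notin> A1) \<or> (\<forall>j. \<xi> (n + j) \<omega> \<notin> A2)"
proof -
  interpret prob_space "M x" by (rule prob_M[OF x])
  note [measurable] = xi_meas[OF x]
  let ?E = "{\<omega>\<in>space (M x). \<exists>n. (\<forall>j. \<xi> (n + j) \<omega> \<notin> A1) \<or> (\<forall>j. \<xi> (n + j) \<omega> \<notin> A2)}"
  have lim: "AE \<omega> in M x. limsup (\<lambda>n. ereal \<bar>\<xi> n \<omega>\<bar>) = \<infinity>"
    using N' x unfolding cond_N'_def by blast
  have "1 \<le> prob ?E + e" if e: "e > 0" for e
  proof -
    obtain H where H: "\<And>z m. z \<in> X \<Longrightarrow> H \<le> z \<Longrightarrow> 1 \<le> ennreal e + surv A1 m z"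
      "\<And>z m. z \<in> X \<Longrightarrow> z \<le> - H \<Longrightarrow> 1 \<le> ennreal e + surv A2 m z"
      using esc[OF e] by blast
    have "1 - e \<le> prob ?E"
    proof (rule escape_probability[OF x, where ?G1.0="{H..}" and ?G2.0="{..-H}"])
      show "AE \<omega> in M x. \<exists>n. \<xi> n \<omega> \<in> {H..} \<union> {..-H}"
        using lim
      proof eventually_elim
        case (elim \<omega>)
        then obtain j where "H \<le> \<bar>\<xi> (0 + j) \<omega>\<bar>" using limsup_inf_large[of "\<lambda>n. \<xi> n \<omega>"] by blast
        then show ?case by (intro exI[of _ j]) auto
      qed
    qed (use e H in auto)
    then show ?thesis by simp
  qed
  then have "1 \<le> prob ?E" by (rule field_le_epsilon)
  then have "prob ?E = 1" using prob_le_1[of ?E] by linarith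
  then show ?thesis by (subst (asm) prob_Collect_eq_1) auto
qed

text \<open>The coordinate h is z, -z or |z|, so one argument serves both half-lines and the radial
  case. The decay of the truncated power makes the probability of ever hitting A small when h z is
  large.\<close>

lemma escape_from_drift:
  assumes \<nu>: "\<nu> > 0" and L: "L \<ge> 1" and [measurable]: "h \<in> borel_measurable borel"
    and A: "A = {z. h z \<le> L}"
    and step: "\<And>z. z \<in> X \<Longrightarrow> L < h z \<Longrightarrow> (\<integral>\<^sup>+y. ennreal (trunc_pow \<nu> 1 (h y)) \<partial>Q z) \<le> ennreal (trunc_pow \<nu> 1 (h z))"
    and e: "e > 0"
  shows "\<exists>H. \<forall>z\<in>X. H \<le> h z \<longrightarrow> (\<forall>m. 1 \<le> ennreal e + surv A m z)"
proof -
  have Am[measurable]: "A \<in> sets borel" unfolding A by measurable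
  obtain H where H: "\<And>r. r \<ge> H \<Longrightarrow> L powr \<nu> * r powr (-\<nu>) \<le> e"
    using tendsto_0_eventually_bound[OF \<nu> e, of "L powr \<nu>"] by blast
  \<comment> \<open>The factor L^\<nu> normalises the supermartingale to be at least 1 on A.\<close>
  define f where "f z = ennreal (L powr \<nu> * trunc_pow \<nu> 1 (h z))" for z
  have [measurable]: "f \<in> borel_measurable borel" unfolding f_def by measurable
  have "1 \<le> ennreal e + surv A m z" if z: "z \<in> X" "max H 1 \<le> h z" for z m
  proof -
    have "1 \<le> f z + of_nat m * 0 + surv A m z"
    proof (rule surv_exit[where \<kappa>=0])
      show "1 \<le> f z" if "z \<in> A" for z
      proof -
        have "L powr (-\<nu>) \<le> trunc_pow \<nu> 1 (h z)"
          using that L \<nu> unfolding trunc_pow_def A by (intro powr_mono2') auto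
        then have "L powr \<nu> * L powr (-\<nu>) \<le> L powr \<nu> * trunc_pow \<nu> 1 (h z)" by (intro mult_left_mono) auto
        moreover have "L powr \<nu> * L powr (-\<nu>) = 1" using L by (simp add: powr_minus)
        ultimately show ?thesis by (simp add: f_def)
      qed
      show "(\<integral>\<^sup>+y. f y \<partial>Q z) \<le> f z + 0" if "z \<in> X" "z \<notin> A" for z
      proof -
        have "(\<integral>\<^sup>+y. f y \<partial>Q z) = ennreal (L powr \<nu>) * (\<integral>\<^sup>+y. ennreal (trunc_pow \<nu> 1 (h y)) \<partial>Q z)"
          unfolding f_def by (subst nn_integral_cmult[symmetric]) (auto simp: ennreal_mult)
        also have "\<dots> \<le> ennreal (L powr \<nu>) * ennreal (trunc_pow \<nu> 1 (h z))"
          using that by (intro mult_left_mono step) (auto simp: A)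
        also have "\<dots> = f z + 0" by (simp add: f_def ennreal_mult)
        finally show ?thesis .
      qed
    qed (use z in auto)
    moreover have "f z \<le> ennreal e"
      unfolding f_def using H[of "h z"] z by (intro ennreal_leI) (simp add: trunc_pow_eq)
    ultimately show ?thesis by (auto intro: order_trans add_right_mono)
  qed
  then show ?thesis by blast
qed

text \<open>For each level separately, almost every path finally stays above it or below its
  negative. Countably many levels are handled together, and the side must be the same for all of
  them.\<close>

lemma subcritical_directional_transient:
  assumes N': "cond_N' X M \<xi>" and D: "drift_limit \<gamma> b" and \<gamma>: "0 \<le> \<gamma>" "\<gamma> < \<alpha> - 1" and b: "b > 0"
  shows "directional_transient X M \<xi>"
  unfolding directional_transient_def
proof
  fix x assume x: "x \<in> X"
  obtain \<nu> R where \<nu>: "\<nu> > 0" and R: "R \<ge> R0" and step: "\<And>x. x \<in> X \<Longrightarrow> R \<le> \<bar>x\<bar> \<Longrightarrow>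
    (\<integral>\<^sup>+z. ennreal (trunc_pow \<nu> 1 (sgn x * z)) \<partial>Q x) \<le> ennreal (trunc_pow \<nu> 1 \<bar>x\<bar>)"
    using directional_drift[OF D \<gamma> b] by blast
  have R1: "R \<ge> 1" using R R0_ge_1 by linarith
  have "AE \<omega> in M x. \<exists>n. (\<forall>j. \<xi> (n + j) \<omega> \<notin> {z. z \<le> L}) \<or> (\<forall>j. \<xi> (n + j) \<omega> \<notin> {z. - z \<le> L})" if L: "L \<ge> R" for L
  proof (rule escape_almost_surely[OF N' x])
    fix e :: real assume e: "e > 0"
    have "\<exists>H. \<forall>z\<in>X. H \<le> z \<longrightarrow> (\<forall>m. 1 \<le> ennreal e + surv {z. z \<le> L} m z)"
    proof (rule escape_from_drift[OF \<nu> _ _ refl _ e])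
      show "(\<integral>\<^sup>+y. ennreal (trunc_pow \<nu> 1 y) \<partial>Q z) \<le> ennreal (trunc_pow \<nu> 1 z)" if "z \<in> X" "L < z" for z
        using step[OF that(1)] that L R1 by simp
    qed (use L R1 in auto)
    moreover have "\<exists>H. \<forall>z\<in>X. H \<le> - z \<longrightarrow> (\<forall>m. 1 \<le> ennreal e + surv {z. - z \<le> L} m z)"
    proof (rule escape_from_drift[OF \<nu> _ _ refl _ e])
      show "(\<integral>\<^sup>+y. ennreal (trunc_pow \<nu> 1 (- y)) \<partial>Q z) \<le> ennreal (trunc_pow \<nu> 1 (- z))" if "z \<in> X" "L < - z" for z
        using step[OF that(1)] that L R1 by simp
    qed (use L R1 in auto)
    ultimately obtain H1 H2 where "\<forall>z\<in>X. H1 \<le> z \<longrightarrow> (\<forall>m. 1 \<le> ennreal e + surv {z. z \<le> L} m z)"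
      "\<forall>z\<in>X. H2 \<le> - z \<longrightarrow> (\<forall>m. 1 \<le> ennreal e + surv {z. - z \<le> L} m z)" by blast
    then show "\<exists>H. \<forall>z\<in>X. (H \<le> z \<longrightarrow> (\<forall>m. 1 \<le> ennreal e + surv {z. z \<le> L} m z)) \<and>
       (z \<le> - H \<longrightarrow> (\<forall>m. 1 \<le> ennreal e + surv {z. - z \<le> L} m z))"
      by (intro exI[of _ "max H1 H2"]) auto
  qed auto
  then have "AE \<omega> in M x. \<forall>k::nat. \<exists>n. (\<forall>j. \<xi> (n + j) \<omega> \<notin> {z. z \<le> R + real k}) \<or> (\<forall>j. \<xi> (n + j) \<omega> \<notin> {z. - z \<le> R + real k})"
    by (subst AE_all_countable) auto
  then show "AE \<omega> in M x. filterlim (\<lambda>n. \<xi> n \<omega>) at_top sequentially \<or> filterlim (\<lambda>n. \<xi> n \<omega>) at_bot sequentially"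
  proof eventually_elim
    case (elim \<omega>)
    have ev: "(\<forall>\<^sub>F n in sequentially. \<xi> n \<omega> > R + real k) \<or> (\<forall>\<^sub>F n in sequentially. \<xi> n \<omega> < - (R + real k))" for k
    proof -
      have iff: "y \<notin> {z. z \<le> R + real k} \<longleftrightarrow> R + real k < y" "y \<notin> {z. - z \<le> R + real k} \<longleftrightarrow> y < - (R + real k)" for y
        by auto
      obtain n where "(\<forall>j. \<xi> (n + j) \<omega> > R + real k) \<or> (\<forall>j. \<xi> (n + j) \<omega> < - (R + real k))"
        using spec[OF elim, of k] unfolding iff by blast
      then show ?thesis by (auto intro: eventually_sequentially_shift)
    qed
    \<comment> \<open>The lowest level R decides the side: being finally above R excludes being
      finally below -(R + k), and conversely.\<close>
    show ?case
    proof (cases "\<forall>\<^sub>F n in sequentially. \<xi> n \<omega> > R")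
      case True
      have "\<forall>\<^sub>F n in sequentially. \<xi> n \<omega> > R + real k" for k
      proof (rule ccontr)
        assume "\<not> ?thesis"
        then have "\<forall>\<^sub>F n in sequentially. \<xi> n \<omega> < - (R + real k)" using ev by blast
        with True have "\<forall>\<^sub>F n in sequentially. False" by eventually_elim (use R1 in auto)
        then show False by simp
      qed
      then have "filterlim (\<lambda>n. \<xi> n \<omega>) at_top sequentially"
        unfolding filterlim_at_top
      proof (intro allI)
        fix Z
        assume *: "\<And>k. \<forall>\<^sub>F n in sequentially. \<xi> n \<omega> > R + real k"
        obtain k :: nat where k: "Z \<le> real k" using real_arch_simple by blast
        show "\<forall>\<^sub>F n in sequentially. Z \<le> \<xi> n \<omega>"
          using *[of k] by eventually_elim (use k R1 in auto)
      qed
      then show ?thesis ..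
    next
      case False
      have "\<forall>\<^sub>F n in sequentially. \<xi> n \<omega> < - (R + real k)" for k
      proof (rule ccontr)
        assume "\<not> ?thesis"
        then have "\<forall>\<^sub>F n in sequentially. \<xi> n \<omega> > R + real k" using ev by blast
        then have "\<forall>\<^sub>F n in sequentially. \<xi> n \<omega> > R" by eventually_elim auto
        then show False using False by blast
      qed
      then have "filterlim (\<lambda>n. \<xi> n \<omega>) at_bot sequentially"
        unfolding filterlim_at_bot
      proof (intro allI)
        fix Z
        assume *: "\<And>k. \<forall>\<^sub>F n in sequentially. \<xi> n \<omega> < - (R + real k)"
        obtain k :: nat where k: "- Z \<le> real k" using real_arch_simple by blast
        show "\<forall>\<^sub>F n in sequentially. \<xi> n \<omega> \<le> Z"
          using *[of k] by eventually_elim (use k R1 in auto)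
      qed
      then show ?thesis ..
    qed
  qed
qed

text \<open>The radial power gives |xi_n| to infinity. The one-sided logarithm, with e small enough
  for the given b, brings the path infinitely often below R' and, after reflection, infinitely often
  above -R'. At late times such visits lie far out on the respective side.\<close>

lemma critical_oscillatory_transient:
  assumes N': "cond_N' X M \<xi>" and rate: "cond_Tbal_rate X K \<alpha> c" and D: "drift_limit (\<alpha> - 1) b"
    and pos: "b + c * pi * cot (pi * \<alpha> / 2) > 0"
  shows "oscillatory_transient X M \<xi>"
  unfolding oscillatory_transient_def
proof
  fix x assume x: "x \<in> X"
  obtain \<nu> R where \<nu>: "\<nu> > 0" and R: "R \<ge> R0" and step: "\<And>x. x \<in> X \<Longrightarrow> R \<le> \<bar>x\<bar> \<Longrightarrow>
    (\<integral>\<^sup>+z. ennreal (trunc_pow \<nu> 1 \<bar>z\<bar>) \<partial>Q x) \<le> ennreal (trunc_pow \<nu> 1 \<bar>x\<bar>)"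
    using radial_drift[OF rate D pos] by blast
  have R1: "R \<ge> 1" using R R0_ge_1 by linarith
  \<comment> \<open>The two alternatives coincide, which lets the two-sided escape lemma serve the
    radial case.\<close>
  have "AE \<omega> in M x. \<exists>n. (\<forall>j. \<xi> (n + j) \<omega> \<notin> {z. \<bar>z\<bar> \<le> L}) \<or> (\<forall>j. \<xi> (n + j) \<omega> \<notin> {z. \<bar>z\<bar> \<le> L})" if L: "L \<ge> R" for L
  proof (rule escape_almost_surely[OF N' x])
    fix e :: real assume e: "e > 0"
    have "\<exists>H. \<forall>z\<in>X. H \<le> \<bar>z\<bar> \<longrightarrow> (\<forall>m. 1 \<le> ennreal e + surv {z. \<bar>z\<bar> \<le> L} m z)"
      by (rule escape_from_drift[OF \<nu> _ _ refl _ e]) (use step L R1 in auto)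
    then obtain H where "\<forall>z\<in>X. H \<le> \<bar>z\<bar> \<longrightarrow> (\<forall>m. 1 \<le> ennreal e + surv {z. \<bar>z\<bar> \<le> L} m z)" by blast
    then show "\<exists>H. \<forall>z\<in>X. (H \<le> z \<longrightarrow> (\<forall>m. 1 \<le> ennreal e + surv {z. \<bar>z\<bar> \<le> L} m z)) \<and>
       (z \<le> - H \<longrightarrow> (\<forall>m. 1 \<le> ennreal e + surv {z. \<bar>z\<bar> \<le> L} m z))"
      by (intro exI[of _ H]) auto
  qed auto
  then have trans: "AE \<omega> in M x. \<forall>k::nat. \<exists>n. \<forall>j. \<xi> (n + j) \<omega> \<notin> {z. \<bar>z\<bar> \<le> R + real k}"
    by (subst AE_all_countable) auto
  obtain e where e: "0 < e" "e < 1/2" "jump_int \<alpha> 0 e False \<le> - ((\<bar>b\<bar> + 1) / c)"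
    using jump_int_one_sided_unbounded[OF alpha] by blast
  \<comment> \<open>The target (|b| + 1) / c makes the critical quantity at most b - |b| - 1, which
    is negative for every b.\<close>
  have "c * jump_int \<alpha> 0 e False \<le> c * - ((\<bar>b\<bar> + 1) / c)" using e c_pos by (intro mult_left_mono) auto
  then have neg: "b + c * jump_int \<alpha> 0 e False < 0" using c_pos by simp
  obtain R' where R': "R' \<ge> R0" and step': "\<And>x. x \<in> X \<Longrightarrow> R' \<le> \<bar>x\<bar> \<Longrightarrow>
    (\<integral>\<^sup>+z. ennreal (trunc_log False (sgn x * z)) \<partial>Q x) \<le> ennreal (trunc_log False \<bar>x\<bar>)"
    using log_drift[OF D e(1,2) neg] by blast
  have R1': "R' \<ge> 1" using R' R0_ge_1 by linarith
  have low: "AE \<omega> in M x. \<exists>\<^sub>\<infinity>n. \<xi> n \<omega> \<in> {..R'}"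
  proof (rule recurrence_criterion[OF N' x, where f="trunc_log False"])
    show "(\<integral>\<^sup>+y. ennreal (trunc_log False y) \<partial>Q z) \<le> ennreal (trunc_log False z)" if "z \<in> X" "z \<notin> {..R'}" for z
      using step'[OF that(1)] that R1' by simp
    show "\<exists>B. \<forall>z. \<bar>z\<bar> \<le> k \<longrightarrow> trunc_log False z \<le> B" for k by (rule trunc_log_bounded)
    show "\<exists>r. \<forall>z. z \<notin> {..R'} \<longrightarrow> r \<le> \<bar>z\<bar> \<longrightarrow> L \<le> trunc_log False z" for L
    proof -
      obtain r where r: "\<And>z. r \<le> \<bar>z\<bar> \<Longrightarrow> 0 < z \<Longrightarrow> L \<le> trunc_log False z" using trunc_log_unbounded[of False L] by blast
      have "L \<le> trunc_log False z" if "z \<notin> {..R'}" "r \<le> \<bar>z\<bar>" for z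
        using that R1' by (intro r) auto
      then show ?thesis by blast
    qed
  qed auto
  have high: "AE \<omega> in M x. \<exists>\<^sub>\<infinity>n. \<xi> n \<omega> \<in> {-R'..}"
  proof (rule recurrence_criterion[OF N' x, where f="\<lambda>z. trunc_log False (- z)"])
    show "(\<integral>\<^sup>+y. ennreal (trunc_log False (- y)) \<partial>Q z) \<le> ennreal (trunc_log False (- z))" if "z \<in> X" "z \<notin> {-R'..}" for z
      using step'[OF that(1)] that R1' by simp
    show "\<exists>B. \<forall>z. \<bar>z\<bar> \<le> k \<longrightarrow> trunc_log False (- z) \<le> B" for k using trunc_log_bounded[of k False] by (metis abs_minus_cancel)
    show "\<exists>r. \<forall>z. z \<notin> {-R'..} \<longrightarrow> r \<le> \<bar>z\<bar> \<longrightarrow> L \<le> trunc_log False (- z)" for L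
    proof -
      obtain r where r: "\<And>z. r \<le> \<bar>z\<bar> \<Longrightarrow> 0 < z \<Longrightarrow> L \<le> trunc_log False z" using trunc_log_unbounded[of False L] by blast
      have "L \<le> trunc_log False (- z)" if "z \<notin> {-R'..}" "r \<le> \<bar>z\<bar>" for z
        using that R1' by (intro r) auto
      then show ?thesis by blast
    qed
  qed auto
  show "AE \<omega> in M x. filterlim (\<lambda>n. \<bar>\<xi> n \<omega>\<bar>) at_top sequentially \<and>
      liminf (\<lambda>n. ereal (\<xi> n \<omega>)) = - \<infinity> \<and> limsup (\<lambda>n. ereal (\<xi> n \<omega>)) = \<infinity>"
    using trans low high
  proof eventually_elim
    case (elim \<omega>)
    have ev: "\<forall>\<^sub>F n in sequentially. Z < \<bar>\<xi> n \<omega>\<bar>" for Z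
    proof -
      obtain k :: nat where k: "Z \<le> real k" using real_arch_simple by blast
      obtain n where n: "\<And>j. \<bar>\<xi> (n + j) \<omega>\<bar> > R + real k" using elim(1)[rule_format, of k] by (auto simp: not_le)
      have "Z < \<bar>\<xi> m \<omega>\<bar>" if "m \<ge> n" for m
        using n[of "m - n"] that k R1 by simp
      then show ?thesis unfolding eventually_sequentially by blast
    qed
    have "filterlim (\<lambda>n. \<bar>\<xi> n \<omega>\<bar>) at_top sequentially"
      unfolding filterlim_at_top using ev by (blast intro: eventually_mono less_imp_le)
    moreover have "liminf (\<lambda>n. ereal (\<xi> n \<omega>)) = - \<infinity>"
    proof (rule liminf_eq_minus_infinity)
      fix B
      have "\<forall>\<^sub>\<infinity>n. max R' B < \<bar>\<xi> n \<omega>\<bar>" using ev[of "max R' B"] unfolding cofinite_eq_sequentially .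
      with elim(2) have "\<exists>\<^sub>\<infinity>n. \<xi> n \<omega> \<in> {..R'} \<and> max R' B < \<bar>\<xi> n \<omega>\<bar>" by (rule INFM_conjI)
      then show "\<exists>\<^sub>\<infinity>n. \<xi> n \<omega> \<le> - B" by (rule INFM_mono) auto
    qed
    moreover have "limsup (\<lambda>n. ereal (\<xi> n \<omega>)) = \<infinity>"
    proof (rule limsup_eq_infinity)
      fix B
      have "\<forall>\<^sub>\<infinity>n. max R' B < \<bar>\<xi> n \<omega>\<bar>" using ev[of "max R' B"] unfolding cofinite_eq_sequentially .
      with elim(3) have "\<exists>\<^sub>\<infinity>n. \<xi> n \<omega> \<in> {-R'..} \<and> max R' B < \<bar>\<xi> n \<omega>\<bar>" by (rule INFM_conjI)
      then show "\<exists>\<^sub>\<infinity>n. B \<le> \<xi> n \<omega>" by (rule INFM_mono) auto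
    qed
    ultimately show ?case by blast
  qed
qed

end

theorem theorem2p7:
  fixes X :: "real set" and K :: "real \<Rightarrow> real measure"
    and M :: "real \<Rightarrow> 'a measure" and \<xi> :: "nat \<Rightarrow> 'a \<Rightarrow> real"
    and \<alpha> c \<gamma> b :: real
  assumes chain: "markov_chain X K M \<xi>"
    and N': "cond_N' X M \<xi>"
    and T: "cond_Tbal X K \<alpha> c"
    and D: "cond_D' X K \<gamma> b"
  shows "(\<gamma> > \<alpha> - 1 \<longrightarrow> null_recurrent X M \<xi>)
       \<and> (\<gamma> < \<alpha> - 1 \<and> b < 0 \<longrightarrow> positive_recurrent X M \<xi>)
       \<and> (\<gamma> < \<alpha> - 1 \<and> b > 0 \<longrightarrow> directional_transient X M \<xi>)
       \<and> (\<gamma> = \<alpha> - 1 \<and> b + c * pi * cot (pi * \<alpha> / 2) < 0 \<longrightarrow> null_recurrent X M \<xi>)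
       \<and> (cond_Tbal_rate X K \<alpha> c \<and> \<gamma> = \<alpha> - 1 \<and> b + c * pi * cot (pi * \<alpha> / 2) > 0
            \<longrightarrow> oscillatory_transient X M \<xi>)"
proof -
  interpret balanced_chain X K M \<xi> \<alpha> c
    by unfold_locales (rule chain, rule T)
  have D': "drift_limit \<gamma> b" by (rule drift_limit_cond_D'[OF D])
  have \<gamma>: "0 \<le> \<gamma>" using D by (simp add: cond_D'_def)
  \<comment> \<open>Instance b = 0 of the critical condition, used after weakening the drift
    condition when \<gamma> > \<alpha> - 1.\<close>
  have "0 + c * pi * cot (pi * \<alpha> / 2) < 0"
    using cot_neg[OF alpha] c_pos by (simp add: mult_pos_neg)
  then show ?thesis
    using critical_null_recurrent[OF N' drift_limit_weaken[OF D']]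
      subcritical_positive_recurrent[OF D' \<gamma>] subcritical_directional_transient[OF N' D' \<gamma>]
      critical_null_recurrent[OF N'] critical_oscillatory_transient[OF N'] D'
    by blast
qed

end
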